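(* Let $R$ be a commutative ring and $\mathfrak a\subseteq R$ an ideal. Let $\mathbf P$ denote one of the properties of being half-centred, centred, weakly quasifair, or weakly large quasifair. Consider the following statements: (1) $\mathfrak a$ has $\mathbf P$; (2) $S^{-1}\mathfrak a$ has $\mathbf P$ (as an ideal of $S^{-1}R$) for every subset $S\subseteq R$; (3) $\mathfrak a_{\mathfrak m}$ has $\mathbf P$ (as an ideal of $R_{\mathfrak m}$) for every $\mathfrak m\in\max(\mathfrak a)$. Then (1)$\Rightarrow$(2)$\Rightarrow$(3). If $\rho^{\mathfrak m}_{\mathfrak a}$ is an isomorphism for every $\mathfrak m\in\max(\mathfrak a)$, then (1)$\Leftrightarrow$(2)$\Leftrightarrow$(3).
   Context: Rings are commutative with unit (possibly zero). For a ring $R$, an ideal $\mathfrak a\subseteq R$ and an $R$-module $M$: $\operatorname{Var}(\mathfrak a)=\{\mathfrak p\in\operatorname{Spec}(R)\mid\mathfrak a\subseteq\mathfrak p\}$; $\min(\mathfrak a)$ and $\max(\mathfrak a)$ are the sets of minimal, resp. maximal, elements of $\operatorname{Var}(\mathfrak a)$; $\Gamma_{\mathfrak a}(M)=\{x\in M\mid\exists n\in\mathbb N:\mathfrak a^n\subseteq(0:_Rx)\}$; $\overline\Gamma_{\mathfrak a}(M)=\{x\in M\mid\mathfrak a\subseteq\sqrt{(0:_Rx)}\}$; $\operatorname{Ass}^{\mathrm f}_R(M)=\{\mathfrak p\in\operatorname{Spec}(R)\mid\exists x\in M:\mathfrak p\in\min(0:_Rx)\}$ (weak assassin). For a subset $S\subseteq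 R$, $S^{-1}$ denotes localisation at the multiplicative set generated by $S$; a subscript $\mathfrak m$ denotes localisation at $S=R\setminus\mathfrak m$. For every $R$-module $M$, the inclusion $\Gamma_{\mathfrak a}(M)\subseteq M$ induces a canonical monomorphism of functors (in $M$) $\rho^S_{\mathfrak a}\colon S^{-1}\Gamma_{\mathfrak a}(M)\to\Gamma_{S^{-1}\mathfrak a}(S^{-1}M)$; for $S=R\setminus\mathfrak p$ with $\mathfrak p$ prime it is denoted $\rho^{\mathfrak p}_{\mathfrak a}$. Being an isomorphism means being one for every $R$-module $M$. An ideal $\mathfrak a$ of a ring $R$ is weakly quasifair if $\operatorname{Ass}^{\mathrm f}_R(\Gamma_{\mathfrak a}(M))=\operatorname{Ass}^{\mathrm f}_R(M)\cap\operatorname{Var}(\mathfrak a)$ for every $R$-module $M$; weakly large quasifair if $\operatorname{Ass}^{\mathrm f}_R(\overline\Gamma_{\mathfrak a}(M))=\operatorname{Ass}^{\mathrm f}_R(M)\cap\operatorname{Var}(\mathfrak a)$ for every $R$-module $M$; centred if, for every $R$-module $M$, $\Gamma_{\mathfrak a}(M)=0\Leftrightarrow\operatorname{Ass}^{\mathrm f}_R(M)\cap\operatorname{Var}(\mathfrak a)=\emptyset$; half-centred if, for every $R$-module $M$, $\Gamma_{\mathfrak a}(M)=M\Leftrightarrow\operatorname{Ass}^{\mathrm f}_R(M)\subseteq\operatorname{Var}(\mathfrak a)$. *)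

theory Defs
  imports "HOL-Algebra.Module" "HOL-Algebra.Ideal_Product"
begin

section \<open>Spectrum, torsion functors and weak assassins\<close>

definition Spec :: "('a, 'b) ring_scheme \<Rightarrow> 'a set set" where
  "Spec R = {p. primeideal p R}"

definition Var :: "('a, 'b) ring_scheme \<Rightarrow> 'a set \<Rightarrow> 'a set set" where
  "Var R a = {p \<in> Spec R. a \<subseteq> p}"

definition min_Var :: "('a, 'b) ring_scheme \<Rightarrow> 'a set \<Rightarrow> 'a set set" where
  "min_Var R a = {p \<in> Var R a. \<forall>q\<in>Var R a. q \<subseteq> p \<longrightarrow> q = p}"

definition max_Var :: "('a, 'b) ring_scheme \<Rightarrow> 'a set \<Rightarrow> 'a set set" where
  "max_Var R a = {p \<in> Var R a. \<forall>q\<in>Var R a. p \<subseteq> q \<longrightarrow> q = p}"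

definition annihilator :: "('a, 'b) ring_scheme \<Rightarrow> ('a, 'm, 'c) module_scheme \<Rightarrow> 'm \<Rightarrow> 'a set" where
  "annihilator R M x = {r \<in> carrier R. r \<odot>\<^bsub>M\<^esub> x = \<zero>\<^bsub>M\<^esub>}"

definition radical :: "('a, 'b) ring_scheme \<Rightarrow> 'a set \<Rightarrow> 'a set" where
  "radical R a = {r \<in> carrier R. \<exists>n::nat. r [^]\<^bsub>R\<^esub> n \<in> a}"

text \<open>The power of \<open>a\<close> in \<^const>\<open>ideals_set\<close> is the ideal power, with zeroth power
  the unit ideal.\<close>

definition torsion ::
  "('a, 'b) ring_scheme \<Rightarrow> 'a set \<Rightarrow> ('a, 'm, 'c) module_scheme \<Rightarrow> 'm set" where
  "torsion R a M =
    {x \<in> carrier M. \<exists>n::nat. a [^]\<^bsub>ideals_set R\<^esub> n \<subseteq> annihilator R M x}"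

definition large_torsion ::
  "('a, 'b) ring_scheme \<Rightarrow> 'a set \<Rightarrow> ('a, 'm, 'c) module_scheme \<Rightarrow> 'm set" where
  "large_torsion R a M = {x \<in> carrier M. a \<subseteq> radical R (annihilator R M x)}"

definition weak_assassin ::
  "('a, 'b) ring_scheme \<Rightarrow> ('a, 'm, 'c) module_scheme \<Rightarrow> 'a set set" where
  "weak_assassin R M = {p \<in> Spec R. \<exists>x\<in>carrier M. p \<in> min_Var R (annihilator R M x)}"

text \<open>The type argument of the following properties is the universe from which the elements of
  the modules are taken; HOL cannot quantify over modules of all types inside a formula.\<close>

definition half_centred :: "'m itself \<Rightarrow> ('a, 'b) ring_scheme \<Rightarrow> 'a set \<Rightarrow> bool" where
  "half_centred (_ :: 'm itself) R a \<longleftrightarrow>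
    (\<forall>M :: ('a, 'm) module. module R M \<longrightarrow>
      (torsion R a M = carrier M \<longleftrightarrow> weak_assassin R M \<subseteq> Var R a))"

definition centred :: "'m itself \<Rightarrow> ('a, 'b) ring_scheme \<Rightarrow> 'a set \<Rightarrow> bool" where
  "centred (_ :: 'm itself) R a \<longleftrightarrow>
    (\<forall>M :: ('a, 'm) module. module R M \<longrightarrow>
      (torsion R a M = {\<zero>\<^bsub>M\<^esub>} \<longleftrightarrow> weak_assassin R M \<inter> Var R a = {}))"

definition weakly_quasifair :: "'m itself \<Rightarrow> ('a, 'b) ring_scheme \<Rightarrow> 'a set \<Rightarrow> bool" where
  "weakly_quasifair (_ :: 'm itself) R a \<longleftrightarrow>
    (\<forall>M :: ('a, 'm) module. module R M \<longrightarrow>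
      weak_assassin R (M\<lparr>carrier := torsion R a M\<rparr>) = weak_assassin R M \<inter> Var R a)"

definition weakly_large_quasifair :: "'m itself \<Rightarrow> ('a, 'b) ring_scheme \<Rightarrow> 'a set \<Rightarrow> bool" where
  "weakly_large_quasifair (_ :: 'm itself) R a \<longleftrightarrow>
    (\<forall>M :: ('a, 'm) module. module R M \<longrightarrow>
      weak_assassin R (M\<lparr>carrier := large_torsion R a M\<rparr>) = weak_assassin R M \<inter> Var R a)"

text \<open>Names for the four properties: a variable \<open>P\<close> ranging over the predicates themselves
  could not be applied to rings of different types, as is needed for \<open>R\<close> and its localisations.\<close>

datatype ideal_property = Half_Centred | Centred | Weakly_Quasifair | Weakly_Large_Quasifair

fun has_property ::
  "ideal_property \<Rightarrow> 'm itself \<Rightarrow> ('a, 'b) ring_scheme \<Rightarrow> 'a set \<Rightarrow> bool" where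
  "has_property Half_Centred U R a = half_centred U R a"
| "has_property Centred U R a = centred U R a"
| "has_property Weakly_Quasifair U R a = weakly_quasifair U R a"
| "has_property Weakly_Large_Quasifair U R a = weakly_large_quasifair U R a"


section \<open>Localisation\<close>

definition mult_closure :: "('a, 'b) ring_scheme \<Rightarrow> 'a set \<Rightarrow> 'a set" where
  "mult_closure R S = \<Inter>{T. submonoid T R \<and> S \<subseteq> T}"

text \<open>The fraction \<open>x/s\<close>, as an equivalence class of pairs.\<close>

definition frac :: "('a, 'b) ring_scheme \<Rightarrow> 'a set \<Rightarrow> ('a, 'm, 'c) module_scheme
    \<Rightarrow> 'm \<Rightarrow> 'a \<Rightarrow> ('m \<times> 'a) set" where
  "frac R S M x s =
    {(y, t). y \<in> carrier M \<and> t \<in> mult_closure R S \<and>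
      (\<exists>u\<in>mult_closure R S. u \<odot>\<^bsub>M\<^esub> (t \<odot>\<^bsub>M\<^esub> x) = u \<odot>\<^bsub>M\<^esub> (s \<odot>\<^bsub>M\<^esub> y))}"

definition self_module :: "('a, 'b) ring_scheme \<Rightarrow> ('a, 'a) module" where
  "self_module R = \<lparr>carrier = carrier R, mult = mult R, one = one R, zero = zero R,
    add = add R, smult = mult R\<rparr>"

text \<open>Operations on fractions are computed on all representatives; these yield the same class,
  so that the union over them is that class.\<close>

definition loc_ring :: "('a, 'b) ring_scheme \<Rightarrow> 'a set \<Rightarrow> ('a \<times> 'a) set ring" where
  "loc_ring R S =
    \<lparr>carrier = {frac R S (self_module R) r s |r s. r \<in> carrier R \<and> s \<in> mult_closure R S},
     mult = (\<lambda>X Y. \<Union>(r, s)\<in>X. \<Union>(r', s')\<in>Y.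
       frac R S (self_module R) (r \<otimes>\<^bsub>R\<^esub> r') (s \<otimes>\<^bsub>R\<^esub> s')),
     one = frac R S (self_module R) \<one>\<^bsub>R\<^esub> \<one>\<^bsub>R\<^esub>,
     zero = frac R S (self_module R) \<zero>\<^bsub>R\<^esub> \<one>\<^bsub>R\<^esub>,
     add = (\<lambda>X Y. \<Union>(r, s)\<in>X. \<Union>(r', s')\<in>Y.
       frac R S (self_module R) ((s' \<otimes>\<^bsub>R\<^esub> r) \<oplus>\<^bsub>R\<^esub> (s \<otimes>\<^bsub>R\<^esub> r')) (s \<otimes>\<^bsub>R\<^esub> s'))\<rparr>"

definition loc_ideal :: "('a, 'b) ring_scheme \<Rightarrow> 'a set \<Rightarrow> 'a set \<Rightarrow> ('a \<times> 'a) set set" where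
  "loc_ideal R S a = {frac R S (self_module R) r s |r s. r \<in> a \<and> s \<in> mult_closure R S}"

text \<open>A record of modules inherits the fields \<^const>\<open>mult\<close> and \<^const>\<open>one\<close> from rings; the
  module axioms do not mention them.\<close>

definition loc_module :: "('a, 'b) ring_scheme \<Rightarrow> 'a set \<Rightarrow> ('a, 'm, 'c) module_scheme
    \<Rightarrow> (('a \<times> 'a) set, ('m \<times> 'a) set) module" where
  "loc_module R S M =
    \<lparr>carrier = {frac R S M x s |x s. x \<in> carrier M \<and> s \<in> mult_closure R S},
     mult = undefined,
     one = undefined,
     zero = frac R S M \<zero>\<^bsub>M\<^esub> \<one>\<^bsub>R\<^esub>,
     add = (\<lambda>X Y. \<Union>(x, s)\<in>X. \<Union>(y, t)\<in>Y.
       frac R S M ((t \<odot>\<^bsub>M\<^esub> x) \<oplus>\<^bsub>M\<^esub> (s \<odot>\<^bsub>M\<^esub> y)) (s \<otimes>\<^bsub>R\<^esub> t)),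
     smult = (\<lambda>X Y. \<Union>(r, s)\<in>X. \<Union>(x, t)\<in>Y. frac R S M (r \<odot>\<^bsub>M\<^esub> x) (s \<otimes>\<^bsub>R\<^esub> t))\<rparr>"

definition module_iso :: "('a, 'b) ring_scheme \<Rightarrow> ('a, 'm, 'c) module_scheme
    \<Rightarrow> ('a, 'n, 'd) module_scheme \<Rightarrow> ('m \<Rightarrow> 'n) set" where
  "module_iso R M N =
    {f \<in> iso (add_monoid M) (add_monoid N).
      \<forall>r\<in>carrier R. \<forall>x\<in>carrier M. f (r \<odot>\<^bsub>M\<^esub> x) = r \<odot>\<^bsub>N\<^esub> f x}"

text \<open>The canonical map sends \<open>x/s\<close>, formed in the localisation of the torsion submodule, to
  \<open>x/s\<close>, formed in the localisation of the whole module.\<close>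

definition rho :: "('a, 'b) ring_scheme \<Rightarrow> 'a set \<Rightarrow> 'a set \<Rightarrow> ('a, 'm, 'c) module_scheme
    \<Rightarrow> ('m \<times> 'a) set \<Rightarrow> ('m \<times> 'a) set" where
  "rho R S a M =
    (\<lambda>X\<in>carrier (loc_module R S (M\<lparr>carrier := torsion R a M\<rparr>)). \<Union>(x, s)\<in>X. frac R S M x s)"

definition rho_iso :: "'m itself \<Rightarrow> ('a, 'b) ring_scheme \<Rightarrow> 'a set \<Rightarrow> 'a set \<Rightarrow> bool" where
  "rho_iso (_ :: 'm itself) R S a \<longleftrightarrow>
    (\<forall>M :: ('a, 'm) module. module R M \<longrightarrow>
      rho R S a M \<in> module_iso (loc_ring R S)
        (loc_module R S (M\<lparr>carrier := torsion R a M\<rparr>))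
        ((loc_module R S M)\<lparr>carrier :=
          torsion (loc_ring R S) (loc_ideal R S a) (loc_module R S M)\<rparr>))"

end

theory Submission
  imports Defs
begin

text \<open>
  \<^bold>\<open>Passing to localisations.\<close>  A module \<open>N\<close> over \<open>S\<^sup>-\<^sup>1R\<close> is also an \<open>R\<close>-module.  Its torsion and
  its large torsion are the same over both rings, and contraction of primes maps its weak
  assassin over \<open>S\<^sup>-\<^sup>1R\<close> bijectively onto that over \<open>R\<close> (\<open>min_ann_con\<close>), respecting the condition of
  containing the ideal.  Hence each of the four equivalences or equalities holds for \<open>N\<close> over
  \<open>S\<^sup>-\<^sup>1R\<close> if and only if it holds over \<open>R\<close> (\<open>property_at_restr\<close>).

  \<^bold>\<open>Returning from localisations.\<close>  Let \<open>M\<close> be an \<open>R\<close>-module.  One half of each property always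
  holds, since primes minimal over annihilators of torsion elements contain \<open>a\<close> and nonzero
  elements have such primes.  For the other half one uses that the weak assassin of \<open>M\<^sub>m\<close>
  consists of the localisations of those members of the weak assassin of \<open>M\<close> that lie below
  \<open>m\<close> (\<open>min_ann_fr\<close>), and that surjectivity of \<open>\<rho>\<close> clears denominators: if \<open>x / s\<close> is torsion,
  then \<open>u x\<close> is torsion for some \<open>u\<close> outside \<open>m\<close> (\<open>torsion_lift\<close>).  This suffices for three of the
  properties.

  The large torsion functor is not controlled by \<open>\<rho>\<close> directly: if \<open>y / 1\<close> lies in the large
  torsion of \<open>M\<^sub>m\<close>, then every \<open>g\<close> in \<open>a\<close> has a power killed by some multiple of \<open>y\<close>, but the
  multiplier depends on \<open>g\<close>.  Three ideas replace this.
  First, large torsion is a radical functor, and so a weakly large quasifair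
  ideal has the stronger property that, for \<open>p\<close> containing \<open>a\<close> and minimal over the annihilator of
  \<open>x\<close>, some multiple \<open>v x\<close> with \<open>v\<close> outside \<open>p\<close> is in the large torsion
  (\<open>weakly_large_quasifair_multiplier\<close>); such multipliers may be multiplied with each other.
  Second, \<open>\<rho>\<close> is applied to the quotient of \<open>M\<close> by \<open>\<surd>(0 : y) y\<close>.
  There \<open>y / 1\<close> is killed by \<open>a\<close> itself, which yields one \<open>u\<close> outside \<open>m\<close> such that the primes over
  \<open>(0 : y)\<close> that do not contain \<open>u\<close> all contain \<open>a\<close> (\<open>radical_quotient_lift\<close>).
  Third, the elements \<open>u\<close> that work in this sense for some multiple \<open>v x\<close> with \<open>v\<close> outside \<open>p\<close> form an
  ideal, which with \<open>a\<close> generates the unit ideal, so that \<open>1 = u + f\<close> with \<open>f\<close> in \<open>a\<close>.  As \<open>u f\<close>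
  is nilpotent on \<open>v x\<close>, the element \<open>z = u\<^sup>N v x\<close> is killed by \<open>f\<^sup>N\<close> for large \<open>N\<close>.  A prime over
  \<open>(0 : z)\<close> contains \<open>f\<close>, hence not \<open>u\<close>, hence \<open>a\<close>: thus \<open>z\<close> is in the large torsion, and
  \<open>p\<close> is minimal over its annihilator (\<open>weakly_large_quasifair_at\<close>).

  The properties quantify over modules on a fixed type, whereas \<open>M\<^sub>m\<close> lives on another
  one.  This is harmless because \<open>M\<^sub>m\<close> has at most as many elements as \<open>M\<close>
  (\<open>loc_module_embeds\<close>).
\<close>

section \<open>Prime ideals over a given ideal\<close>

text \<open>Krull's lemma.  Maximality is part of the conclusion so that the case \<open>W = {1}\<close> gives
  maximal ideals.\<close>

lemma (in cring) prime_avoiding: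
  assumes I: "ideal I R" and W: "W \<subseteq> carrier R" "\<one> \<in> W"
    and Wm: "\<And>x y. x \<in> W \<Longrightarrow> y \<in> W \<Longrightarrow> x \<otimes> y \<in> W" and disj: "I \<inter> W = {}"
  shows "\<exists>q. primeideal q R \<and> I \<subseteq> q \<and> q \<inter> W = {} \<and>
    (\<forall>J. ideal J R \<longrightarrow> q \<subseteq> J \<longrightarrow> J \<inter> W = {} \<longrightarrow> J = q)"
proof -
  define A where "A = {J. ideal J R \<and> I \<subseteq> J \<and> J \<inter> W = {}}"
  have "\<exists>q\<in>A. \<forall>X\<in>A. q \<subseteq> X \<longrightarrow> X = q"
  proof (rule subset_Zorn_nonempty)
    show "A \<noteq> {}" using I disj by (auto simp: A_def)
    fix C assume C: "C \<noteq> {}" "subset.chain A C"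
    then have CI: "ideal J R" if "J \<in> C" for J using that by (auto simp: pred_on.chain_def A_def)
    have cmp: "J \<subseteq> K \<or> K \<subseteq> J" if "J \<in> C" "K \<in> C" for J K
      using that C(2) by (auto simp: pred_on.chain_def)
    have sg: "subgroup J (add_monoid R)" if "J \<in> C" for J
      using CI[OF that] by (simp add: additive_subgroup.a_subgroup ideal.axioms(1))
    have "ideal (\<Union>C) R"
    proof (rule idealI[OF ring_axioms])
      show "subgroup (\<Union>C) (add_monoid R)"
      proof (rule group.subgroupI[OF a_group])
        show "\<Union>C \<subseteq> carrier (add_monoid R)" using CI ideal.Icarr by fastforce
        show "\<Union>C \<noteq> {}" using C(1) subgroup.one_closed[OF sg] by blast
        show "inv\<^bsub>add_monoid R\<^esub> x \<in> \<Union>C" if "x \<in> \<Union>C" for x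
          using that subgroup.m_inv_closed[OF sg] by blast
        show "x \<otimes>\<^bsub>add_monoid R\<^esub> y \<in> \<Union>C" if xy: "x \<in> \<Union>C" "y \<in> \<Union>C" for x y
        proof -
          obtain J where "J \<in> C" "x \<in> J" "y \<in> J" using xy cmp by blast
          then show ?thesis using subgroup.m_closed[OF sg] by blast
        qed
      qed
    qed (use CI ideal.I_l_closed ideal.I_r_closed in fast)+
    moreover have "I \<subseteq> \<Union>C \<and> \<Union>C \<inter> W = {}"
      using C by (fastforce simp: pred_on.chain_def A_def)
    ultimately show "\<Union>C \<in> A" by (simp add: A_def)
  qed
  then obtain q where qA: "q \<in> A" and max: "\<And>X. X \<in> A \<Longrightarrow> q \<subseteq> X \<Longrightarrow> X = q" by blast
  interpret q: ideal q R using qA by (simp add: A_def)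
  \<comment> \<open>An ideal strictly above \<open>q\<close> meets \<open>W\<close>.\<close>
  have big: "\<exists>w\<in>W. \<exists>i\<in>q. \<exists>r\<in>carrier R. w = i \<oplus> r \<otimes> x" if x: "x \<in> carrier R" "x \<notin> q" for x
  proof (rule ccontr)
    assume c: "\<not> ?thesis"
    let ?J = "q <+>\<^bsub>R\<^esub> PIdl x"
    have J: "ideal ?J R" using add_ideals[OF q.is_ideal cgenideal_ideal[OF x(1)]] .
    have "\<zero> \<in> PIdl x" "x \<in> PIdl x"
      using additive_subgroup.zero_closed[OF ideal.axioms(1)[OF cgenideal_ideal[OF x(1)]]]
        cgenideal_self[OF x(1)] by auto
    have "q \<subseteq> ?J"
    proof
      fix i assume "i \<in> q"
      then have "i = i \<oplus> \<zero>" using q.a_Hcarr by simp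
      then show "i \<in> ?J" using \<open>i \<in> q\<close> \<open>\<zero> \<in> PIdl x\<close> unfolding set_add_def' by blast
    qed
    moreover have "x \<in> ?J"
    proof -
      have "x = \<zero> \<oplus> x" using x by simp
      then show ?thesis using q.zero_closed \<open>x \<in> PIdl x\<close> unfolding set_add_def' by blast
    qed
    moreover have "?J \<inter> W = {}" using c unfolding set_add_def' cgenideal_def by blast
    ultimately show False using max[of ?J] J qA x(2) by (auto simp: A_def)
  qed
  have "primeideal q R"
  proof (rule primeidealI[OF q.is_ideal is_cring])
    show "carrier R \<noteq> q" using qA W by (auto simp: A_def)
    fix x y assume x: "x \<in> carrier R" and y: "y \<in> carrier R" and xy: "x \<otimes> y \<in> q"
    show "x \<in> q \<or> y \<in> q"
    proof (rule ccontr)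
      assume "\<not> ?thesis"
      with big x y obtain w i r v j s where *: "w \<in> W" "i \<in> q" "r \<in> carrier R" "w = i \<oplus> r \<otimes> x"
        "v \<in> W" "j \<in> q" "s \<in> carrier R" "v = j \<oplus> s \<otimes> y" by meson
      have ij: "i \<in> carrier R" "j \<in> carrier R" using * q.a_Hcarr by auto
      have "w \<otimes> v = (i \<otimes> v \<oplus> j \<otimes> (r \<otimes> x)) \<oplus> (r \<otimes> s) \<otimes> (x \<otimes> y)"
        unfolding *(4,8) using * ij x y by algebra
      moreover have "i \<otimes> v \<in> q" "j \<otimes> (r \<otimes> x) \<in> q" "(r \<otimes> s) \<otimes> (x \<otimes> y) \<in> q"
        using * x xy W by (auto intro: q.I_l_closed q.I_r_closed)
      then have "(i \<otimes> v \<oplus> j \<otimes> (r \<otimes> x)) \<oplus> (r \<otimes> s) \<otimes> (x \<otimes> y) \<in> q" by (intro q.a_closed)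
      ultimately show False using Wm[OF *(1,5)] qA by (simp add: A_def) blast
    qed
  qed
  moreover have "J = q" if "ideal J R" "q \<subseteq> J" "J \<inter> W = {}" for J
    using max[of J] that qA by (auto simp: A_def)
  ultimately show ?thesis using qA by (auto simp: A_def)
qed

lemma (in cring) ex_max_Var:
  assumes I: "ideal I R" "\<one> \<notin> I"
  obtains m where "primeideal m R" "I \<subseteq> m" "\<And>c. c \<subseteq> m \<Longrightarrow> m \<in> max_Var R c"
proof -
  have "I \<inter> {\<one>} = {}" using I by auto
  then obtain m where m: "primeideal m R" "I \<subseteq> m"
    "\<And>J. ideal J R \<Longrightarrow> m \<subseteq> J \<Longrightarrow> J \<inter> {\<one>} = {} \<Longrightarrow> J = m"
    using prime_avoiding[OF I(1), of "{\<one>}"] by (metis empty_iff empty_subsetI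
        insert_iff insert_subset l_one one_closed)
  have "q = m" if "primeideal q R" "m \<subseteq> q" for q
  proof (rule m(3)[OF _ that(2)])
    show "ideal q R" using that(1) by (rule primeideal.axioms(1))
    then show "q \<inter> {\<one>} = {}" using ideal.one_imp_carrier primeideal.I_notcarr[OF that(1)] by auto
  qed
  then show thesis using that[of m] m(1,2) by (auto simp: max_Var_def Var_def Spec_def)
qed

lemma (in cring) prime_one: "primeideal p R \<Longrightarrow> \<one> \<notin> p"
  using ideal.one_imp_carrier primeideal.I_notcarr primeideal.axioms(1) by blast

lemma (in cring) prime_zero: "primeideal p R \<Longrightarrow> \<zero> \<in> p"
  by (meson additive_subgroup.zero_closed ideal.axioms(1) primeideal.axioms(1))

lemma (in cring) prime_carr: "primeideal p R \<Longrightarrow> x \<in> p \<Longrightarrow> x \<in> carrier R"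
  by (meson ideal.Icarr primeideal.axioms(1))

lemma (in cring) prime_mult_iff:
  "primeideal p R \<Longrightarrow> x \<in> carrier R \<Longrightarrow> y \<in> carrier R \<Longrightarrow> x \<otimes> y \<in> p \<longleftrightarrow> x \<in> p \<or> y \<in> p"
  by (meson ideal.I_l_closed ideal.I_r_closed primeideal.I_prime primeideal.axioms(1))

lemma (in cring) prime_powD: "primeideal p R \<Longrightarrow> x \<in> carrier R \<Longrightarrow> x [^] (n::nat) \<in> p \<Longrightarrow> x \<in> p"
  by (induction n) (auto simp: prime_one prime_mult_iff)

text \<open>The intersection of a chain of primes is prime.  Zorn's lemma is applied to the
  complements, which turns descending chains into ascending ones.\<close>

lemma (in cring) min_prime_below:
  assumes P: "primeideal P R" and "I \<subseteq> P"
  obtains p where "p \<in> min_Var R I" "p \<subseteq> P"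
proof -
  define A where "A = {carrier R - q |q. primeideal q R \<and> I \<subseteq> q \<and> q \<subseteq> P}"
  have "\<exists>M\<in>A. \<forall>X\<in>A. M \<subseteq> X \<longrightarrow> X = M"
  proof (rule subset_Zorn_nonempty)
    show "A \<noteq> {}" using assms by (auto simp: A_def)
    fix C assume C: "C \<noteq> {}" "subset.chain A C"
    define D where "D = {q. primeideal q R \<and> I \<subseteq> q \<and> q \<subseteq> P \<and> carrier R - q \<in> C}"
    have DC: "X \<in> C \<longleftrightarrow> (\<exists>q\<in>D. X = carrier R - q)" for X
      using C(2) by (auto simp: D_def A_def pred_on.chain_def)
    have Dne: "D \<noteq> {}" using C(1) DC by auto
    have Dch: "q \<subseteq> q' \<or> q' \<subseteq> q" if "q \<in> D" "q' \<in> D" for q q'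
    proof -
      have "\<forall>X\<in>C. \<forall>Y\<in>C. X \<subseteq> Y \<or> Y \<subseteq> X" using C(2) by (auto simp: pred_on.chain_def)
      moreover have "carrier R - q \<in> C" "carrier R - q' \<in> C" using that by (auto simp: D_def)
      ultimately have "carrier R - q \<subseteq> carrier R - q' \<or> carrier R - q' \<subseteq> carrier R - q"
        by simp
      moreover have "q \<subseteq> carrier R" "q' \<subseteq> carrier R" using that prime_carr by (auto simp: D_def)
      ultimately show ?thesis by blast
    qed
    have Dp: "primeideal q R" if "q \<in> D" for q using that by (simp add: D_def)
    have "ideal (\<Inter>D) R" by (rule i_Intersect[OF _ Dne]) (simp add: Dp primeideal.axioms(1))
    moreover have "carrier R \<noteq> \<Inter>D" using Dne Dp prime_one by fastforce
    moreover have "x \<in> \<Inter>D \<or> y \<in> \<Inter>D"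
      if xy: "x \<in> carrier R" "y \<in> carrier R" "x \<otimes> y \<in> \<Inter>D" for x y
    proof (rule ccontr)
      assume "\<not> ?thesis"
      then obtain q q' where "q \<in> D" "x \<notin> q" "q' \<in> D" "y \<notin> q'" by blast
      with Dch obtain q0 where "q0 \<in> D" "x \<notin> q0" "y \<notin> q0" by blast
      then show False using xy prime_mult_iff[OF Dp, of q0 x y] by blast
    qed
    ultimately have "primeideal (\<Inter>D) R" by (intro primeidealI is_cring) auto
    moreover have "I \<subseteq> \<Inter>D" "\<Inter>D \<subseteq> P" using Dne by (auto simp: D_def)
    moreover have "\<Union>C = carrier R - \<Inter>D" using DC by blast
    ultimately show "\<Union>C \<in> A" by (auto simp: A_def)
  qed
  then obtain M where M: "M \<in> A" and M_max: "\<forall>X\<in>A. M \<subseteq> X \<longrightarrow> X = M" by blast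
  from M obtain p where p: "primeideal p R" "I \<subseteq> p" "p \<subseteq> P" and Mp: "M = carrier R - p"
    by (auto simp: A_def)
  have max: "\<And>X. X \<in> A \<Longrightarrow> carrier R - p \<subseteq> X \<Longrightarrow> X = carrier R - p"
    using M_max unfolding Mp by blast
  have "q = p" if q: "primeideal q R" "I \<subseteq> q" "q \<subseteq> p" for q
  proof -
    have "carrier R - q \<in> A" unfolding A_def using q p by blast
    then have "carrier R - q = carrier R - p" using max q by blast
    then show ?thesis using prime_carr[OF q(1)] prime_carr[OF p(1)] by blast
  qed
  then have "p \<in> min_Var R I" using p by (auto simp: min_Var_def Var_def Spec_def)
  then show thesis using p(3) by (rule that)
qed

text \<open>The local ring at a minimal prime \<open>p\<close> over \<open>I\<close> has \<open>p\<close> as its only prime over \<open>I\<close>, so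
  that every element of \<open>p\<close> is nilpotent there.  This criterion has no quantifier over
  primes, and all later arguments about weak assassins are computations with its exponents
  and its denominators \<open>t\<close>.\<close>

lemma (in cring) min_Var_iff:
  assumes I: "ideal I R"
  shows "p \<in> min_Var R I \<longleftrightarrow> primeideal p R \<and> I \<subseteq> p \<and>
    (\<forall>r\<in>p. \<exists>t\<in>carrier R - p. \<exists>n::nat. t \<otimes> r [^] n \<in> I)" (is "_ \<longleftrightarrow> ?C")
proof
  assume p: "p \<in> min_Var R I"
  then have pp: "primeideal p R" and Ip: "I \<subseteq> p"
    and min: "\<And>q. primeideal q R \<Longrightarrow> I \<subseteq> q \<Longrightarrow> q \<subseteq> p \<Longrightarrow> q = p"
    by (auto simp: min_Var_def Var_def Spec_def)
  have "\<exists>t\<in>carrier R - p. \<exists>n::nat. t \<otimes> r [^] n \<in> I" if r: "r \<in> p" for r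
  proof (rule ccontr)
    assume c: "\<not> ?thesis"
    have rR: "r \<in> carrier R" using prime_carr[OF pp r] .
    let ?W = "{t \<otimes> r [^] n |t (n::nat). t \<in> carrier R - p}"
    \<comment> \<open>A prime that avoids \<open>?W\<close> lies below \<open>p\<close> and misses \<open>r\<close>, against minimality.\<close>
    have one: "t \<in> ?W" if "t \<in> carrier R - p" for t
    proof -
      have "t = t \<otimes> r [^] (0::nat)" using that by simp
      then show ?thesis using that by blast
    qed
    have Wm: "x \<otimes> y \<in> ?W" if "x \<in> ?W" "y \<in> ?W" for x y
    proof -
      from that obtain t s and n k :: nat where *: "x = t \<otimes> r [^] n" "y = s \<otimes> r [^] k"
        "t \<in> carrier R - p" "s \<in> carrier R - p" by blast
      have "x \<otimes> y = (t \<otimes> s) \<otimes> (r [^] n \<otimes> r [^] k)"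
        unfolding * using *(3,4) rR by (simp add: m_ac)
      then have "x \<otimes> y = (t \<otimes> s) \<otimes> r [^] (n + k)" using rR by (simp add: nat_pow_mult)
      moreover have "t \<otimes> s \<in> carrier R - p" using *(3,4) prime_mult_iff[OF pp] by auto
      ultimately show ?thesis by blast
    qed
    have WR: "?W \<subseteq> carrier R" using rR by auto
    have W1: "\<one> \<in> ?W" using one prime_one[OF pp] by blast
    have "I \<inter> ?W = {}" using c by blast
    then have "\<exists>q. primeideal q R \<and> I \<subseteq> q \<and> q \<inter> ?W = {} \<and>
        (\<forall>J. ideal J R \<longrightarrow> q \<subseteq> J \<longrightarrow> J \<inter> ?W = {} \<longrightarrow> J = q)"
      by (intro prime_avoiding[OF I WR W1] Wm)
    then obtain q where q: "primeideal q R" "I \<subseteq> q" "q \<inter> ?W = {}" by (elim exE conjE) rule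
    have "q \<subseteq> p" using q(3) one prime_carr[OF q(1)] by blast
    then have "r \<in> q" using min q(1,2) r by blast
    moreover have "r = \<one> \<otimes> r [^] (1::nat)" using rR by simp
    then have "r \<in> ?W" using prime_one[OF pp] by blast
    ultimately show False using q(3) by blast
  qed
  then show ?C using pp Ip by blast
next
  assume C: ?C
  have "q = p" if q: "primeideal q R" "I \<subseteq> q" "q \<subseteq> p" for q
  proof -
    have "r \<in> q" if r: "r \<in> p" for r
    proof -
      obtain t and n :: nat where t: "t \<in> carrier R - p" "t \<otimes> r [^] n \<in> I" using C r by blast
      have rR: "r \<in> carrier R" using C prime_carr r by blast
      have "t \<in> q \<or> r [^] n \<in> q" using t q rR prime_mult_iff[OF q(1)] by blast
      then show ?thesis using t q prime_powD[OF q(1) rR] by blast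
    qed
    then show ?thesis using q by blast
  qed
  then show "p \<in> min_Var R I" using C by (auto simp: min_Var_def Var_def Spec_def)
qed

section \<open>Torsion and weak assassins, elementwise\<close>

context module begin

lemma smult_comm:
  "r \<in> carrier R \<Longrightarrow> s \<in> carrier R \<Longrightarrow> x \<in> carrier M \<Longrightarrow>
    r \<odot>\<^bsub>M\<^esub> (s \<odot>\<^bsub>M\<^esub> x) = s \<odot>\<^bsub>M\<^esub> (r \<odot>\<^bsub>M\<^esub> x)"
  by (metis R.m_comm smult_assoc1)

lemma smult_minus_eq_zero:
  "r \<in> carrier R \<Longrightarrow> s \<in> carrier R \<Longrightarrow> x \<in> carrier M \<Longrightarrow>
    (r \<ominus>\<^bsub>R\<^esub> s) \<odot>\<^bsub>M\<^esub> x = \<zero>\<^bsub>M\<^esub> \<longleftrightarrow> r \<odot>\<^bsub>M\<^esub> x = s \<odot>\<^bsub>M\<^esub> x"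
  by (simp add: R.minus_eq smult_l_distr smult_l_minus)
    (metis M.add.inv_closed M.minus_equality M.minus_minus M.r_neg smult_closed)

lemma annihilator_ideal:
  assumes x: "x \<in> carrier M"
  shows "ideal (annihilator R M x) R"
proof (rule idealI[OF R.ring_axioms])
  show "subgroup (annihilator R M x) (add_monoid R)"
    by (rule group.subgroupI[OF R.a_group])
      (use x in \<open>auto simp: annihilator_def smult_l_distr smult_l_minus a_inv_def[symmetric]
        intro: exI[of _ "\<zero>\<^bsub>R\<^esub>"]\<close>)
  show "r \<otimes>\<^bsub>R\<^esub> s \<in> annihilator R M x" "s \<otimes>\<^bsub>R\<^esub> r \<in> annihilator R M x"
    if "s \<in> annihilator R M x" "r \<in> carrier R" for r s
    using that x by (auto simp: annihilator_def smult_assoc1 smult_comm[of s r])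
qed

lemma min_ann_iff:
  assumes x: "x \<in> carrier M"
  shows "p \<in> min_Var R (annihilator R M x) \<longleftrightarrow> primeideal p R \<and>
    (\<forall>r\<in>carrier R. r \<odot>\<^bsub>M\<^esub> x = \<zero>\<^bsub>M\<^esub> \<longrightarrow> r \<in> p) \<and>
    (\<forall>r\<in>p. \<exists>t\<in>carrier R - p. \<exists>n::nat. t \<odot>\<^bsub>M\<^esub> (r [^]\<^bsub>R\<^esub> n \<odot>\<^bsub>M\<^esub> x) = \<zero>\<^bsub>M\<^esub>)"
proof -
  have "(\<exists>t\<in>carrier R - p. \<exists>n::nat. t \<otimes>\<^bsub>R\<^esub> r [^]\<^bsub>R\<^esub> n \<in> annihilator R M x) \<longleftrightarrow>
      (\<exists>t\<in>carrier R - p. \<exists>n::nat. t \<odot>\<^bsub>M\<^esub> (r [^]\<^bsub>R\<^esub> n \<odot>\<^bsub>M\<^esub> x) = \<zero>\<^bsub>M\<^esub>)"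
    if "primeideal p R" "r \<in> p" for r
    using that x R.prime_carr[of p r] by (auto simp: annihilator_def smult_assoc1 intro!: bex_cong)
  then show ?thesis
    unfolding R.min_Var_iff[OF annihilator_ideal[OF x]]
    by (intro conj_cong refl) (simp add: annihilator_def subset_iff, blast, simp)
qed

text \<open>The flexibility in the choice of \<open>x\<close> for a given \<open>p\<close>: denominators outside \<open>p\<close> may be
  cleared.\<close>

lemma min_ann_multiple:
  assumes p: "p \<in> min_Var R (annihilator R M x)" and x: "x \<in> carrier M"
    and v: "v \<in> carrier R - p"
  shows "p \<in> min_Var R (annihilator R M (v \<odot>\<^bsub>M\<^esub> x))"
proof -
  note P = p[unfolded min_ann_iff[OF x]]
  have vR: "v \<in> carrier R" using v by simp
  have "r \<in> p" if "r \<in> carrier R" "r \<odot>\<^bsub>M\<^esub> (v \<odot>\<^bsub>M\<^esub> x) = \<zero>\<^bsub>M\<^esub>" for r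
  proof -
    have "r \<otimes>\<^bsub>R\<^esub> v \<in> p" using that P vR x by (simp add: smult_assoc1)
    then show ?thesis using R.prime_mult_iff[of p r v] P v that by auto
  qed
  moreover have "\<exists>t\<in>carrier R - p. \<exists>n::nat. t \<odot>\<^bsub>M\<^esub> (r [^]\<^bsub>R\<^esub> n \<odot>\<^bsub>M\<^esub> (v \<odot>\<^bsub>M\<^esub> x)) = \<zero>\<^bsub>M\<^esub>"
    if r: "r \<in> p" for r
  proof -
    obtain t and n :: nat where t: "t \<in> carrier R - p" "t \<odot>\<^bsub>M\<^esub> (r [^]\<^bsub>R\<^esub> n \<odot>\<^bsub>M\<^esub> x) = \<zero>\<^bsub>M\<^esub>"
      using P r by blast
    have rR: "r \<in> carrier R" using P r R.prime_carr by blast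
    have "t \<odot>\<^bsub>M\<^esub> (r [^]\<^bsub>R\<^esub> n \<odot>\<^bsub>M\<^esub> (v \<odot>\<^bsub>M\<^esub> x)) = v \<odot>\<^bsub>M\<^esub> (t \<odot>\<^bsub>M\<^esub> (r [^]\<^bsub>R\<^esub> n \<odot>\<^bsub>M\<^esub> x))"
      using t(1) rR vR x smult_comm by simp
    then show ?thesis using t vR by auto
  qed
  ultimately show ?thesis using P vR x unfolding min_ann_iff[OF smult_closed[OF vR x]] by blast
qed

end

lemma weak_assassin_on:
  "weak_assassin R (M\<lparr>carrier := X\<rparr>) = (\<Union>x\<in>X. min_Var R (annihilator R M x))"
  by (auto simp: weak_assassin_def annihilator_def min_Var_def Var_def Spec_def)

lemma weak_assassin_eq:
  "weak_assassin R M = (\<Union>x\<in>carrier M. min_Var R (annihilator R M x))"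
  by (auto simp: weak_assassin_def min_Var_def Var_def)

text \<open>\<open>a\<^sup>n x = 0\<close>, unfolded one factor at a time, which replaces computations in the ideal
  \<open>a\<^sup>n\<close> by inductions over \<open>n\<close> for all \<open>x\<close> at once.\<close>

primrec power_kills :: "'a set \<Rightarrow> ('a, 'm, 'c) module_scheme \<Rightarrow> nat \<Rightarrow> 'm \<Rightarrow> bool" where
  "power_kills a M 0 x \<longleftrightarrow> x = \<zero>\<^bsub>M\<^esub>"
| "power_kills a M (Suc n) x \<longleftrightarrow> (\<forall>f\<in>a. power_kills a M n (f \<odot>\<^bsub>M\<^esub> x))"

locale module_ideal = module R M + ideal a R for R (structure) and M (structure) and a
begin

lemma aR: "f \<in> a \<Longrightarrow> f \<in> carrier R" by (rule Icarr)

lemma ideal_power: "ideal (a [^]\<^bsub>ideals_set R\<^esub> (n::nat)) R"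
proof (induction n)
  case 0
  then show ?case using R.oneideal by (simp add: ideals_set_def nat_pow_def)
next
  case (Suc n)
  then show ?case
    using R.ideal_prod_is_ideal[OF Suc is_ideal] by (simp add: ideals_set_def nat_pow_def)
qed

lemma ideal_power_Suc: "a [^]\<^bsub>ideals_set R\<^esub> Suc n = (a [^]\<^bsub>ideals_set R\<^esub> n) \<cdot>\<^bsub>R\<^esub> a"
  by (simp add: ideals_set_def nat_pow_def)

lemma power_kills_iff:
  "x \<in> carrier M \<Longrightarrow> a [^]\<^bsub>ideals_set R\<^esub> n \<subseteq> annihilator R M x \<longleftrightarrow> power_kills a M n x"
proof (induction n arbitrary: x)
  case 0
  have "a [^]\<^bsub>ideals_set R\<^esub> (0::nat) = carrier R" by (simp add: ideals_set_def nat_pow_def)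
  moreover have "x = \<zero>\<^bsub>M\<^esub>" if "carrier R \<subseteq> annihilator R M x"
    using that 0 smult_one[OF 0] R.one_closed by (auto simp: annihilator_def simp del: smult_one)
  ultimately show ?case using 0 by (auto simp: annihilator_def)
next
  case (Suc n)
  let ?A = "a [^]\<^bsub>ideals_set R\<^esub> n"
  have AR: "i \<in> ?A \<Longrightarrow> i \<in> carrier R" for i using ideal.Icarr[OF ideal_power] .
  have "?A \<cdot>\<^bsub>R\<^esub> a \<subseteq> annihilator R M x \<longleftrightarrow> (\<forall>f\<in>a. ?A \<subseteq> annihilator R M (f \<odot>\<^bsub>M\<^esub> x))"
  proof safe
    fix f i assume "?A \<cdot>\<^bsub>R\<^esub> a \<subseteq> annihilator R M x" "f \<in> a" "i \<in> ?A"
    moreover from this have "i \<otimes>\<^bsub>R\<^esub> f \<in> ?A \<cdot>\<^bsub>R\<^esub> a" by (intro ideal_prod.prod)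
    ultimately show "i \<in> annihilator R M (f \<odot>\<^bsub>M\<^esub> x)"
      using AR aR Suc.prems by (auto simp: annihilator_def smult_assoc1)
  next
    fix r assume *: "\<forall>f\<in>a. ?A \<subseteq> annihilator R M (f \<odot>\<^bsub>M\<^esub> x)" and "r \<in> ?A \<cdot>\<^bsub>R\<^esub> a"
    from this(2) show "r \<in> annihilator R M x"
    proof induction
      case (prod i j)
      then show ?case using * AR aR Suc.prems by (auto simp: annihilator_def smult_assoc1)
    next
      case (sum s1 s2)
      then show ?case using Suc.prems by (auto simp: annihilator_def smult_l_distr)
    qed
  qed
  then show ?case using Suc aR unfolding ideal_power_Suc by simp
qed

lemma torsion_iff: "x \<in> torsion R a M \<longleftrightarrow> x \<in> carrier M \<and> (\<exists>n. power_kills a M n x)"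
  using power_kills_iff by (auto simp: torsion_def)

lemma power_kills_smult:
  "power_kills a M n x \<Longrightarrow> x \<in> carrier M \<Longrightarrow> r \<in> carrier R \<Longrightarrow> power_kills a M n (r \<odot>\<^bsub>M\<^esub> x)"
  by (induction n arbitrary: x) (auto simp: aR smult_comm[of _ r])

lemma power_kills_add:
  "power_kills a M n x \<Longrightarrow> power_kills a M n y \<Longrightarrow> x \<in> carrier M \<Longrightarrow> y \<in> carrier M \<Longrightarrow>
    power_kills a M n (x \<oplus>\<^bsub>M\<^esub> y)"
  by (induction n arbitrary: x y) (auto simp: aR smult_r_distr)

lemma power_kills_mono:
  "power_kills a M n x \<Longrightarrow> x \<in> carrier M \<Longrightarrow> n \<le> k \<Longrightarrow> power_kills a M k x"
proof (induction k)
  case (Suc k)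
  then show ?case
    by (cases "n = Suc k") (auto intro!: power_kills_smult aR)
qed simp

lemma power_kills_pow:
  "power_kills a M n x \<Longrightarrow> x \<in> carrier M \<Longrightarrow> g \<in> a \<Longrightarrow> g [^]\<^bsub>R\<^esub> n \<odot>\<^bsub>M\<^esub> x = \<zero>\<^bsub>M\<^esub>"
proof (induction n arbitrary: x)
  case (Suc n)
  then have "g [^]\<^bsub>R\<^esub> n \<odot>\<^bsub>M\<^esub> (g \<odot>\<^bsub>M\<^esub> x) = \<zero>\<^bsub>M\<^esub>" by (simp add: aR)
  then show ?case using Suc aR by (simp add: smult_assoc1)
qed simp

lemma large_torsion_iff:
  "x \<in> large_torsion R a M \<longleftrightarrow>
    x \<in> carrier M \<and> (\<forall>g\<in>a. \<exists>n::nat. g [^]\<^bsub>R\<^esub> n \<odot>\<^bsub>M\<^esub> x = \<zero>\<^bsub>M\<^esub>)"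
  by (auto simp: large_torsion_def radical_def annihilator_def aR subset_iff)

lemma torsion_sub_large: "torsion R a M \<subseteq> large_torsion R a M"
  unfolding torsion_iff large_torsion_iff subset_iff using power_kills_pow by blast

lemma torsion_smult: "x \<in> torsion R a M \<Longrightarrow> r \<in> carrier R \<Longrightarrow> r \<odot>\<^bsub>M\<^esub> x \<in> torsion R a M"
  using power_kills_smult by (auto simp: torsion_iff)

lemma torsion_add:
  assumes "x \<in> torsion R a M" "y \<in> torsion R a M"
  shows "x \<oplus>\<^bsub>M\<^esub> y \<in> torsion R a M"
proof -
  obtain n k where "power_kills a M n x" "power_kills a M k y" and c: "x \<in> carrier M" "y \<in> carrier M"
    using assms by (auto simp: torsion_iff)
  then have "power_kills a M (max n k) x" "power_kills a M (max n k) y"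
    by (auto intro: power_kills_mono)
  then show ?thesis using c power_kills_add by (auto simp: torsion_iff)
qed

lemma zero_torsion: "\<zero>\<^bsub>M\<^esub> \<in> torsion R a M"
proof -
  have "power_kills a M 0 \<zero>\<^bsub>M\<^esub>" by simp
  then show ?thesis unfolding torsion_iff by blast
qed

lemma smult_pow_zero_mono:
  assumes "r [^]\<^bsub>R\<^esub> (n::nat) \<odot>\<^bsub>M\<^esub> x = \<zero>\<^bsub>M\<^esub>" "n \<le> k" "r \<in> carrier R" "x \<in> carrier M"
  shows "r [^]\<^bsub>R\<^esub> k \<odot>\<^bsub>M\<^esub> x = \<zero>\<^bsub>M\<^esub>"
proof -
  have "r [^]\<^bsub>R\<^esub> k = r [^]\<^bsub>R\<^esub> (k - n) \<otimes>\<^bsub>R\<^esub> r [^]\<^bsub>R\<^esub> n" using assms R.nat_pow_mult by simp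
  then show ?thesis using assms by (simp add: smult_assoc1)
qed

lemma large_torsion_smult:
  "x \<in> large_torsion R a M \<Longrightarrow> r \<in> carrier R \<Longrightarrow> r \<odot>\<^bsub>M\<^esub> x \<in> large_torsion R a M"
  unfolding large_torsion_iff
  by (auto simp: smult_comm[of _ r] aR) (metis smult_r_null)

lemma large_torsion_add:
  assumes "x \<in> large_torsion R a M" "y \<in> large_torsion R a M"
  shows "x \<oplus>\<^bsub>M\<^esub> y \<in> large_torsion R a M"
proof -
  have c: "x \<in> carrier M" "y \<in> carrier M" using assms by (auto simp: large_torsion_iff)
  have "\<exists>n::nat. g [^]\<^bsub>R\<^esub> n \<odot>\<^bsub>M\<^esub> (x \<oplus>\<^bsub>M\<^esub> y) = \<zero>\<^bsub>M\<^esub>" if g: "g \<in> a" for g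
  proof -
    obtain n k :: nat where nk: "g [^]\<^bsub>R\<^esub> n \<odot>\<^bsub>M\<^esub> x = \<zero>\<^bsub>M\<^esub>" "g [^]\<^bsub>R\<^esub> k \<odot>\<^bsub>M\<^esub> y = \<zero>\<^bsub>M\<^esub>"
      using assms g unfolding large_torsion_iff by blast
    have "g [^]\<^bsub>R\<^esub> max n k \<odot>\<^bsub>M\<^esub> x = \<zero>\<^bsub>M\<^esub>" "g [^]\<^bsub>R\<^esub> max n k \<odot>\<^bsub>M\<^esub> y = \<zero>\<^bsub>M\<^esub>"
      using smult_pow_zero_mono[OF nk(1)] smult_pow_zero_mono[OF nk(2)] aR[OF g] c by auto
    then show ?thesis using c aR[OF g] by (auto simp: smult_r_distr intro!: exI[of _ "max n k"])
  qed
  then show ?thesis using c by (auto simp: large_torsion_iff)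
qed

lemma large_torsion_submodule: "submodule (large_torsion R a M) R M"
proof (rule submoduleI)
  show "\<ominus>\<^bsub>M\<^esub> x \<in> large_torsion R a M" if "x \<in> large_torsion R a M" for x
  proof -
    have "(\<ominus>\<^bsub>R\<^esub> \<one>\<^bsub>R\<^esub>) \<odot>\<^bsub>M\<^esub> x \<in> large_torsion R a M" using that large_torsion_smult by simp
    moreover have "x \<in> carrier M" using that by (simp add: large_torsion_iff)
    ultimately show ?thesis by (simp add: smult_l_minus)
  qed
qed (use zero_torsion torsion_sub_large large_torsion_add large_torsion_smult in
    \<open>auto simp: large_torsion_iff\<close>)

text \<open>This lemma and the next one give the implications and inclusions that hold for every ideal
  in place of the four properties.\<close>

lemma large_torsion_min_ann:
  assumes "x \<in> large_torsion R a M" "p \<in> min_Var R (annihilator R M x)"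
  shows "p \<in> weak_assassin R M \<inter> Var R a"
proof -
  have x: "x \<in> carrier M" using assms by (simp add: large_torsion_iff)
  note P = assms(2)[unfolded min_ann_iff[OF x]]
  have "g \<in> p" if g: "g \<in> a" for g
  proof -
    obtain n :: nat where "g [^]\<^bsub>R\<^esub> n \<odot>\<^bsub>M\<^esub> x = \<zero>\<^bsub>M\<^esub>" using assms g unfolding large_torsion_iff by blast
    then have "g [^]\<^bsub>R\<^esub> n \<in> p" using P aR[OF g] by blast
    then show ?thesis using R.prime_powD P aR[OF g] by blast
  qed
  then show ?thesis using assms x P by (auto simp: weak_assassin_eq Var_def Spec_def)
qed

lemma ex_min_ann:
  assumes "x \<in> carrier M" "x \<noteq> \<zero>\<^bsub>M\<^esub>"
  shows "\<exists>p. p \<in> min_Var R (annihilator R M x)"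
proof -
  have "\<one>\<^bsub>R\<^esub> \<notin> annihilator R M x" using assms by (simp add: annihilator_def)
  then obtain m where "primeideal m R" "annihilator R M x \<subseteq> m"
    by (rule R.ex_max_Var[OF annihilator_ideal[OF assms(1)]])
  then show ?thesis using R.min_prime_below by blast
qed

end

section \<open>Quotients and transport of structure\<close>

text \<open>The module structure on the image of a map whose kernel relation is a congruence.  An
  injective map moves a module to another type; choosing representatives modulo a submodule
  gives the quotient on the type of the module itself.  The second point matters because the
  properties in question quantify over modules on one fixed type.\<close>

definition image_module :: "('m \<Rightarrow> 'n) \<Rightarrow> ('a, 'm, 'c) module_scheme \<Rightarrow> ('a, 'n) module" where
  "image_module q M = (let rep = inv_into (carrier M) q in
    \<lparr>carrier = q ` carrier M, mult = undefined, one = undefined, zero = q \<zero>\<^bsub>M\<^esub>,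
     add = (\<lambda>X Y. q (rep X \<oplus>\<^bsub>M\<^esub> rep Y)), smult = (\<lambda>r X. q (r \<odot>\<^bsub>M\<^esub> rep X))\<rparr>)"

locale module_congruence = module R M for R (structure) and M (structure) +
  fixes q :: "'c \<Rightarrow> 'n"
  assumes q_add: "\<lbrakk>x \<in> carrier M; x' \<in> carrier M; y \<in> carrier M; y' \<in> carrier M;
      q x = q x'; q y = q y'\<rbrakk> \<Longrightarrow> q (x \<oplus>\<^bsub>M\<^esub> y) = q (x' \<oplus>\<^bsub>M\<^esub> y')"
    and q_smult: "\<lbrakk>r \<in> carrier R; x \<in> carrier M; x' \<in> carrier M; q x = q x'\<rbrakk> \<Longrightarrow>
      q (r \<odot>\<^bsub>M\<^esub> x) = q (r \<odot>\<^bsub>M\<^esub> x')"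
begin

abbreviation "Q \<equiv> image_module q M"

lemma image_carrier: "carrier Q = q ` carrier M" and image_zero: "\<zero>\<^bsub>Q\<^esub> = q \<zero>\<^bsub>M\<^esub>"
  by (simp_all add: image_module_def Let_def)

lemma image_add: "x \<in> carrier M \<Longrightarrow> y \<in> carrier M \<Longrightarrow> q x \<oplus>\<^bsub>Q\<^esub> q y = q (x \<oplus>\<^bsub>M\<^esub> y)"
  unfolding image_module_def Let_def
  by (simp, rule q_add) (auto intro: inv_into_into f_inv_into_f)

lemma image_smult: "r \<in> carrier R \<Longrightarrow> x \<in> carrier M \<Longrightarrow> r \<odot>\<^bsub>Q\<^esub> q x = q (r \<odot>\<^bsub>M\<^esub> x)"
  unfolding image_module_def Let_def
  by (simp, rule q_smult) (auto intro: inv_into_into f_inv_into_f)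

lemma image_is_module: "module R Q"
proof (rule moduleI[OF R.is_cring])
  show "abelian_group Q"
  proof (rule abelian_groupI)
    fix X assume "X \<in> carrier Q"
    then obtain x where x: "x \<in> carrier M" "X = q x" by (auto simp: image_carrier)
    then show "\<exists>Y\<in>carrier Q. Y \<oplus>\<^bsub>Q\<^esub> X = \<zero>\<^bsub>Q\<^esub>"
      by (intro bexI[of _ "q (\<ominus>\<^bsub>M\<^esub> x)"]) (auto simp: image_carrier image_add image_zero M.l_neg)
  qed (auto simp: image_carrier image_add image_zero M.a_ac)
qed (auto simp: image_carrier image_add image_smult smult_l_distr smult_r_distr smult_assoc1)

end

definition quotient_rep :: "('a, 'm, 'c) module_scheme \<Rightarrow> 'm set \<Rightarrow> 'm \<Rightarrow> 'm" where
  "quotient_rep M N x = (SOME y. y \<in> carrier M \<and> x \<ominus>\<^bsub>M\<^esub> y \<in> N)"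

lemma quotient_module:
  fixes R (structure) and M (structure)
  assumes "module R M" and "submodule N R M"
  defines "q \<equiv> quotient_rep M N"
  shows "module_congruence R M q"
    and "x \<in> carrier M \<Longrightarrow> q x \<in> carrier M"
    and "x \<in> carrier M \<Longrightarrow> q x = q \<zero>\<^bsub>M\<^esub> \<longleftrightarrow> x \<in> N"
proof -
  interpret module R M by fact
  note N = submoduleE[OF assms(2)]
  have NM: "x \<in> N \<Longrightarrow> x \<in> carrier M" for x using N(1) by blast
  have N0: "\<zero>\<^bsub>M\<^esub> \<in> N" using N by (metis M.r_neg NM ex_in_conv)
  have q: "q x \<in> carrier M \<and> x \<ominus>\<^bsub>M\<^esub> q x \<in> N" if "x \<in> carrier M" for x
    unfolding q_def quotient_rep_def
    by (rule someI[of _ x]) (use that N0 in \<open>auto simp: M.minus_eq M.r_neg\<close>)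
  have sub: "x \<ominus>\<^bsub>M\<^esub> z \<in> N" if "x \<in> carrier M" "y \<in> carrier M" "z \<in> carrier M"
    "x \<ominus>\<^bsub>M\<^esub> y \<in> N" "y \<ominus>\<^bsub>M\<^esub> z \<in> N" for x y z
  proof -
    have "x \<ominus>\<^bsub>M\<^esub> z = (x \<ominus>\<^bsub>M\<^esub> y) \<oplus>\<^bsub>M\<^esub> (y \<ominus>\<^bsub>M\<^esub> z)"
      using that by (simp add: M.minus_eq M.a_assoc M.r_neg1)
    then show ?thesis using N(5) that by simp
  qed
  have sym: "y \<ominus>\<^bsub>M\<^esub> x \<in> N" if "x \<in> carrier M" "y \<in> carrier M" "x \<ominus>\<^bsub>M\<^esub> y \<in> N" for x y
  proof -
    have "y \<ominus>\<^bsub>M\<^esub> x = \<ominus>\<^bsub>M\<^esub> (x \<ominus>\<^bsub>M\<^esub> y)"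
      using that by (simp add: M.minus_eq M.minus_add M.a_comm)
    then show ?thesis using N(3) that by simp
  qed
  have eq: "q x = q y \<longleftrightarrow> x \<ominus>\<^bsub>M\<^esub> y \<in> N" if xy: "x \<in> carrier M" "y \<in> carrier M" for x y
  proof
    assume "q x = q y"
    then show "x \<ominus>\<^bsub>M\<^esub> y \<in> N" using sub[of x "q x" y] sym[of y "q y"] q xy by metis
  next
    assume *: "x \<ominus>\<^bsub>M\<^esub> y \<in> N"
    have "z \<in> carrier M \<Longrightarrow> x \<ominus>\<^bsub>M\<^esub> z \<in> N \<longleftrightarrow> y \<ominus>\<^bsub>M\<^esub> z \<in> N" for z
      using sub[of x y z] sub[of y x z] sym[of x y] * xy by blast
    then show "q x = q y" unfolding q_def quotient_rep_def by metis
  qed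
  show "module_congruence R M q"
  proof
    fix x x' y y' assume c: "x \<in> carrier M" "x' \<in> carrier M" "y \<in> carrier M" "y' \<in> carrier M"
      and "q x = q x'" "q y = q y'"
    then have "x \<ominus>\<^bsub>M\<^esub> x' \<in> N" "y \<ominus>\<^bsub>M\<^esub> y' \<in> N" by (simp_all add: eq)
    then have "(x \<ominus>\<^bsub>M\<^esub> x') \<oplus>\<^bsub>M\<^esub> (y \<ominus>\<^bsub>M\<^esub> y') \<in> N" by (rule N(5))
    moreover have "(x \<ominus>\<^bsub>M\<^esub> x') \<oplus>\<^bsub>M\<^esub> (y \<ominus>\<^bsub>M\<^esub> y') = (x \<oplus>\<^bsub>M\<^esub> y) \<ominus>\<^bsub>M\<^esub> (x' \<oplus>\<^bsub>M\<^esub> y')"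
      using c by (simp add: M.minus_eq M.minus_add M.a_ac)
    ultimately show "q (x \<oplus>\<^bsub>M\<^esub> y) = q (x' \<oplus>\<^bsub>M\<^esub> y')" using c by (simp add: eq)
  next
    fix r x x' assume c: "r \<in> carrier R" "x \<in> carrier M" "x' \<in> carrier M" and "q x = q x'"
    then have "r \<odot>\<^bsub>M\<^esub> (x \<ominus>\<^bsub>M\<^esub> x') \<in> N" using N(4) by (simp add: eq)
    then show "q (r \<odot>\<^bsub>M\<^esub> x) = q (r \<odot>\<^bsub>M\<^esub> x')"
      using c by (simp add: eq M.minus_eq smult_r_distr smult_r_minus)
  qed
  show "x \<in> carrier M \<Longrightarrow> q x \<in> carrier M" using q by blast
  show "x \<in> carrier M \<Longrightarrow> q x = q \<zero>\<^bsub>M\<^esub> \<longleftrightarrow> x \<in> N"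
    using eq[of x "\<zero>\<^bsub>M\<^esub>"] M.minus_equality[of "\<zero>\<^bsub>M\<^esub>" "\<zero>\<^bsub>M\<^esub>"]
    by (simp add: M.minus_eq)
qed

text \<open>The conditions for a single module.  Unlike the properties they may be compared between
  modules over different rings and on different types.\<close>

fun property_at ::
  "ideal_property \<Rightarrow> ('a, 'b) ring_scheme \<Rightarrow> 'a set \<Rightarrow> ('a, 'm, 'c) module_scheme \<Rightarrow> bool" where
  "property_at Half_Centred R a M \<longleftrightarrow>
    (torsion R a M = carrier M \<longleftrightarrow> weak_assassin R M \<subseteq> Var R a)"
| "property_at Centred R a M \<longleftrightarrow>
    (torsion R a M = {\<zero>\<^bsub>M\<^esub>} \<longleftrightarrow> weak_assassin R M \<inter> Var R a = {})"
| "property_at Weakly_Quasifair R a M \<longleftrightarrow>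
    weak_assassin R (M\<lparr>carrier := torsion R a M\<rparr>) = weak_assassin R M \<inter> Var R a"
| "property_at Weakly_Large_Quasifair R a M \<longleftrightarrow>
    weak_assassin R (M\<lparr>carrier := large_torsion R a M\<rparr>) = weak_assassin R M \<inter> Var R a"

lemma has_property_iff:
  "has_property P TYPE('m) R a \<longleftrightarrow>
    (\<forall>M :: ('a, 'm) module. module R M \<longrightarrow> property_at P R a M)"
  by (cases P) (simp_all add: half_centred_def centred_def weakly_quasifair_def
      weakly_large_quasifair_def)

text \<open>A property survives any change of ring and module that respects annihilators, torsion and
  primes.  It is used for a change of type of the module over one ring, and for restriction
  of scalars to \<open>R\<close> from a localisation of \<open>R\<close>.\<close>

lemma property_at_transfer:
  assumes f: "inj_on f (carrier M)" "f ` carrier M = carrier N" "f \<zero>\<^bsub>M\<^esub> = \<zero>\<^bsub>N\<^esub>"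
      "\<zero>\<^bsub>M\<^esub> \<in> carrier M"
    and tors: "torsion T b N = f ` torsion R a M" "large_torsion T b N = f ` large_torsion R a M"
    and con: "inj_on con (Spec T)" "\<And>q. q \<in> Spec T \<Longrightarrow> con q \<in> Spec R \<and> (b \<subseteq> q \<longleftrightarrow> a \<subseteq> con q)"
    and ann: "\<And>x. x \<in> carrier M \<Longrightarrow>
      min_Var R (annihilator R M x) = con ` min_Var T (annihilator T N (f x))"
  shows "property_at P R a M \<longleftrightarrow> property_at P T b N"
proof -
  have tM: "torsion R a M \<subseteq> carrier M" "large_torsion R a M \<subseteq> carrier M"
    by (auto simp: torsion_def large_torsion_def)
  have Sp: "min_Var T I \<subseteq> Spec T" for I by (auto simp: min_Var_def Var_def)
  have on: "weak_assassin R (M\<lparr>carrier := X\<rparr>) = con ` weak_assassin T (N\<lparr>carrier := f ` X\<rparr>)"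
    if "X \<subseteq> carrier M" for X
    unfolding weak_assassin_on using ann that by (simp add: image_UN subset_iff)
  have all: "weak_assassin R M = con ` weak_assassin T N"
    using on[of "carrier M"] f(2) by (simp add: weak_assassin_on weak_assassin_eq)
  have Ass_Spec: "weak_assassin T N \<subseteq> Spec T" "weak_assassin T (N\<lparr>carrier := X\<rparr>) \<subseteq> Spec T" for X
    by (auto simp: weak_assassin_def)
  have sub: "weak_assassin R M \<subseteq> Var R a \<longleftrightarrow> weak_assassin T N \<subseteq> Var T b"
    unfolding all using con(2) Ass_Spec(1) by (auto simp: Var_def)
  have inter: "weak_assassin R M \<inter> Var R a = con ` (weak_assassin T N \<inter> Var T b)"
    unfolding all using con(2) Ass_Spec(1) by (auto simp: Var_def)
  have img: "con ` A = con ` B \<longleftrightarrow> A = B" if "A \<subseteq> Spec T" "B \<subseteq> Spec T" for A B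
    using inj_on_image_eq_iff[OF con(1) that] .
  have tor_all: "torsion R a M = carrier M \<longleftrightarrow> torsion T b N = carrier N"
    unfolding tors f(2)[symmetric] using inj_on_image_eq_iff[OF f(1) tM(1)] by simp
  have tor_0: "torsion R a M = {\<zero>\<^bsub>M\<^esub>} \<longleftrightarrow> torsion T b N = {\<zero>\<^bsub>N\<^esub>}"
    using inj_on_image_eq_iff[OF f(1) tM(1), of "{\<zero>\<^bsub>M\<^esub>}"] f(3,4) by (simp add: tors)
  show ?thesis
  proof (cases P)
    case Half_Centred then show ?thesis using tor_all sub by simp
  next
    case Centred then show ?thesis using tor_0 inter by simp
  next
    case Weakly_Quasifair
    then show ?thesis using on[OF tM(1)] inter img Ass_Spec by (simp add: tors inf.coboundedI1)
  next
    case Weakly_Large_Quasifair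
    then show ?thesis using on[OF tM(2)] inter img Ass_Spec by (simp add: tors inf.coboundedI1)
  qed
qed

text \<open>Hence the type over which a property is formulated may be replaced by any type that embeds
  in it.\<close>

lemma has_property_embed:
  fixes N :: "('a, 'n) module" and f :: "'n \<Rightarrow> 'm"
  assumes P: "has_property P TYPE('m) R a" and N: "module R N" and a: "ideal a R"
    and f: "inj_on f (carrier N)"
  shows "property_at P R a N"
proof -
  interpret N: module_ideal R N a
    by (intro module_ideal.intro N a)
  interpret f: module_congruence R N f
  proof
    fix x x' y y' assume "x \<in> carrier N" "x' \<in> carrier N" "y \<in> carrier N" "y' \<in> carrier N"
      "f x = f x'" "f y = f y'"
    then show "f (x \<oplus>\<^bsub>N\<^esub> y) = f (x' \<oplus>\<^bsub>N\<^esub> y')" using f by (auto dest: inj_onD)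
  next
    fix r x x' assume "r \<in> carrier R" "x \<in> carrier N" "x' \<in> carrier N" "f x = f x'"
    then show "f (r \<odot>\<^bsub>N\<^esub> x) = f (r \<odot>\<^bsub>N\<^esub> x')" using f by (auto dest: inj_onD)
  qed
  interpret Q: module_ideal R f.Q a
    by (intro module_ideal.intro f.image_is_module a)
  have zero: "f x = \<zero>\<^bsub>f.Q\<^esub> \<longleftrightarrow> x = \<zero>\<^bsub>N\<^esub>" if "x \<in> carrier N" for x
    using f that by (auto simp: f.image_zero dest: inj_onD)
  have kills: "power_kills a f.Q n (f x) \<longleftrightarrow> power_kills a N n x" if "x \<in> carrier N" for n x
    using that by (induction n arbitrary: x) (simp_all add: zero f.image_smult N.aR)
  have tors: "torsion R a f.Q = f ` torsion R a N"
    unfolding set_eq_iff Q.torsion_iff image_iff Bex_def N.torsion_iff f.image_carrier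
    using kills by blast
  have large: "large_torsion R a f.Q = f ` large_torsion R a N"
    by (auto simp: Q.large_torsion_iff N.large_torsion_iff f.image_carrier f.image_smult N.aR zero)
  have ann: "annihilator R f.Q (f x) = annihilator R N x" if "x \<in> carrier N" for x
    using that by (simp add: annihilator_def f.image_smult zero cong: conj_cong)
  have "property_at P R a N \<longleftrightarrow> property_at P R a f.Q"
    by (rule property_at_transfer[where f = f and con = "\<lambda>p. p"])
      (simp_all add: f f.image_carrier f.image_zero tors large ann)
  then show ?thesis using P f.image_is_module unfolding has_property_iff by blast
qed

text \<open>The large torsion functor is a radical: the quotient of a module by its large torsion has
  no large torsion, and so no prime in the weak assassin of that quotient contains \<open>a\<close>.  But if
  all \<open>v\<close> with \<open>v x\<close> in the large torsion were in \<open>p\<close>, then \<open>p\<close> would be minimal over the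
  annihilator of the class of \<open>x\<close> in the quotient.  Compared with the definition, which provides
  some element of the large torsion with \<open>p\<close> minimal over its annihilator, a multiplier \<open>v\<close>
  outside \<open>p\<close> can be combined with other such multipliers.\<close>

lemma weakly_large_quasifair_multiplier:
  fixes N :: "('a, 'n) module" and f :: "'n \<Rightarrow> 'm"
  assumes P: "has_property Weakly_Large_Quasifair TYPE('m) R a"
    and N: "module R N" and a: "ideal a R" and f: "inj_on f (carrier N)"
    and x: "x \<in> carrier N" and p: "p \<in> min_Var R (annihilator R N x)" "a \<subseteq> p"
  shows "\<exists>v\<in>carrier R - p. v \<odot>\<^bsub>N\<^esub> x \<in> large_torsion R a N"
proof (rule ccontr)
  interpret N: module_ideal R N a by (intro module_ideal.intro N a)
  let ?L = "large_torsion R a N"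
  assume "\<not> ?thesis"
  then have no: "v \<in> p" if "v \<in> carrier R" "v \<odot>\<^bsub>N\<^esub> x \<in> ?L" for v using that by blast
  define q where "q = quotient_rep N ?L"
  note quot = quotient_module[OF N N.large_torsion_submodule, folded q_def]
  interpret q: module_congruence R N q by (rule quot(1))
  interpret Q: module_ideal R q.Q a by (intro module_ideal.intro q.image_is_module a)
  have zero: "q y = \<zero>\<^bsub>q.Q\<^esub> \<longleftrightarrow> y \<in> ?L" if "y \<in> carrier N" for y
    using quot(3)[OF that] by (simp add: q.image_zero)
  have "y \<in> ?L" if y: "y \<in> carrier N" and qy: "q y \<in> large_torsion R a q.Q" for y
  proof -
    \<comment> \<open>\<open>g\<^sup>n y\<close> is in the large torsion, and so is killed by a further power of \<open>g\<close>.\<close>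
    have "\<exists>n::nat. g [^]\<^bsub>R\<^esub> n \<odot>\<^bsub>N\<^esub> y = \<zero>\<^bsub>N\<^esub>" if g: "g \<in> a" for g
    proof -
      have gR: "g \<in> carrier R" using N.aR[OF g] .
      obtain n :: nat where "g [^]\<^bsub>R\<^esub> n \<odot>\<^bsub>q.Q\<^esub> q y = \<zero>\<^bsub>q.Q\<^esub>"
        using qy g unfolding Q.large_torsion_iff by blast
      then have "g [^]\<^bsub>R\<^esub> n \<odot>\<^bsub>N\<^esub> y \<in> ?L" using gR y by (simp add: q.image_smult zero)
      then obtain k :: nat where "g [^]\<^bsub>R\<^esub> k \<odot>\<^bsub>N\<^esub> (g [^]\<^bsub>R\<^esub> n \<odot>\<^bsub>N\<^esub> y) = \<zero>\<^bsub>N\<^esub>"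
        using g unfolding N.large_torsion_iff by blast
      then have "g [^]\<^bsub>R\<^esub> (k + n) \<odot>\<^bsub>N\<^esub> y = \<zero>\<^bsub>N\<^esub>"
        using gR y by (simp add: N.smult_assoc1 N.R.nat_pow_mult[symmetric])
      then show ?thesis by blast
    qed
    then show ?thesis using y by (simp add: N.large_torsion_iff)
  qed
  then have "large_torsion R a q.Q \<subseteq> {\<zero>\<^bsub>q.Q\<^esub>}"
    using zero by (auto simp: Q.large_torsion_iff q.image_carrier)
  moreover have "p' \<notin> min_Var R (annihilator R q.Q \<zero>\<^bsub>q.Q\<^esub>)" for p'
    using N.R.prime_one[of p'] N.R.one_closed unfolding Q.min_ann_iff[OF Q.M.zero_closed]
    by (metis Q.smult_r_null)
  ultimately have none: "weak_assassin R (q.Q\<lparr>carrier := large_torsion R a q.Q\<rparr>) = {}"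
    unfolding weak_assassin_on by blast
  have "inj_on f (carrier q.Q)"
    using f quot(2) by (auto simp: q.image_carrier intro: inj_on_subset)
  then have "property_at Weakly_Large_Quasifair R a q.Q"
    by (intro has_property_embed[OF P q.image_is_module a])
  then have "weak_assassin R q.Q \<inter> Var R a = {}" using none by simp
  moreover have "p \<in> min_Var R (annihilator R q.Q (q x))"
  proof -
    note P = p(1)[unfolded N.min_ann_iff[OF x]]
    have qx: "q x \<in> carrier q.Q" using x by (simp add: q.image_carrier)
    have 0: "q \<zero>\<^bsub>N\<^esub> = \<zero>\<^bsub>q.Q\<^esub>" by (simp add: q.image_zero)
    have "\<exists>t\<in>carrier R - p. \<exists>n::nat. t \<odot>\<^bsub>q.Q\<^esub> (r [^]\<^bsub>R\<^esub> n \<odot>\<^bsub>q.Q\<^esub> q x) = \<zero>\<^bsub>q.Q\<^esub>" if r: "r \<in> p" for r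
    proof -
      obtain t and n :: nat where t: "t \<in> carrier R - p" "t \<odot>\<^bsub>N\<^esub> (r [^]\<^bsub>R\<^esub> n \<odot>\<^bsub>N\<^esub> x) = \<zero>\<^bsub>N\<^esub>"
        using P r by blast
      have "r \<in> carrier R" using P r N.R.prime_carr by blast
      then have "t \<odot>\<^bsub>q.Q\<^esub> (r [^]\<^bsub>R\<^esub> n \<odot>\<^bsub>q.Q\<^esub> q x) = \<zero>\<^bsub>q.Q\<^esub>" using t x by (simp add: q.image_smult 0)
      then show ?thesis using t(1) by blast
    qed
    moreover have "r \<in> p" if "r \<in> carrier R" "r \<odot>\<^bsub>q.Q\<^esub> q x = \<zero>\<^bsub>q.Q\<^esub>" for r
      using that x no by (simp add: q.image_smult zero)
    ultimately show ?thesis unfolding Q.min_ann_iff[OF qx] using P by blast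
  qed
  ultimately show False using p(2) x by (auto simp: weak_assassin_eq q.image_carrier min_Var_def Var_def)
qed

section \<open>Rings and modules of fractions\<close>

text \<open>For operations on classes that are defined by a union over all representatives.\<close>

lemma UN_UN_const:
  assumes "(x0, s0) \<in> X" "(y0, t0) \<in> Y"
    and "\<And>x s y t. (x, s) \<in> X \<Longrightarrow> (y, t) \<in> Y \<Longrightarrow> F x s y t = c"
  shows "(\<Union>(x, s)\<in>X. \<Union>(y, t)\<in>Y. F x s y t) = c"
proof
  show "c \<subseteq> (\<Union>(x, s)\<in>X. \<Union>(y, t)\<in>Y. F x s y t)"
    using assms(3)[OF assms(1,2)] assms(1,2) by blast
qed (use assms(3) in blast)

locale fractions = module R M for R (structure) and M (structure) +
  fixes S :: "'a set"
  assumes S: "S \<subseteq> carrier R"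
begin

abbreviation "W \<equiv> mult_closure R S"

abbreviation "L \<equiv> loc_module R S M"

abbreviation fr :: "'c \<Rightarrow> 'a \<Rightarrow> ('c \<times> 'a) set" where
  "fr \<equiv> frac R S M"

lemma W_carr [simp]: "w \<in> W \<Longrightarrow> w \<in> carrier R"
proof -
  have "submonoid (carrier R) R" by (rule submonoid.intro) auto
  then show "w \<in> W \<Longrightarrow> w \<in> carrier R" using S by (auto simp: mult_closure_def)
qed

lemma W_one [simp]: "\<one>\<^bsub>R\<^esub> \<in> W"
  by (auto simp: mult_closure_def submonoid.one_closed)

lemma W_mult [simp]: "v \<in> W \<Longrightarrow> w \<in> W \<Longrightarrow> v \<otimes>\<^bsub>R\<^esub> w \<in> W"
  by (auto simp: mult_closure_def submonoid.m_closed)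

lemmas smult_norm = smult_assoc1[symmetric] R.m_ac

lemma mem_fr_iff: "(y, t) \<in> fr x s \<longleftrightarrow> y \<in> carrier M \<and> t \<in> W \<and>
    (\<exists>u\<in>W. u \<odot>\<^bsub>M\<^esub> (t \<odot>\<^bsub>M\<^esub> x) = u \<odot>\<^bsub>M\<^esub> (s \<odot>\<^bsub>M\<^esub> y))"
  by (simp add: frac_def)

lemma fr_trans:
  assumes "(y, t) \<in> fr x s" "(z, w) \<in> fr y t" "x \<in> carrier M" "s \<in> W"
  shows "(z, w) \<in> fr x s"
proof -
  from assms obtain u v where c: "y \<in> carrier M" "t \<in> W" "u \<in> W" "z \<in> carrier M" "w \<in> W" "v \<in> W"
    and e: "u \<odot>\<^bsub>M\<^esub> (t \<odot>\<^bsub>M\<^esub> x) = u \<odot>\<^bsub>M\<^esub> (s \<odot>\<^bsub>M\<^esub> y)" "v \<odot>\<^bsub>M\<^esub> (w \<odot>\<^bsub>M\<^esub> y) = v \<odot>\<^bsub>M\<^esub> (t \<odot>\<^bsub>M\<^esub> z)"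
    by (auto simp: mem_fr_iff)
  have "(u \<otimes>\<^bsub>R\<^esub> v \<otimes>\<^bsub>R\<^esub> t) \<odot>\<^bsub>M\<^esub> (w \<odot>\<^bsub>M\<^esub> x) = (v \<otimes>\<^bsub>R\<^esub> w) \<odot>\<^bsub>M\<^esub> (u \<odot>\<^bsub>M\<^esub> (t \<odot>\<^bsub>M\<^esub> x))"
    using c assms(3,4) by (simp add: smult_norm)
  also have "\<dots> = (u \<otimes>\<^bsub>R\<^esub> s) \<odot>\<^bsub>M\<^esub> (v \<odot>\<^bsub>M\<^esub> (w \<odot>\<^bsub>M\<^esub> y))"
    unfolding e(1) using c assms(3,4) by (simp add: smult_norm)
  also have "\<dots> = (u \<otimes>\<^bsub>R\<^esub> v \<otimes>\<^bsub>R\<^esub> t) \<odot>\<^bsub>M\<^esub> (s \<odot>\<^bsub>M\<^esub> z)"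
    unfolding e(2) using c assms(3,4) by (simp add: smult_norm)
  finally show ?thesis using c by (auto simp: mem_fr_iff)
qed

lemma fr_sym: "(y, t) \<in> fr x s \<Longrightarrow> x \<in> carrier M \<Longrightarrow> s \<in> W \<Longrightarrow> (x, s) \<in> fr y t"
  unfolding mem_fr_iff by (auto dest: sym)

lemma fr_refl: "x \<in> carrier M \<Longrightarrow> s \<in> W \<Longrightarrow> (x, s) \<in> fr x s"
  by (auto simp: mem_fr_iff)

lemma fr_mem_eq:
  assumes "(y, t) \<in> fr x s" "x \<in> carrier M" "s \<in> W"
  shows "fr y t = fr x s"
proof -
  have c: "y \<in> carrier M" "t \<in> W" using assms(1) by (auto simp: mem_fr_iff)
  have "(z, w) \<in> fr y t \<longleftrightarrow> (z, w) \<in> fr x s" for z w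
    using fr_trans[OF assms(1) _ assms(2,3)] fr_trans[OF fr_sym[OF assms] _ c] by blast
  then show ?thesis by auto
qed

lemma fr_eq_iff:
  assumes "x \<in> carrier M" "y \<in> carrier M" "s \<in> W" "t \<in> W"
  shows "fr x s = fr y t \<longleftrightarrow> (\<exists>u\<in>W. u \<odot>\<^bsub>M\<^esub> (t \<odot>\<^bsub>M\<^esub> x) = u \<odot>\<^bsub>M\<^esub> (s \<odot>\<^bsub>M\<^esub> y))"
proof
  assume "fr x s = fr y t"
  then have "(y, t) \<in> fr x s" using fr_refl assms by simp
  then show "\<exists>u\<in>W. u \<odot>\<^bsub>M\<^esub> (t \<odot>\<^bsub>M\<^esub> x) = u \<odot>\<^bsub>M\<^esub> (s \<odot>\<^bsub>M\<^esub> y)" by (simp add: mem_fr_iff)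
next
  assume "\<exists>u\<in>W. u \<odot>\<^bsub>M\<^esub> (t \<odot>\<^bsub>M\<^esub> x) = u \<odot>\<^bsub>M\<^esub> (s \<odot>\<^bsub>M\<^esub> y)"
  then have "(y, t) \<in> fr x s" using assms by (simp add: mem_fr_iff)
  then show "fr x s = fr y t" using fr_mem_eq assms by simp
qed

lemma fr_cancel: "x \<in> carrier M \<Longrightarrow> s \<in> W \<Longrightarrow> t \<in> W \<Longrightarrow> fr (t \<odot>\<^bsub>M\<^esub> x) (t \<otimes>\<^bsub>R\<^esub> s) = fr x s"
  by (subst fr_eq_iff) (auto intro!: bexI[of _ "\<one>\<^bsub>R\<^esub>"] simp: smult_norm)

lemma fr_zero_iff: "x \<in> carrier M \<Longrightarrow> s \<in> W \<Longrightarrow> fr x s = \<zero>\<^bsub>L\<^esub> \<longleftrightarrow> (\<exists>u\<in>W. u \<odot>\<^bsub>M\<^esub> x = \<zero>\<^bsub>M\<^esub>)"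
  by (simp add: loc_module_def fr_eq_iff)

lemma loc_carrier: "X \<in> carrier L \<longleftrightarrow> (\<exists>x\<in>carrier M. \<exists>s\<in>W. X = fr x s)"
  by (auto simp: loc_module_def)

lemma loc_zero: "\<zero>\<^bsub>L\<^esub> = fr \<zero>\<^bsub>M\<^esub> \<one>\<^bsub>R\<^esub>"
  by (simp add: loc_module_def)

lemma loc_add:
  assumes c: "x \<in> carrier M" "s \<in> W" "y \<in> carrier M" "t \<in> W"
  shows "fr x s \<oplus>\<^bsub>L\<^esub> fr y t = fr ((t \<odot>\<^bsub>M\<^esub> x) \<oplus>\<^bsub>M\<^esub> (s \<odot>\<^bsub>M\<^esub> y)) (s \<otimes>\<^bsub>R\<^esub> t)"
proof -
  have wd: "fr ((t' \<odot>\<^bsub>M\<^esub> x') \<oplus>\<^bsub>M\<^esub> (s' \<odot>\<^bsub>M\<^esub> y')) (s' \<otimes>\<^bsub>R\<^esub> t')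
      = fr ((t \<odot>\<^bsub>M\<^esub> x) \<oplus>\<^bsub>M\<^esub> (s \<odot>\<^bsub>M\<^esub> y)) (s \<otimes>\<^bsub>R\<^esub> t)"
    if "(x', s') \<in> fr x s" "(y', t') \<in> fr y t" for x' s' y' t'
  proof -
    from that obtain u v where d: "x' \<in> carrier M" "s' \<in> W" "y' \<in> carrier M" "t' \<in> W" "u \<in> W" "v \<in> W"
      and e: "u \<odot>\<^bsub>M\<^esub> (s' \<odot>\<^bsub>M\<^esub> x) = u \<odot>\<^bsub>M\<^esub> (s \<odot>\<^bsub>M\<^esub> x')" "v \<odot>\<^bsub>M\<^esub> (t' \<odot>\<^bsub>M\<^esub> y) = v \<odot>\<^bsub>M\<^esub> (t \<odot>\<^bsub>M\<^esub> y')"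
      by (auto simp: mem_fr_iff)
    have "(u \<otimes>\<^bsub>R\<^esub> v) \<odot>\<^bsub>M\<^esub> ((s \<otimes>\<^bsub>R\<^esub> t) \<odot>\<^bsub>M\<^esub> (t' \<odot>\<^bsub>M\<^esub> x'))
        = (v \<otimes>\<^bsub>R\<^esub> t \<otimes>\<^bsub>R\<^esub> t') \<odot>\<^bsub>M\<^esub> (u \<odot>\<^bsub>M\<^esub> (s \<odot>\<^bsub>M\<^esub> x'))"
      using c d by (simp add: smult_norm)
    also have "\<dots> = (u \<otimes>\<^bsub>R\<^esub> v) \<odot>\<^bsub>M\<^esub> ((s' \<otimes>\<^bsub>R\<^esub> t') \<odot>\<^bsub>M\<^esub> (t \<odot>\<^bsub>M\<^esub> x))"
      unfolding e(1)[symmetric] using c d by (simp add: smult_norm)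
    finally have 1: "(u \<otimes>\<^bsub>R\<^esub> v) \<odot>\<^bsub>M\<^esub> ((s \<otimes>\<^bsub>R\<^esub> t) \<odot>\<^bsub>M\<^esub> (t' \<odot>\<^bsub>M\<^esub> x'))
        = (u \<otimes>\<^bsub>R\<^esub> v) \<odot>\<^bsub>M\<^esub> ((s' \<otimes>\<^bsub>R\<^esub> t') \<odot>\<^bsub>M\<^esub> (t \<odot>\<^bsub>M\<^esub> x))" .
    have "(u \<otimes>\<^bsub>R\<^esub> v) \<odot>\<^bsub>M\<^esub> ((s \<otimes>\<^bsub>R\<^esub> t) \<odot>\<^bsub>M\<^esub> (s' \<odot>\<^bsub>M\<^esub> y'))
        = (u \<otimes>\<^bsub>R\<^esub> s \<otimes>\<^bsub>R\<^esub> s') \<odot>\<^bsub>M\<^esub> (v \<odot>\<^bsub>M\<^esub> (t \<odot>\<^bsub>M\<^esub> y'))"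
      using c d by (simp add: smult_norm)
    also have "\<dots> = (u \<otimes>\<^bsub>R\<^esub> v) \<odot>\<^bsub>M\<^esub> ((s' \<otimes>\<^bsub>R\<^esub> t') \<odot>\<^bsub>M\<^esub> (s \<odot>\<^bsub>M\<^esub> y))"
      unfolding e(2)[symmetric] using c d by (simp add: smult_norm)
    finally have 2: "(u \<otimes>\<^bsub>R\<^esub> v) \<odot>\<^bsub>M\<^esub> ((s \<otimes>\<^bsub>R\<^esub> t) \<odot>\<^bsub>M\<^esub> (s' \<odot>\<^bsub>M\<^esub> y'))
        = (u \<otimes>\<^bsub>R\<^esub> v) \<odot>\<^bsub>M\<^esub> ((s' \<otimes>\<^bsub>R\<^esub> t') \<odot>\<^bsub>M\<^esub> (s \<odot>\<^bsub>M\<^esub> y))" .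
    show ?thesis
      by (subst fr_eq_iff) (use c d 1 2 in \<open>auto simp: smult_r_distr intro!: bexI[of _ "u \<otimes>\<^bsub>R\<^esub> v"]\<close>)
  qed
  show ?thesis
    unfolding loc_module_def ring.simps partial_object.simps
    by (rule UN_UN_const[OF fr_refl[OF c(1,2)] fr_refl[OF c(3,4)] wd])
qed

lemma loc_add_same:
  assumes c: "x \<in> carrier M" "y \<in> carrier M" "s \<in> W"
  shows "fr x s \<oplus>\<^bsub>L\<^esub> fr y s = fr (x \<oplus>\<^bsub>M\<^esub> y) s"
  using fr_cancel[of "x \<oplus>\<^bsub>M\<^esub> y" s s] c by (simp add: loc_add smult_r_distr)

text \<open>With a common denominator the module axioms for fractions reduce to those for
  numerators.\<close>

lemma common_denominator:
  assumes "X \<in> carrier L" "Y \<in> carrier L" "Z \<in> carrier L"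
  obtains x y z s where "x \<in> carrier M" "y \<in> carrier M" "z \<in> carrier M" "s \<in> W"
    "X = fr x s" "Y = fr y s" "Z = fr z s"
proof -
  obtain x r y s z t where c: "x \<in> carrier M" "r \<in> W" "y \<in> carrier M" "s \<in> W" "z \<in> carrier M" "t \<in> W"
    and e: "X = fr x r" "Y = fr y s" "Z = fr z t"
    using assms unfolding loc_carrier by metis
  have "X = fr ((s \<otimes>\<^bsub>R\<^esub> t) \<odot>\<^bsub>M\<^esub> x) (r \<otimes>\<^bsub>R\<^esub> s \<otimes>\<^bsub>R\<^esub> t)"
    "Y = fr ((r \<otimes>\<^bsub>R\<^esub> t) \<odot>\<^bsub>M\<^esub> y) (r \<otimes>\<^bsub>R\<^esub> s \<otimes>\<^bsub>R\<^esub> t)"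
    "Z = fr ((r \<otimes>\<^bsub>R\<^esub> s) \<odot>\<^bsub>M\<^esub> z) (r \<otimes>\<^bsub>R\<^esub> s \<otimes>\<^bsub>R\<^esub> t)"
    using fr_cancel[of x r "s \<otimes>\<^bsub>R\<^esub> t"] fr_cancel[of y s "r \<otimes>\<^bsub>R\<^esub> t"] fr_cancel[of z t "r \<otimes>\<^bsub>R\<^esub> s"] c e
    by (simp_all add: R.m_ac)
  then show thesis using c by (intro that) auto
qed

lemma fr_zero: "s \<in> W \<Longrightarrow> fr \<zero>\<^bsub>M\<^esub> s = \<zero>\<^bsub>L\<^esub>"
  using fr_zero_iff[of "\<zero>\<^bsub>M\<^esub>" s] by (auto intro: bexI[of _ "\<one>\<^bsub>R\<^esub>"])

lemma fr_carrier [simp]: "x \<in> carrier M \<Longrightarrow> s \<in> W \<Longrightarrow> fr x s \<in> carrier L"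
  by (auto simp: loc_carrier)

lemma loc_abelian_group: "abelian_group L"
proof (rule abelian_groupI)
  fix X Y Z assume XYZ: "X \<in> carrier L" "Y \<in> carrier L" "Z \<in> carrier L"
  obtain x y z s where "x \<in> carrier M" "y \<in> carrier M" "z \<in> carrier M" "s \<in> W"
    "X = fr x s" "Y = fr y s" "Z = fr z s" using common_denominator[OF XYZ] .
  then show "(X \<oplus>\<^bsub>L\<^esub> Y) \<oplus>\<^bsub>L\<^esub> Z = X \<oplus>\<^bsub>L\<^esub> (Y \<oplus>\<^bsub>L\<^esub> Z)"
    by (simp add: loc_add_same M.a_assoc)
next
  fix X Y assume XY: "X \<in> carrier L" "Y \<in> carrier L"
  obtain x y z s where "x \<in> carrier M" "y \<in> carrier M" "s \<in> W" "X = fr x s" "Y = fr y s"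
    using common_denominator[OF XY XY(1)] .
  then show "X \<oplus>\<^bsub>L\<^esub> Y \<in> carrier L" "X \<oplus>\<^bsub>L\<^esub> Y = Y \<oplus>\<^bsub>L\<^esub> X"
    by (simp_all add: loc_add_same M.a_comm)
next
  show "\<zero>\<^bsub>L\<^esub> \<in> carrier L" by (simp add: loc_zero)
next
  fix X assume "X \<in> carrier L"
  then obtain x s where x: "x \<in> carrier M" "s \<in> W" "X = fr x s" by (auto simp: loc_carrier)
  show "\<zero>\<^bsub>L\<^esub> \<oplus>\<^bsub>L\<^esub> X = X"
    using x loc_add_same[of "\<zero>\<^bsub>M\<^esub>" x s] by (simp add: fr_zero)
  show "\<exists>Y\<in>carrier L. Y \<oplus>\<^bsub>L\<^esub> X = \<zero>\<^bsub>L\<^esub>"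
    using x by (intro bexI[of _ "fr (\<ominus>\<^bsub>M\<^esub> x) s"]) (simp_all add: loc_add_same M.l_neg fr_zero)
qed

end

lemma (in cring) self_module: "module R (self_module R)"
proof (rule moduleI[OF is_cring])
  show "abelian_group (self_module R)"
    by (rule abelian_groupI) (auto simp: self_module_def a_ac intro: bexI[of _ "\<ominus> _"] l_neg)
qed (auto simp: self_module_def l_distr r_distr m_assoc)

lemma self_module_simps [simp]:
  "carrier (self_module R) = carrier R" "\<zero>\<^bsub>self_module R\<^esub> = \<zero>\<^bsub>R\<^esub>"
  "x \<oplus>\<^bsub>self_module R\<^esub> y = x \<oplus>\<^bsub>R\<^esub> y" "x \<odot>\<^bsub>self_module R\<^esub> y = x \<otimes>\<^bsub>R\<^esub> y"
  by (simp_all add: self_module_def)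

context fractions begin

abbreviation "T \<equiv> loc_ring R S"

abbreviation fR :: "'a \<Rightarrow> 'a \<Rightarrow> ('a \<times> 'a) set" where
  "fR \<equiv> frac R S (self_module R)"

lemma self_fractions: "fractions R (self_module R) S"
  by (intro fractions.intro fractions_axioms.intro R.self_module S)

lemma loc_smult:
  assumes c: "r \<in> carrier R" "s \<in> W" "x \<in> carrier M" "t \<in> W"
  shows "fR r s \<odot>\<^bsub>L\<^esub> fr x t = fr (r \<odot>\<^bsub>M\<^esub> x) (s \<otimes>\<^bsub>R\<^esub> t)"
proof -
  interpret A: fractions R "self_module R" S by (rule self_fractions)
  have wd: "fr (r' \<odot>\<^bsub>M\<^esub> x') (s' \<otimes>\<^bsub>R\<^esub> t') = fr (r \<odot>\<^bsub>M\<^esub> x) (s \<otimes>\<^bsub>R\<^esub> t)"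
    if "(r', s') \<in> fR r s" "(x', t') \<in> fr x t" for r' s' x' t'
  proof -
    from that obtain u v where d: "r' \<in> carrier R" "s' \<in> W" "x' \<in> carrier M" "t' \<in> W" "u \<in> W" "v \<in> W"
      and e: "u \<otimes>\<^bsub>R\<^esub> (s' \<otimes>\<^bsub>R\<^esub> r) = u \<otimes>\<^bsub>R\<^esub> (s \<otimes>\<^bsub>R\<^esub> r')"
        "v \<odot>\<^bsub>M\<^esub> (t' \<odot>\<^bsub>M\<^esub> x) = v \<odot>\<^bsub>M\<^esub> (t \<odot>\<^bsub>M\<^esub> x')"
      by (auto simp: mem_fr_iff A.mem_fr_iff)
    have "(u \<otimes>\<^bsub>R\<^esub> v) \<odot>\<^bsub>M\<^esub> ((s \<otimes>\<^bsub>R\<^esub> t) \<odot>\<^bsub>M\<^esub> (r' \<odot>\<^bsub>M\<^esub> x'))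
        = (u \<otimes>\<^bsub>R\<^esub> (s \<otimes>\<^bsub>R\<^esub> r')) \<odot>\<^bsub>M\<^esub> (v \<odot>\<^bsub>M\<^esub> (t \<odot>\<^bsub>M\<^esub> x'))"
      using c d by (simp add: smult_norm)
    also have "\<dots> = (u \<otimes>\<^bsub>R\<^esub> v) \<odot>\<^bsub>M\<^esub> ((s' \<otimes>\<^bsub>R\<^esub> t') \<odot>\<^bsub>M\<^esub> (r \<odot>\<^bsub>M\<^esub> x))"
      unfolding e[symmetric] using c d by (simp add: smult_norm)
    finally show ?thesis
      by (subst fr_eq_iff) (use c d in \<open>auto intro!: bexI[of _ "u \<otimes>\<^bsub>R\<^esub> v"]\<close>)
  qed
  have "(r, s) \<in> fR r s" using A.fr_refl c by simp
  from UN_UN_const[OF this fr_refl[OF c(3,4)] wd]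
  show ?thesis unfolding loc_module_def module.simps .
qed

end

text \<open>The ring of fractions shares its carrier and its operations with the localisation of \<open>R\<close> as a
  module over itself.\<close>

locale ring_fractions = cring R for R (structure) +
  fixes S :: "'a set"
  assumes SR: "S \<subseteq> carrier R"
begin

sublocale A: fractions R "self_module R" S
  by (intro fractions.intro fractions_axioms.intro self_module SR)

abbreviation "T \<equiv> loc_ring R S"

lemma T_simps:
  "carrier T = carrier A.L" "\<zero>\<^bsub>T\<^esub> = \<zero>\<^bsub>A.L\<^esub>" "X \<oplus>\<^bsub>T\<^esub> Y = X \<oplus>\<^bsub>A.L\<^esub> Y" "X \<otimes>\<^bsub>T\<^esub> Y = X \<odot>\<^bsub>A.L\<^esub> Y"
  by (simp_all add: loc_ring_def loc_module_def)

lemma T_one: "\<one>\<^bsub>T\<^esub> = A.fR \<one> \<one>"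
  by (simp add: loc_ring_def)

lemma T_mult:
  "r \<in> carrier R \<Longrightarrow> s \<in> A.W \<Longrightarrow> x \<in> carrier R \<Longrightarrow> t \<in> A.W \<Longrightarrow>
    A.fR r s \<otimes>\<^bsub>T\<^esub> A.fR x t = A.fR (r \<otimes> x) (s \<otimes> t)"
  using A.loc_smult by (simp add: T_simps)

lemma T_add_same:
  "x \<in> carrier R \<Longrightarrow> y \<in> carrier R \<Longrightarrow> s \<in> A.W \<Longrightarrow>
    A.fR x s \<oplus>\<^bsub>T\<^esub> A.fR y s = A.fR (x \<oplus> y) s"
  using A.loc_add_same by (simp add: T_simps)

lemma T_carrier: "X \<in> carrier T \<longleftrightarrow> (\<exists>r\<in>carrier R. \<exists>s\<in>A.W. X = A.fR r s)"
  using A.loc_carrier by (simp add: T_simps)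

lemma T_common:
  assumes "X \<in> carrier T" "Y \<in> carrier T"
  obtains x y s where "x \<in> carrier R" "y \<in> carrier R" "s \<in> A.W" "X = A.fR x s" "Y = A.fR y s"
  using A.common_denominator[of X Y Y] assms by (simp add: T_simps) metis

lemma T_cring: "cring T"
proof (rule cringI)
  interpret L: abelian_group A.L by (rule A.loc_abelian_group)
  show "abelian_group T"
    by (rule abelian_groupI) (auto simp: T_simps L.a_ac intro: bexI[of _ "\<ominus>\<^bsub>A.L\<^esub> _"] L.l_neg)
  show "comm_monoid T"
  proof (rule comm_monoidI)
    fix X Y Z assume "X \<in> carrier T" "Y \<in> carrier T" "Z \<in> carrier T"
    then obtain x r y s z t where "x \<in> carrier R" "r \<in> A.W" "y \<in> carrier R" "s \<in> A.W"
      "z \<in> carrier R" "t \<in> A.W" "X = A.fR x r" "Y = A.fR y s" "Z = A.fR z t"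
      unfolding T_carrier by metis
    then show "(X \<otimes>\<^bsub>T\<^esub> Y) \<otimes>\<^bsub>T\<^esub> Z = X \<otimes>\<^bsub>T\<^esub> (Y \<otimes>\<^bsub>T\<^esub> Z)" by (simp add: T_mult m_assoc)
  next
    fix X Y assume "X \<in> carrier T" "Y \<in> carrier T"
    then obtain x r y s where *: "x \<in> carrier R" "r \<in> A.W" "y \<in> carrier R" "s \<in> A.W"
      "X = A.fR x r" "Y = A.fR y s" unfolding T_carrier by metis
    then show "X \<otimes>\<^bsub>T\<^esub> Y = Y \<otimes>\<^bsub>T\<^esub> X" by (simp add: T_mult m_comm)
    show "X \<otimes>\<^bsub>T\<^esub> Y \<in> carrier T" unfolding T_carrier
      using * by (intro bexI[of _ "x \<otimes> y"] bexI[of _ "r \<otimes> s"]) (simp_all add: T_mult)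
  next
    show "\<one>\<^bsub>T\<^esub> \<in> carrier T" unfolding T_one T_carrier by (metis A.W_one one_closed)
    fix X assume "X \<in> carrier T"
    then show "\<one>\<^bsub>T\<^esub> \<otimes>\<^bsub>T\<^esub> X = X" unfolding T_carrier T_one by (auto simp: T_mult)
  qed
  fix X Y Z assume XYZ: "X \<in> carrier T" "Y \<in> carrier T" "Z \<in> carrier T"
  obtain x y s where 1: "x \<in> carrier R" "y \<in> carrier R" "s \<in> A.W" "X = A.fR x s" "Y = A.fR y s"
    using T_common[OF XYZ(1,2)] .
  obtain z t where 2: "z \<in> carrier R" "t \<in> A.W" "Z = A.fR z t" using XYZ(3) by (auto simp: T_carrier)
  show "(X \<oplus>\<^bsub>T\<^esub> Y) \<otimes>\<^bsub>T\<^esub> Z = X \<otimes>\<^bsub>T\<^esub> Z \<oplus>\<^bsub>T\<^esub> Y \<otimes>\<^bsub>T\<^esub> Z"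
    using 1 2 by (simp add: T_mult T_add_same l_distr)
qed

end

context fractions begin

lemma ring_fractions: "ring_fractions R S"
  by (intro ring_fractions.intro ring_fractions_axioms.intro R.is_cring S)

lemma loc_is_module: "module T L"
proof (rule moduleI)
  interpret F: ring_fractions R S by (rule ring_fractions)
  show "cring T" by (rule F.T_cring)
  show "abelian_group L" by (rule loc_abelian_group)
  fix A X assume "A \<in> carrier T" "X \<in> carrier L"
  then obtain a x r s where 1: "a \<in> carrier R" "r \<in> W" "A = fR a r" "x \<in> carrier M" "s \<in> W" "X = fr x s"
    by (auto simp: F.T_carrier loc_carrier)
  then show "A \<odot>\<^bsub>L\<^esub> X \<in> carrier L" by (simp add: loc_smult)
  {
    fix B assume "B \<in> carrier T"
    then obtain b t where "b \<in> carrier R" "t \<in> W" "B = fR b t" by (auto simp: F.T_carrier)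
    then show "(A \<otimes>\<^bsub>T\<^esub> B) \<odot>\<^bsub>L\<^esub> X = A \<odot>\<^bsub>L\<^esub> (B \<odot>\<^bsub>L\<^esub> X)"
      using 1 by (simp add: loc_smult F.T_mult smult_assoc1 R.m_assoc)
  }
next
  interpret F: ring_fractions R S by (rule ring_fractions)
  fix A B X assume AB: "A \<in> carrier T" "B \<in> carrier T" and "X \<in> carrier L"
  then obtain x s where 1: "x \<in> carrier M" "s \<in> W" "X = fr x s" by (auto simp: loc_carrier)
  obtain a b t where "a \<in> carrier R" "b \<in> carrier R" "t \<in> W" "A = fR a t" "B = fR b t"
    using F.T_common[OF AB] .
  then show "(A \<oplus>\<^bsub>T\<^esub> B) \<odot>\<^bsub>L\<^esub> X = A \<odot>\<^bsub>L\<^esub> X \<oplus>\<^bsub>L\<^esub> B \<odot>\<^bsub>L\<^esub> X"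
    using 1 by (simp add: loc_smult F.T_add_same loc_add_same smult_l_distr)
next
  interpret F: ring_fractions R S by (rule ring_fractions)
  fix A X Y assume "A \<in> carrier T" and XY: "X \<in> carrier L" "Y \<in> carrier L"
  then obtain a t where 1: "a \<in> carrier R" "t \<in> W" "A = fR a t" by (auto simp: F.T_carrier)
  obtain x y z s where "x \<in> carrier M" "y \<in> carrier M" "s \<in> W" "X = fr x s" "Y = fr y s"
    using common_denominator[OF XY XY(1)] .
  then show "A \<odot>\<^bsub>L\<^esub> (X \<oplus>\<^bsub>L\<^esub> Y) = A \<odot>\<^bsub>L\<^esub> X \<oplus>\<^bsub>L\<^esub> A \<odot>\<^bsub>L\<^esub> Y"
    using 1 by (simp add: loc_smult loc_add_same smult_r_distr)
next
  interpret F: ring_fractions R S by (rule ring_fractions)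
  fix X assume "X \<in> carrier L"
  then show "\<one>\<^bsub>T\<^esub> \<odot>\<^bsub>L\<^esub> X = X" by (auto simp: loc_carrier F.T_one loc_smult)
qed

end

section \<open>Primes and torsion under localisation\<close>

text \<open>What the arguments need of \<open>R \<rightarrow> S\<^sup>-\<^sup>1R\<close>: every element of the target becomes the image of an
  element of \<open>R\<close> after multiplication by an invertible image.\<close>

locale fraction_map = R: cring R + T: cring T + ideal a R + b: ideal b T
  for R (structure) and T (structure) and a b +
  fixes \<phi> :: "'a \<Rightarrow> 'c" and W :: "'a set"
  assumes hom: "\<phi> \<in> ring_hom R T"
    and W_carr: "w \<in> W \<Longrightarrow> w \<in> carrier R"
    and W_one: "\<one>\<^bsub>R\<^esub> \<in> W"
    and W_mult: "v \<in> W \<Longrightarrow> w \<in> W \<Longrightarrow> v \<otimes>\<^bsub>R\<^esub> w \<in> W"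
    and W_unit: "w \<in> W \<Longrightarrow> \<exists>u\<in>carrier T. u \<otimes>\<^bsub>T\<^esub> \<phi> w = \<one>\<^bsub>T\<^esub>"
    and numerator: "t \<in> carrier T \<Longrightarrow> \<exists>r\<in>carrier R. \<exists>w\<in>W. \<phi> w \<otimes>\<^bsub>T\<^esub> t = \<phi> r"
    and b_image: "f \<in> a \<Longrightarrow> \<phi> f \<in> b"
    and b_numerator: "t \<in> b \<Longrightarrow> \<exists>f\<in>a. \<exists>w\<in>W. \<phi> w \<otimes>\<^bsub>T\<^esub> t = \<phi> f"
begin

text \<open>Contraction and extension of ideals.\<close>

definition con :: "'c set \<Rightarrow> 'a set" where
  "con q = {r \<in> carrier R. \<phi> r \<in> q}"

definition ext :: "'a set \<Rightarrow> 'c set" where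
  "ext p = {t \<in> carrier T. \<exists>r\<in>p. \<exists>w\<in>W. \<phi> w \<otimes>\<^bsub>T\<^esub> t = \<phi> r}"

sublocale \<phi>: ring_hom_cring R T \<phi>
  by unfold_locales (rule hom)

lemma \<phi>_pow: "r \<in> carrier R \<Longrightarrow> \<phi> (r [^]\<^bsub>R\<^esub> (n::nat)) = \<phi> r [^]\<^bsub>T\<^esub> n"
  by (induction n) auto

lemma unit_not_prime: "primeideal q T \<Longrightarrow> w \<in> W \<Longrightarrow> \<phi> w \<notin> q"
  using W_unit[of w] W_carr[of w] by (metis T.prime_mult_iff T.prime_one \<phi>.hom_closed)

lemma con_prime:
  assumes q: "primeideal q T"
  shows "primeideal (con q) R"
proof (rule primeidealI[OF _ R.is_cring])
  interpret q: ideal q T using q by (rule primeideal.axioms(1))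
  show "ideal (con q) R"
  proof (rule idealI[OF R.ring_axioms])
    show "subgroup (con q) (add_monoid R)"
      by (rule group.subgroupI[OF R.a_group])
        (auto simp: con_def a_inv_def[symmetric] intro: exI[of _ "\<zero>\<^bsub>R\<^esub>"])
  qed (auto simp: con_def intro: q.I_l_closed q.I_r_closed)
  show "carrier R \<noteq> con q" using T.prime_one[OF q] R.one_closed unfolding con_def by (metis (mono_tags, lifting) \<phi>.hom_one mem_Collect_eq)
  show "x \<in> con q \<or> y \<in> con q" if "x \<in> carrier R" "y \<in> carrier R" "x \<otimes>\<^bsub>R\<^esub> y \<in> con q" for x y
    using that T.prime_mult_iff[OF q] by (auto simp: con_def)
qed

lemma mem_iff_numerator:
  assumes q: "primeideal q T" and t: "t \<in> carrier T" and w: "w \<in> W" "r \<in> carrier R"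
    "\<phi> w \<otimes>\<^bsub>T\<^esub> t = \<phi> r"
  shows "t \<in> q \<longleftrightarrow> r \<in> con q"
  using T.prime_mult_iff[OF q, of "\<phi> w" t] unit_not_prime[OF q w(1)] w t W_carr[OF w(1)]
  by (simp add: con_def)

lemma con_inj: "inj_on con (Spec T)"
proof (rule inj_onI)
  fix q q' assume "q \<in> Spec T" "q' \<in> Spec T" and eq: "con q = con q'"
  then have q: "primeideal q T" "primeideal q' T" by (auto simp: Spec_def)
  have "t \<in> q \<longleftrightarrow> t \<in> q'" if t: "t \<in> carrier T" for t
    using numerator[OF t] mem_iff_numerator[OF q(1) t] mem_iff_numerator[OF q(2) t] eq by metis
  then show "q = q'" using T.prime_carr[OF q(1)] T.prime_carr[OF q(2)] by blast
qed

lemma con_Var: "q \<in> Spec T \<Longrightarrow> con q \<in> Spec R \<and> (b \<subseteq> q \<longleftrightarrow> a \<subseteq> con q)"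
proof -
  assume "q \<in> Spec T"
  then have q: "primeideal q T" by (simp add: Spec_def)
  have "b \<subseteq> q" if "a \<subseteq> con q"
  proof
    fix t assume t: "t \<in> b"
    then obtain f w where "f \<in> a" "w \<in> W" "\<phi> w \<otimes>\<^bsub>T\<^esub> t = \<phi> f" using b_numerator by blast
    then show "t \<in> q" using mem_iff_numerator[OF q b.Icarr[OF t]] that Icarr by blast
  qed
  moreover have "a \<subseteq> con q" if "b \<subseteq> q" unfolding con_def using that b_image Icarr by blast
  ultimately show ?thesis using con_prime[OF q] unfolding Spec_def by blast
qed

text \<open>Extension and contraction are inverse to each other on primes that contain the kernel of
  \<open>\<phi>\<close> and avoid \<open>W\<close>.\<close>

lemma ext_prime:
  assumes p: "primeideal p R" and W: "p \<inter> W = {}"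
    and ker: "\<And>r. r \<in> carrier R \<Longrightarrow> \<phi> r = \<zero>\<^bsub>T\<^esub> \<Longrightarrow> r \<in> p"
  shows "primeideal (ext p) T" "con (ext p) = p"
proof -
  note pR = R.prime_carr[OF p]
  interpret p: ideal p R using p by (rule primeideal.axioms(1))
  have mem: "r \<in> p" if t: "t \<in> ext p" and w: "w \<in> W" and r: "r \<in> carrier R" and e: "\<phi> w \<otimes>\<^bsub>T\<^esub> t = \<phi> r"
    for t w r
  proof -
    obtain r' w' where *: "t \<in> carrier T" "r' \<in> p" "w' \<in> W" "\<phi> w' \<otimes>\<^bsub>T\<^esub> t = \<phi> r'"
      using t by (auto simp: ext_def)
    note c = r pR[OF *(2)] W_carr[OF w] W_carr[OF *(3)]
    have "\<phi> (w' \<otimes>\<^bsub>R\<^esub> r) = \<phi> w' \<otimes>\<^bsub>T\<^esub> (\<phi> w \<otimes>\<^bsub>T\<^esub> t)" using c e by simp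
    also have "\<dots> = \<phi> w \<otimes>\<^bsub>T\<^esub> (\<phi> w' \<otimes>\<^bsub>T\<^esub> t)" using c *(1) by (simp add: T.m_lcomm)
    also have "\<dots> = \<phi> (w \<otimes>\<^bsub>R\<^esub> r')" using c *(4) by simp
    finally have "\<phi> (w' \<otimes>\<^bsub>R\<^esub> r \<ominus>\<^bsub>R\<^esub> w \<otimes>\<^bsub>R\<^esub> r') = \<zero>\<^bsub>T\<^esub>"
      using c by (simp add: R.minus_eq T.r_neg)
    then have "w' \<otimes>\<^bsub>R\<^esub> r \<ominus>\<^bsub>R\<^esub> w \<otimes>\<^bsub>R\<^esub> r' \<in> p" using ker c by simp
    moreover have "w \<otimes>\<^bsub>R\<^esub> r' \<in> p" using p.I_l_closed * c by simp
    ultimately have "(w' \<otimes>\<^bsub>R\<^esub> r \<ominus>\<^bsub>R\<^esub> w \<otimes>\<^bsub>R\<^esub> r') \<oplus>\<^bsub>R\<^esub> w \<otimes>\<^bsub>R\<^esub> r' \<in> p" by simp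
    moreover have "(w' \<otimes>\<^bsub>R\<^esub> r \<ominus>\<^bsub>R\<^esub> w \<otimes>\<^bsub>R\<^esub> r') \<oplus>\<^bsub>R\<^esub> w \<otimes>\<^bsub>R\<^esub> r' = w' \<otimes>\<^bsub>R\<^esub> r"
      using c by (simp add: R.minus_eq R.a_assoc R.l_neg)
    ultimately show "r \<in> p" using R.prime_mult_iff[OF p c(4,1)] W *(3) by auto
  qed
  have iff: "t \<in> ext p \<longleftrightarrow> r \<in> p"
    if "t \<in> carrier T" "w \<in> W" "r \<in> carrier R" "\<phi> w \<otimes>\<^bsub>T\<^esub> t = \<phi> r" for t w r
    using mem[OF _ that(2-4)] that by (auto simp: ext_def)
  show con: "con (ext p) = p"
    using iff[of "\<phi> _" "\<one>\<^bsub>R\<^esub>"] pR W_one by (auto simp: con_def)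
  have add: "x \<oplus>\<^bsub>T\<^esub> y \<in> ext p" if xy: "x \<in> ext p" "y \<in> ext p" for x y
  proof -
    obtain r v s w where *: "x \<in> carrier T" "y \<in> carrier T" "r \<in> p" "s \<in> p" "v \<in> W" "w \<in> W"
      "\<phi> v \<otimes>\<^bsub>T\<^esub> x = \<phi> r" "\<phi> w \<otimes>\<^bsub>T\<^esub> y = \<phi> s" using xy by (auto simp: ext_def)
    note c = *(1,2) W_carr[OF *(5)] W_carr[OF *(6)] pR[OF *(3)] pR[OF *(4)]
    have "\<phi> (v \<otimes>\<^bsub>R\<^esub> w) \<otimes>\<^bsub>T\<^esub> (x \<oplus>\<^bsub>T\<^esub> y) = \<phi> w \<otimes>\<^bsub>T\<^esub> (\<phi> v \<otimes>\<^bsub>T\<^esub> x) \<oplus>\<^bsub>T\<^esub> \<phi> v \<otimes>\<^bsub>T\<^esub> (\<phi> w \<otimes>\<^bsub>T\<^esub> y)"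
      using c by (simp add: T.r_distr T.m_ac)
    also have "\<dots> = \<phi> (w \<otimes>\<^bsub>R\<^esub> r \<oplus>\<^bsub>R\<^esub> v \<otimes>\<^bsub>R\<^esub> s)" unfolding *(7,8) using c by simp
    finally have "\<phi> (v \<otimes>\<^bsub>R\<^esub> w) \<otimes>\<^bsub>T\<^esub> (x \<oplus>\<^bsub>T\<^esub> y) = \<phi> (w \<otimes>\<^bsub>R\<^esub> r \<oplus>\<^bsub>R\<^esub> v \<otimes>\<^bsub>R\<^esub> s)" .
    moreover have "w \<otimes>\<^bsub>R\<^esub> r \<oplus>\<^bsub>R\<^esub> v \<otimes>\<^bsub>R\<^esub> s \<in> p" using *(3,4) c p.I_l_closed by simp
    ultimately show ?thesis using iff[of "x \<oplus>\<^bsub>T\<^esub> y" "v \<otimes>\<^bsub>R\<^esub> w" "w \<otimes>\<^bsub>R\<^esub> r \<oplus>\<^bsub>R\<^esub> v \<otimes>\<^bsub>R\<^esub> s"] c W_mult[OF *(5,6)]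
      by (simp del: \<phi>.hom_mult \<phi>.hom_add)
  qed
  have mult: "x \<otimes>\<^bsub>T\<^esub> y \<in> ext p \<longleftrightarrow> x \<in> ext p \<or> y \<in> ext p"
    if xy: "x \<in> carrier T" "y \<in> carrier T" for x y
  proof -
    obtain r v s w where *: "r \<in> carrier R" "s \<in> carrier R" "v \<in> W" "w \<in> W"
      "\<phi> v \<otimes>\<^bsub>T\<^esub> x = \<phi> r" "\<phi> w \<otimes>\<^bsub>T\<^esub> y = \<phi> s" using numerator xy by meson
    have "\<phi> (v \<otimes>\<^bsub>R\<^esub> w) \<otimes>\<^bsub>T\<^esub> (x \<otimes>\<^bsub>T\<^esub> y) = (\<phi> v \<otimes>\<^bsub>T\<^esub> x) \<otimes>\<^bsub>T\<^esub> (\<phi> w \<otimes>\<^bsub>T\<^esub> y)"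
      using xy W_carr *(3,4) by (simp add: T.m_ac)
    also have "\<dots> = \<phi> (r \<otimes>\<^bsub>R\<^esub> s)" unfolding *(5,6) using * by simp
    finally have "x \<otimes>\<^bsub>T\<^esub> y \<in> ext p \<longleftrightarrow> r \<otimes>\<^bsub>R\<^esub> s \<in> p" 
      using iff[of "x \<otimes>\<^bsub>T\<^esub> y" "v \<otimes>\<^bsub>R\<^esub> w" "r \<otimes>\<^bsub>R\<^esub> s"] xy * W_mult
      by (simp del: \<phi>.hom_mult)
    also have "\<dots> \<longleftrightarrow> x \<in> ext p \<or> y \<in> ext p"
      using R.prime_mult_iff[OF p] iff xy * by simp
    finally show ?thesis .
  qed
  have extT: "x \<in> ext p \<Longrightarrow> x \<in> carrier T" for x by (simp add: ext_def)
  have "\<zero>\<^bsub>R\<^esub> \<in> con (ext p)" unfolding con by (rule R.prime_zero[OF p])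
  then have "\<zero>\<^bsub>T\<^esub> \<in> ext p" by (simp add: con_def)
  have "ideal (ext p) T"
  proof (rule idealI[OF T.ring_axioms])
    show "subgroup (ext p) (add_monoid T)"
    proof (rule group.subgroupI[OF T.a_group])
      fix x assume x: "x \<in> ext p"
      have "(\<ominus>\<^bsub>T\<^esub> \<one>\<^bsub>T\<^esub>) \<otimes>\<^bsub>T\<^esub> x \<in> ext p" using mult[of "\<ominus>\<^bsub>T\<^esub> \<one>\<^bsub>T\<^esub>" x] x extT[OF x] by simp
      then have "\<ominus>\<^bsub>T\<^esub> x \<in> ext p" using extT[OF x] by (simp add: T.l_minus)
      then show "inv\<^bsub>add_monoid T\<^esub> x \<in> ext p" by (simp add: a_inv_def)
    qed (use add extT \<open>\<zero>\<^bsub>T\<^esub> \<in> ext p\<close> in auto)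
  qed (use mult extT in auto)
  moreover have "carrier T \<noteq> ext p"
  proof
    assume "carrier T = ext p"
    then have "\<one>\<^bsub>R\<^esub> \<in> con (ext p)" unfolding con_def by auto
    then show False unfolding con using R.prime_one[OF p] by blast
  qed
  ultimately show "primeideal (ext p) T" using mult by (intro primeidealI T.is_cring) auto
qed

end

locale fraction_map_module = fraction_map R T a b \<phi> W + N: module T N
  for R (structure) and T (structure) and a b \<phi> W and N (structure)
begin

lemma unit_cancel:
  assumes "w \<in> W" "y \<in> carrier N" "\<phi> w \<odot>\<^bsub>N\<^esub> y = \<zero>\<^bsub>N\<^esub>"
  shows "y = \<zero>\<^bsub>N\<^esub>"
proof -
  obtain u where u: "u \<in> carrier T" "u \<otimes>\<^bsub>T\<^esub> \<phi> w = \<one>\<^bsub>T\<^esub>" using W_unit[OF assms(1)] by blast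
  have "y = (u \<otimes>\<^bsub>T\<^esub> \<phi> w) \<odot>\<^bsub>N\<^esub> y" using u assms(2) by simp
  also have "\<dots> = u \<odot>\<^bsub>N\<^esub> (\<phi> w \<odot>\<^bsub>N\<^esub> y)"
    using u(1) assms(1,2) W_carr by (intro N.smult_assoc1) auto
  finally show ?thesis using u(1) assms(3) by simp
qed

text \<open>Since \<open>W\<close> acts on \<open>N\<close> by bijections, an element of \<open>W\<close> in a minimal prime over the
  annihilator in \<open>R\<close> could be cancelled, by the criterion for minimal primes.  So these
  primes avoid \<open>W\<close> and extend to the target ring.\<close>

lemma min_ann_con:
  assumes x: "x \<in> carrier N"
  shows "con ` min_Var T (annihilator T N x) = min_Var R {r \<in> carrier R. \<phi> r \<odot>\<^bsub>N\<^esub> x = \<zero>\<^bsub>N\<^esub>}"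
    (is "_ = min_Var R ?I")
proof -
  have I: "ideal ?I R"
  proof (rule idealI[OF R.ring_axioms])
    show "subgroup ?I (add_monoid R)"
      by (rule group.subgroupI[OF R.a_group])
        (use x in \<open>auto simp: N.smult_l_distr N.smult_l_minus a_inv_def[symmetric]
          intro: exI[of _ "\<zero>\<^bsub>R\<^esub>"]\<close>)
    fix s r assume "s \<in> ?I" "r \<in> carrier R"
    then have "\<phi> r \<odot>\<^bsub>N\<^esub> (\<phi> s \<odot>\<^bsub>N\<^esub> x) = \<zero>\<^bsub>N\<^esub>" "s \<in> carrier R" by auto
    moreover from this have "\<phi> s \<odot>\<^bsub>N\<^esub> (\<phi> r \<odot>\<^bsub>N\<^esub> x) = \<zero>\<^bsub>N\<^esub>"
      using \<open>r \<in> carrier R\<close> x N.smult_comm[of "\<phi> r" "\<phi> s" x] by simp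
    ultimately show "r \<otimes>\<^bsub>R\<^esub> s \<in> ?I" "s \<otimes>\<^bsub>R\<^esub> r \<in> ?I"
      using \<open>r \<in> carrier R\<close> x by (simp_all add: N.smult_assoc1)
  qed
  have "con q \<in> min_Var R ?I" if "q \<in> min_Var T (annihilator T N x)" for q
  proof -
    note Q = that[unfolded N.min_ann_iff[OF x]]
    then have q: "primeideal q T" by blast
    have "\<exists>t\<in>carrier R - con q. \<exists>n::nat. t \<otimes>\<^bsub>R\<^esub> r [^]\<^bsub>R\<^esub> n \<in> ?I" if r: "r \<in> con q" for r
    proof -
      have rR: "r \<in> carrier R" "\<phi> r \<in> q" using r by (auto simp: con_def)
      then obtain t and n :: nat where t: "t \<in> carrier T - q" "t \<odot>\<^bsub>N\<^esub> (\<phi> r [^]\<^bsub>T\<^esub> n \<odot>\<^bsub>N\<^esub> x) = \<zero>\<^bsub>N\<^esub>"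
        using Q by blast
      obtain s w where s: "s \<in> carrier R" "w \<in> W" "\<phi> w \<otimes>\<^bsub>T\<^esub> t = \<phi> s" using numerator t by blast
      have "\<phi> (s \<otimes>\<^bsub>R\<^esub> r [^]\<^bsub>R\<^esub> n) \<odot>\<^bsub>N\<^esub> x = (\<phi> w \<otimes>\<^bsub>T\<^esub> t) \<odot>\<^bsub>N\<^esub> (\<phi> r [^]\<^bsub>T\<^esub> n \<odot>\<^bsub>N\<^esub> x)"
        using s rR x by (simp add: \<phi>_pow N.smult_assoc1)
      also have "\<dots> = \<zero>\<^bsub>N\<^esub>" using t s(2) W_carr rR x by (simp add: N.smult_assoc1 del: \<phi>.hom_mult)
      finally have "s \<otimes>\<^bsub>R\<^esub> r [^]\<^bsub>R\<^esub> n \<in> ?I" using s rR by simp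
      moreover have "s \<notin> con q" using mem_iff_numerator[OF q _ s(2,1,3)] t by blast
      ultimately show ?thesis using s by blast
    qed
    moreover have "?I \<subseteq> con q" using Q by (auto simp: con_def)
    ultimately show ?thesis unfolding R.min_Var_iff[OF I] using con_prime[OF q] by blast
  qed
  moreover have "\<exists>q\<in>min_Var T (annihilator T N x). con q = p" if p: "p \<in> min_Var R ?I" for p
  proof -
    note P = p[unfolded R.min_Var_iff[OF I]]
    then have pp: "primeideal p R" by blast
    have "p \<inter> W = {}"
    proof (rule ccontr)
      assume "p \<inter> W \<noteq> {}"
      then obtain w where w: "w \<in> p" "w \<in> W" by blast
      then obtain t and n :: nat where t: "t \<in> carrier R - p" "t \<otimes>\<^bsub>R\<^esub> w [^]\<^bsub>R\<^esub> n \<in> ?I" using P by blast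
      have wn: "w [^]\<^bsub>R\<^esub> n \<in> W" using w(2) by (induction n) (auto intro: W_one W_mult)
      have "\<phi> (w [^]\<^bsub>R\<^esub> n) \<odot>\<^bsub>N\<^esub> (\<phi> t \<odot>\<^bsub>N\<^esub> x) = \<zero>\<^bsub>N\<^esub>"
        using t x W_carr[OF wn] by (simp add: N.smult_assoc1 N.smult_comm[of "\<phi> (w [^]\<^bsub>R\<^esub> n)"])
      then have "\<phi> t \<odot>\<^bsub>N\<^esub> x = \<zero>\<^bsub>N\<^esub>" using unit_cancel[OF wn] t x by simp
      then show False using t P by auto
    qed
    moreover have "r \<in> p" if "r \<in> carrier R" "\<phi> r = \<zero>\<^bsub>T\<^esub>" for r using that x P by auto
    ultimately have e: "primeideal (ext p) T" "con (ext p) = p"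
      using ext_prime[OF pp] by auto
    have "\<exists>t\<in>carrier T - ext p. \<exists>n::nat. t \<odot>\<^bsub>N\<^esub> (z [^]\<^bsub>T\<^esub> n \<odot>\<^bsub>N\<^esub> x) = \<zero>\<^bsub>N\<^esub>" if z: "z \<in> ext p" for z
    proof -
      obtain r w where r: "z \<in> carrier T" "r \<in> p" "w \<in> W" "\<phi> w \<otimes>\<^bsub>T\<^esub> z = \<phi> r"
        using z by (auto simp: ext_def)
      note rR = R.prime_carr[OF pp r(2)]
      obtain t and n :: nat where t: "t \<in> carrier R - p" "t \<otimes>\<^bsub>R\<^esub> r [^]\<^bsub>R\<^esub> n \<in> ?I" using P r by blast
      have wn: "w [^]\<^bsub>R\<^esub> n \<in> W" using r(3) by (induction n) (auto intro: W_one W_mult)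
      have "\<phi> (w [^]\<^bsub>R\<^esub> n) \<odot>\<^bsub>N\<^esub> (\<phi> t \<odot>\<^bsub>N\<^esub> (z [^]\<^bsub>T\<^esub> n \<odot>\<^bsub>N\<^esub> x))
          = \<phi> t \<odot>\<^bsub>N\<^esub> ((\<phi> w [^]\<^bsub>T\<^esub> n \<otimes>\<^bsub>T\<^esub> z [^]\<^bsub>T\<^esub> n) \<odot>\<^bsub>N\<^esub> x)"
        using t x r W_carr[OF r(3)]
        by (simp add: N.smult_assoc1 N.smult_comm[of "\<phi> w [^]\<^bsub>T\<^esub> n"] \<phi>_pow)
      also have "\<dots> = \<phi> t \<odot>\<^bsub>N\<^esub> (\<phi> r [^]\<^bsub>T\<^esub> n \<odot>\<^bsub>N\<^esub> x)"
        using r W_carr[OF r(3)] by (simp add: T.nat_pow_distrib[symmetric])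
      also have "\<dots> = \<zero>\<^bsub>N\<^esub>" using t rR x by (simp add: N.smult_assoc1 \<phi>_pow)
      finally have "\<phi> t \<odot>\<^bsub>N\<^esub> (z [^]\<^bsub>T\<^esub> n \<odot>\<^bsub>N\<^esub> x) = \<zero>\<^bsub>N\<^esub>"
        using unit_cancel[OF wn] t x r by simp
      moreover have "\<phi> t \<notin> ext p" using t e(2) by (auto simp: con_def)
      ultimately show ?thesis using t by (metis DiffD1 DiffI \<phi>.hom_closed)
    qed
    moreover have "z \<in> ext p" if z: "z \<in> carrier T" "z \<odot>\<^bsub>N\<^esub> x = \<zero>\<^bsub>N\<^esub>" for z
    proof -
      obtain r w where r: "r \<in> carrier R" "w \<in> W" "\<phi> w \<otimes>\<^bsub>T\<^esub> z = \<phi> r" using numerator z by blast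
      have "\<phi> r \<odot>\<^bsub>N\<^esub> x = \<zero>\<^bsub>N\<^esub>" unfolding r(3)[symmetric] using z x W_carr[OF r(2)] by (simp add: N.smult_assoc1)
      then have "r \<in> p" using P r by blast
      then show ?thesis using r z by (auto simp: ext_def)
    qed
    ultimately have "ext p \<in> min_Var T (annihilator T N x)" unfolding N.min_ann_iff[OF x] using e by blast
    then show ?thesis using e by blast
  qed
  ultimately show ?thesis by blast
qed

text \<open>Restriction of scalars along \<open>\<phi>\<close>.\<close>

definition restr :: "('a, 'e) module" where
  "restr = \<lparr>carrier = carrier N, mult = undefined, one = undefined, zero = \<zero>\<^bsub>N\<^esub>, add = add N,
    smult = (\<lambda>r x. \<phi> r \<odot>\<^bsub>N\<^esub> x)\<rparr>"

lemma restr_simps [simp]: "carrier restr = carrier N" "\<zero>\<^bsub>restr\<^esub> = \<zero>\<^bsub>N\<^esub>"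
  "x \<oplus>\<^bsub>restr\<^esub> y = x \<oplus>\<^bsub>N\<^esub> y" "r \<odot>\<^bsub>restr\<^esub> x = \<phi> r \<odot>\<^bsub>N\<^esub> x"
  by (simp_all add: restr_def)

lemma restr_is_module: "module R restr"
proof (rule moduleI[OF R.is_cring])
  show "abelian_group restr"
    by (rule abelian_groupI) (auto simp: N.M.a_ac intro: bexI[of _ "\<ominus>\<^bsub>N\<^esub> _"] N.M.l_neg)
qed (auto simp: N.smult_l_distr N.smult_r_distr N.smult_assoc1)

lemma power_kills_restr: "x \<in> carrier N \<Longrightarrow> power_kills b N n x \<longleftrightarrow> power_kills a restr n x"
proof (induction n arbitrary: x)
  case (Suc n)
  interpret N': module_ideal T N b by unfold_locales
  have "power_kills b N n (\<beta> \<odot>\<^bsub>N\<^esub> x)" if "\<forall>f\<in>a. power_kills b N n (\<phi> f \<odot>\<^bsub>N\<^esub> x)" "\<beta> \<in> b" for \<beta>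
  proof -
    have "\<beta> \<in> b" using that(2) .
    note \<beta> = b.Icarr[OF this]
    obtain f w where f: "f \<in> a" "w \<in> W" "\<phi> w \<otimes>\<^bsub>T\<^esub> \<beta> = \<phi> f" using b_numerator[OF \<open>\<beta> \<in> b\<close>] by blast
    obtain u where u: "u \<in> carrier T" "u \<otimes>\<^bsub>T\<^esub> \<phi> w = \<one>\<^bsub>T\<^esub>" using W_unit[OF f(2)] by blast
    have "u \<odot>\<^bsub>N\<^esub> (\<phi> f \<odot>\<^bsub>N\<^esub> x) = (u \<otimes>\<^bsub>T\<^esub> \<phi> w) \<odot>\<^bsub>N\<^esub> (\<beta> \<odot>\<^bsub>N\<^esub> x)"
      unfolding f(3)[symmetric] using u(1) \<beta> W_carr[OF f(2)] Suc.prems by (simp add: N.smult_assoc1)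
    then show ?thesis
      using N'.power_kills_smult[of n "\<phi> f \<odot>\<^bsub>N\<^esub> x" u] that f(1) u \<beta> Icarr[OF f(1)] Suc.prems by simp
  qed
  moreover have "power_kills a restr n (\<phi> f \<odot>\<^bsub>N\<^esub> x) \<longleftrightarrow> power_kills b N n (\<phi> f \<odot>\<^bsub>N\<^esub> x)" if "f \<in> a" for f
    using Suc that Icarr by simp
  ultimately have "(\<forall>\<beta>\<in>b. power_kills b N n (\<beta> \<odot>\<^bsub>N\<^esub> x)) \<longleftrightarrow> (\<forall>f\<in>a. power_kills a restr n (\<phi> f \<odot>\<^bsub>N\<^esub> x))"
    using b_image by blast
  then show ?case by simp
qed simp

lemma property_at_restr: "property_at P R a restr \<longleftrightarrow> property_at P T b N"
proof (rule property_at_transfer[where f = "\<lambda>x. x" and con = con])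
  interpret M: module_ideal R restr a by (intro module_ideal.intro restr_is_module is_ideal)
  interpret N': module_ideal T N b by unfold_locales
  show "torsion T b N = (\<lambda>x. x) ` torsion R a restr"
    using power_kills_restr unfolding image_ident set_eq_iff M.torsion_iff N'.torsion_iff restr_simps
    by blast
  have "\<exists>n::nat. \<beta> [^]\<^bsub>T\<^esub> n \<odot>\<^bsub>N\<^esub> x = \<zero>\<^bsub>N\<^esub>"
    if x: "x \<in> carrier N" and *: "\<forall>f\<in>a. \<exists>n::nat. \<phi> (f [^]\<^bsub>R\<^esub> n) \<odot>\<^bsub>N\<^esub> x = \<zero>\<^bsub>N\<^esub>" and "\<beta> \<in> b" for x \<beta>
  proof -
    note \<beta> = b.Icarr[OF that(3)]
    obtain f w where f: "f \<in> a" "w \<in> W" "\<phi> w \<otimes>\<^bsub>T\<^esub> \<beta> = \<phi> f" using b_numerator[OF \<open>\<beta> \<in> b\<close>] by blast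
    obtain n :: nat where n: "\<phi> (f [^]\<^bsub>R\<^esub> n) \<odot>\<^bsub>N\<^esub> x = \<zero>\<^bsub>N\<^esub>" using * f(1) by blast
    have wn: "w [^]\<^bsub>R\<^esub> n \<in> W" using f(2) by (induction n) (auto intro: W_one W_mult)
    have "\<phi> (w [^]\<^bsub>R\<^esub> n) \<odot>\<^bsub>N\<^esub> (\<beta> [^]\<^bsub>T\<^esub> n \<odot>\<^bsub>N\<^esub> x) = (\<phi> w \<otimes>\<^bsub>T\<^esub> \<beta>) [^]\<^bsub>T\<^esub> n \<odot>\<^bsub>N\<^esub> x"
      using \<beta> x W_carr[OF f(2)] by (simp add: N.smult_assoc1 T.nat_pow_distrib \<phi>_pow)
    also have "\<dots> = \<zero>\<^bsub>N\<^esub>" unfolding f(3) using n Icarr[OF f(1)] by (simp add: \<phi>_pow)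
    finally have "\<beta> [^]\<^bsub>T\<^esub> n \<odot>\<^bsub>N\<^esub> x = \<zero>\<^bsub>N\<^esub>" using unit_cancel[OF wn] \<beta> x by simp
    then show ?thesis by blast
  qed
  then have "x \<in> large_torsion T b N \<longleftrightarrow> x \<in> large_torsion R a restr" for x
    using b_image Icarr unfolding M.large_torsion_iff N'.large_torsion_iff
    by (simp add: \<phi>_pow) blast
  then show "large_torsion T b N = (\<lambda>x. x) ` large_torsion R a restr" by auto
  show "min_Var R (annihilator R restr x) = con ` min_Var T (annihilator T N x)"
    if "x \<in> carrier restr" for x
    using min_ann_con[of x] that by (simp add: annihilator_def)
qed (auto simp: con_inj con_Var)

end

locale ideal_fractions = ring_fractions R S + ideal a R for R (structure) and S and a
begin

abbreviation "b \<equiv> loc_ideal R S a"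

abbreviation \<phi> :: "'a \<Rightarrow> ('a \<times> 'a) set" where
  "\<phi> r \<equiv> A.fR r \<one>"

lemma loc_ideal_iff: "t \<in> b \<longleftrightarrow> (\<exists>f\<in>a. \<exists>s\<in>A.W. t = A.fR f s)"
  by (auto simp: loc_ideal_def)

lemma loc_ideal_ideal: "ideal b T"
proof -
  interpret T: cring T by (rule T_cring)
  have carr: "t \<in> b \<Longrightarrow> t \<in> carrier T" for t using Icarr by (auto simp: loc_ideal_iff T_carrier)
  have mult: "x \<otimes>\<^bsub>T\<^esub> t \<in> b" if "t \<in> b" "x \<in> carrier T" for t x
  proof -
    obtain f s r w where *: "f \<in> a" "s \<in> A.W" "t = A.fR f s" "r \<in> carrier R" "w \<in> A.W" "x = A.fR r w"
      using \<open>t \<in> b\<close> \<open>x \<in> carrier T\<close> unfolding loc_ideal_iff T_carrier by blast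
    then have "x \<otimes>\<^bsub>T\<^esub> t = A.fR (r \<otimes> f) (w \<otimes> s)" using Icarr by (simp add: T_mult)
    then show ?thesis unfolding loc_ideal_iff using I_l_closed * A.W_mult by blast
  qed
  have add: "x \<oplus>\<^bsub>T\<^esub> y \<in> b" if "x \<in> b" "y \<in> b" for x y
  proof -
    obtain f s g t where *: "f \<in> a" "s \<in> A.W" "x = A.fR f s" "g \<in> a" "t \<in> A.W" "y = A.fR g t"
      using \<open>x \<in> b\<close> \<open>y \<in> b\<close> unfolding loc_ideal_iff by blast
    then have "x \<oplus>\<^bsub>T\<^esub> y = A.fR (t \<otimes> f \<oplus> s \<otimes> g) (s \<otimes> t)"
      using Icarr A.loc_add by (simp add: T_simps)
    moreover have "t \<otimes> f \<oplus> s \<otimes> g \<in> a" using * by (intro a_closed I_l_closed A.W_carr)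
    ultimately show ?thesis unfolding loc_ideal_iff using *(2,5) A.W_mult by blast
  qed
  show ?thesis
  proof (rule idealI[OF T.ring_axioms])
    show "subgroup b (add_monoid T)"
    proof (rule group.subgroupI[OF T.a_group])
      show "b \<subseteq> carrier (add_monoid T)" using carr by auto
      show "b \<noteq> {}" using zero_closed A.W_one unfolding loc_ideal_iff[symmetric] set_eq_iff loc_ideal_iff by blast
      show "inv\<^bsub>add_monoid T\<^esub> x \<in> b" if "x \<in> b" for x
      proof -
        have "\<ominus>\<^bsub>T\<^esub> x \<in> b" using mult[OF that, of "\<ominus>\<^bsub>T\<^esub> \<one>\<^bsub>T\<^esub>"] carr[OF that] by (simp add: T.l_minus)
        then show ?thesis by (simp add: a_inv_def)
      qed
    qed (use add in auto)
  qed (use mult carr T.m_comm in auto)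
qed

lemma \<phi>_mult_frac: "r \<in> carrier R \<Longrightarrow> w \<in> A.W \<Longrightarrow> \<phi> w \<otimes>\<^bsub>T\<^esub> A.fR r w = \<phi> r"
  using A.fr_cancel[of r \<one> w] by (simp add: T_mult)

lemma fraction_map: "fraction_map R T a b \<phi> A.W"
proof (intro fraction_map.intro fraction_map_axioms.intro)
  show "\<phi> \<in> ring_hom R T"
    by (rule ring_hom_memI) (simp_all add: T_mult T_add_same T_one, simp add: T_simps)
  show "\<exists>u\<in>carrier T. u \<otimes>\<^bsub>T\<^esub> \<phi> w = \<one>\<^bsub>T\<^esub>" if w: "w \<in> A.W" for w
  proof
    show "A.fR \<one> w \<in> carrier T" unfolding T_carrier using w by blast
    have "A.fR w w = A.fR \<one> \<one>" using w by (subst A.fr_eq_iff) auto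
    then show "A.fR \<one> w \<otimes>\<^bsub>T\<^esub> \<phi> w = \<one>\<^bsub>T\<^esub>" using w by (simp add: T_mult T_one)
  qed
  show "\<exists>r\<in>carrier R. \<exists>w\<in>A.W. \<phi> w \<otimes>\<^bsub>T\<^esub> t = \<phi> r" if "t \<in> carrier T" for t
    using that \<phi>_mult_frac unfolding T_carrier by blast
  show "\<exists>f\<in>a. \<exists>w\<in>A.W. \<phi> w \<otimes>\<^bsub>T\<^esub> t = \<phi> f" if "t \<in> b" for t
    using that \<phi>_mult_frac Icarr unfolding loc_ideal_iff by blast
  show "\<phi> f \<in> b" if "f \<in> a" for f using that A.W_one unfolding loc_ideal_iff by blast
qed (use T_cring is_cring loc_ideal_ideal is_ideal in auto)

text \<open>Restriction of scalars turns every module over the localisation into an \<open>R\<close>-module on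
  the same type, to which the property of \<open>a\<close> applies.\<close>

lemma has_property_localises:
  assumes "has_property P TYPE('m) R a"
  shows "has_property P TYPE('m) T b"
  unfolding has_property_iff
proof (intro allI impI)
  fix N :: "(('a \<times> 'a) set, 'm) module" assume N: "module T N"
  interpret F: fraction_map_module R T a b \<phi> A.W N
    by (intro fraction_map_module.intro fraction_map N)
  show "property_at P T b N"
    using assms F.restr_is_module F.property_at_restr unfolding has_property_iff by blast
qed

end

section \<open>Localisations of modules\<close>

context fractions begin

text \<open>Localisation does not increase cardinality, so that a localised module is again covered
  by properties of modules on the original type: \<open>x / s\<close> is determined by the pair
  \<open>(x, s x)\<close>, and \<open>M \<times> M\<close> is equipotent to \<open>M\<close> for infinite \<open>M\<close>.  For finite
  \<open>M\<close> the sequence \<open>s\<^sup>i x\<close> has a repetition, and so \<open>x / s\<close> has a representative with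
  denominator \<open>1\<close>.\<close>

lemma loc_module_embeds: "\<exists>f :: ('c \<times> 'a) set \<Rightarrow> 'c. inj_on f (carrier L)"
proof (cases "finite (carrier M)")
  case True
  have "carrier L \<subseteq> (\<lambda>y. fr y \<one>\<^bsub>R\<^esub>) ` carrier M"
  proof
    fix X assume "X \<in> carrier L"
    then obtain x s where x: "x \<in> carrier M" "s \<in> W" "X = fr x s" by (auto simp: loc_carrier)
    have sR: "s \<in> carrier R" using x by simp
    have sW: "s [^]\<^bsub>R\<^esub> (i::nat) \<in> W" for i using x(2) by (induction i) auto
    define g where "g i = s [^]\<^bsub>R\<^esub> (i::nat) \<odot>\<^bsub>M\<^esub> x" for i
    have "range g \<subseteq> carrier M" using x by (auto simp: g_def)
    then have "finite (range g)" using True finite_subset by blast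
    then have "\<not> inj g" using infinite_UNIV_nat finite_imageD by blast
    then obtain i j where ij: "g i = g j" "i < j" by (metis injI linorder_neqE_nat)
    define y where "y = s [^]\<^bsub>R\<^esub> (j - i - 1) \<odot>\<^bsub>M\<^esub> x"
    have "s [^]\<^bsub>R\<^esub> i \<otimes>\<^bsub>R\<^esub> (s [^]\<^bsub>R\<^esub> (j - i - 1) \<otimes>\<^bsub>R\<^esub> s) = s [^]\<^bsub>R\<^esub> i \<otimes>\<^bsub>R\<^esub> s [^]\<^bsub>R\<^esub> Suc (j - i - 1)" by simp
    also have "\<dots> = s [^]\<^bsub>R\<^esub> j" using sR ij(2) by (subst R.nat_pow_mult) auto
    finally have "s [^]\<^bsub>R\<^esub> i \<odot>\<^bsub>M\<^esub> (s \<odot>\<^bsub>M\<^esub> y) = g j"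
      unfolding y_def g_def using sR x by (simp add: smult_norm)
    then have "s [^]\<^bsub>R\<^esub> i \<odot>\<^bsub>M\<^esub> (\<one>\<^bsub>R\<^esub> \<odot>\<^bsub>M\<^esub> x) = s [^]\<^bsub>R\<^esub> i \<odot>\<^bsub>M\<^esub> (s \<odot>\<^bsub>M\<^esub> y)"
      using ij(1) x by (simp add: g_def)
    moreover have y: "y \<in> carrier M" using x by (simp add: y_def)
    ultimately have "fr x s = fr y \<one>\<^bsub>R\<^esub>" using fr_eq_iff[OF x(1) y x(2) W_one] sW by blast
    then show "X \<in> (\<lambda>y. fr y \<one>\<^bsub>R\<^esub>) ` carrier M" using y x(3) by blast
  qed
  then show ?thesis using inj_on_inv_into by blast
next
  case False
  define g where "g = (\<lambda>(x, z). SOME X. \<exists>s\<in>W. z = s \<odot>\<^bsub>M\<^esub> x \<and> X = fr x s)"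
  have "carrier L \<subseteq> g ` (carrier M \<times> carrier M)"
  proof
    fix X assume "X \<in> carrier L"
    then obtain x s where x: "x \<in> carrier M" "s \<in> W" "X = fr x s" by (auto simp: loc_carrier)
    have "\<exists>t\<in>W. s \<odot>\<^bsub>M\<^esub> x = t \<odot>\<^bsub>M\<^esub> x \<and> g (x, s \<odot>\<^bsub>M\<^esub> x) = fr x t"
      unfolding g_def prod.case by (rule someI[of _ "fr x s"]) (use x in blast)
    then obtain t where t: "t \<in> W" "s \<odot>\<^bsub>M\<^esub> x = t \<odot>\<^bsub>M\<^esub> x" "g (x, s \<odot>\<^bsub>M\<^esub> x) = fr x t" by blast
    have "\<one>\<^bsub>R\<^esub> \<odot>\<^bsub>M\<^esub> (t \<odot>\<^bsub>M\<^esub> x) = \<one>\<^bsub>R\<^esub> \<odot>\<^bsub>M\<^esub> (s \<odot>\<^bsub>M\<^esub> x)" using t(2) by simp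
    then have "fr x s = fr x t" using fr_eq_iff[OF x(1,1,2) t(1)] W_one by blast
    then have "X = g (x, s \<odot>\<^bsub>M\<^esub> x)" using t x by simp
    moreover have "(x, s \<odot>\<^bsub>M\<^esub> x) \<in> carrier M \<times> carrier M" using x by simp
    ultimately show "X \<in> g ` (carrier M \<times> carrier M)" by blast
  qed
  then have 1: "inj_on (inv_into (carrier M \<times> carrier M) g) (carrier L)"
    and 2: "inv_into (carrier M \<times> carrier M) g ` carrier L \<subseteq> carrier M \<times> carrier M"
    using inv_into_into[of _ g "carrier M \<times> carrier M"] by (blast intro: inj_on_inv_into)+
  obtain h where "bij_betw h (carrier M \<times> carrier M) (carrier M)"
    using card_of_Times_same_infinite[OF False] unfolding card_of_ordIso[symmetric] by blast
  then have "inj_on h (inv_into (carrier M \<times> carrier M) g ` carrier L)"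
    using 2 by (auto simp: bij_betw_def intro: inj_on_subset)
  then show ?thesis using comp_inj_on[OF 1] by blast
qed

text \<open>The form in which \<open>\<rho>\<close> enters: it allows to clear denominators of torsion
  elements.\<close>

lemma rho_surjective:
  assumes iso: "rho R S a M \<in> module_iso T (loc_module R S (M\<lparr>carrier := torsion R a M\<rparr>))
      (L\<lparr>carrier := torsion T b L\<rparr>)"
    and X: "X \<in> torsion T b L"
  obtains y s where "y \<in> torsion R a M" "s \<in> W" "X = fr y s"
proof -
  let ?G = "M\<lparr>carrier := torsion R a M\<rparr>"
  have "X \<in> rho R S a M ` carrier (loc_module R S ?G)"
    using iso X by (auto simp: module_iso_def iso_def bij_betw_def)
  then obtain Y where Y: "Y \<in> carrier (loc_module R S ?G)" "X = rho R S a M Y" by blast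
  then obtain y s where y: "y \<in> torsion R a M" "s \<in> W" "Y = frac R S ?G y s"
    by (auto simp: loc_module_def)
  have yM: "y \<in> carrier M" using y(1) by (simp add: torsion_def)
  have "Y \<subseteq> fr y s" unfolding y(3) by (auto simp: frac_def torsion_def)
  then have "fr y' s' = fr y s" if "(y', s') \<in> Y" for y' s' using fr_mem_eq[OF _ yM y(2)] that by blast
  moreover have "(y, s) \<in> Y" unfolding y(3) using y(1,2) by (auto simp: frac_def)
  ultimately have "(\<Union>(y', s')\<in>Y. fr y' s') = fr y s" by blast
  then have "X = fr y s" using Y by (simp add: rho_def)
  with y(1,2) show thesis by (rule that)
qed

end

lemma (in cring) mult_closure_prime_complement:
  assumes m: "primeideal m R"
  shows "mult_closure R (carrier R - m) = carrier R - m"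
proof -
  have "submonoid (carrier R - m) R"
    using prime_one[OF m] prime_mult_iff[OF m] by (intro submonoid.intro) auto
  then show ?thesis unfolding mult_closure_def by blast
qed

locale module_at_prime = module_ideal R M a for R (structure) and M (structure) and a +
  fixes m :: "'a set"
  assumes m: "primeideal m R"
begin

abbreviation "C \<equiv> carrier R - m"

sublocale fractions R M C
  by (intro fractions.intro fractions_axioms.intro module_axioms) blast

lemma W_eq: "W = C"
  by (rule R.mult_closure_prime_complement[OF m])

sublocale I: ideal_fractions R C a
  by (intro ideal_fractions.intro ring_fractions is_ideal)

sublocale F: fraction_map_module R T a I.b I.\<phi> W L
  by (intro fraction_map_module.intro I.fraction_map loc_is_module)

text \<open>Over \<open>R\<close>, the annihilator of \<open>x / s\<close> is the saturation of the annihilator of \<open>x\<close> with respect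
  to the complement of \<open>m\<close>.  Both have the same minimal primes below \<open>m\<close>, and a minimal
  prime over the saturation lies below \<open>m\<close>.\<close>

lemma min_ann_fr:
  assumes x: "x \<in> carrier M" and s: "s \<in> W"
  shows "F.con ` min_Var T (annihilator T L (fr x s)) = {p \<in> min_Var R (annihilator R M x). p \<subseteq> m}"
proof -
  let ?K = "{r \<in> carrier R. I.\<phi> r \<odot>\<^bsub>L\<^esub> fr x s = \<zero>\<^bsub>L\<^esub>}"
  interpret N: module R F.restr by (rule F.restr_is_module)
  have "?K = annihilator R F.restr (fr x s)" by (simp add: annihilator_def)
  then have Kideal: "ideal ?K R" using N.annihilator_ideal[of "fr x s"] x s by simp
  have K: "r \<in> ?K \<longleftrightarrow> r \<in> carrier R \<and> (\<exists>u\<in>C. u \<odot>\<^bsub>M\<^esub> (r \<odot>\<^bsub>M\<^esub> x) = \<zero>\<^bsub>M\<^esub>)" for r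
  proof -
    have "I.\<phi> r \<odot>\<^bsub>L\<^esub> fr x s = fr (r \<odot>\<^bsub>M\<^esub> x) s" if "r \<in> carrier R"
      using that x s by (simp add: loc_smult)
    then show ?thesis
      using fr_zero_iff[OF smult_closed[OF _ x] s] unfolding W_eq mem_Collect_eq by metis
  qed
  have "p \<in> min_Var R ?K \<longleftrightarrow> p \<in> min_Var R (annihilator R M x) \<and> p \<subseteq> m" for p
  proof
    assume "p \<in> min_Var R ?K"
    note P = this[unfolded R.min_Var_iff[OF Kideal]]
    then have p: "primeideal p R" by blast
    have Kp: "r \<in> p" if "r \<in> carrier R" "u \<in> C" "u \<odot>\<^bsub>M\<^esub> (r \<odot>\<^bsub>M\<^esub> x) = \<zero>\<^bsub>M\<^esub>" for r u
      using P K that by blast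
    have pm: "p \<subseteq> m"
    proof (rule ccontr)
      assume "\<not> p \<subseteq> m"
      then obtain w where w: "w \<in> p" "w \<in> C" using R.prime_carr[OF p] by blast
      then obtain t and n :: nat where t: "t \<in> carrier R - p" "t \<otimes>\<^bsub>R\<^esub> w [^]\<^bsub>R\<^esub> n \<in> ?K" using P by blast
      then obtain u where u: "u \<in> C" "u \<odot>\<^bsub>M\<^esub> ((t \<otimes>\<^bsub>R\<^esub> w [^]\<^bsub>R\<^esub> n) \<odot>\<^bsub>M\<^esub> x) = \<zero>\<^bsub>M\<^esub>" using K by blast
      have "w [^]\<^bsub>R\<^esub> n \<in> C" using w R.prime_powD[OF m] by auto
      then have "u \<otimes>\<^bsub>R\<^esub> w [^]\<^bsub>R\<^esub> n \<in> C" using u R.prime_mult_iff[OF m] by auto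
      moreover have "(u \<otimes>\<^bsub>R\<^esub> w [^]\<^bsub>R\<^esub> n) \<odot>\<^bsub>M\<^esub> (t \<odot>\<^bsub>M\<^esub> x) = \<zero>\<^bsub>M\<^esub>"
        using u t w x by (simp add: smult_norm)
      ultimately have "t \<in> p" using Kp[of t] t by blast
      then show False using t by blast
    qed
    have "\<exists>t\<in>carrier R - p. \<exists>n::nat. t \<odot>\<^bsub>M\<^esub> (r [^]\<^bsub>R\<^esub> n \<odot>\<^bsub>M\<^esub> x) = \<zero>\<^bsub>M\<^esub>" if r: "r \<in> p" for r
    proof -
      obtain t and n :: nat where t: "t \<in> carrier R - p" "t \<otimes>\<^bsub>R\<^esub> r [^]\<^bsub>R\<^esub> n \<in> ?K" using P r by blast
      then obtain u where u: "u \<in> C" "u \<odot>\<^bsub>M\<^esub> ((t \<otimes>\<^bsub>R\<^esub> r [^]\<^bsub>R\<^esub> n) \<odot>\<^bsub>M\<^esub> x) = \<zero>\<^bsub>M\<^esub>" using K by blast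
      have "u \<otimes>\<^bsub>R\<^esub> t \<in> carrier R - p" using u t pm R.prime_mult_iff[OF p] by auto
      moreover have "(u \<otimes>\<^bsub>R\<^esub> t) \<odot>\<^bsub>M\<^esub> (r [^]\<^bsub>R\<^esub> n \<odot>\<^bsub>M\<^esub> x) = \<zero>\<^bsub>M\<^esub>"
        using u t x R.prime_carr[OF p r] by (simp add: smult_norm)
      ultimately show ?thesis by blast
    qed
    moreover have "r \<in> p" if "r \<in> carrier R" "r \<odot>\<^bsub>M\<^esub> x = \<zero>\<^bsub>M\<^esub>" for r
      using Kp[of r "\<one>\<^bsub>R\<^esub>"] that R.prime_one[OF m] x by simp
    ultimately show "p \<in> min_Var R (annihilator R M x) \<and> p \<subseteq> m"
      unfolding min_ann_iff[OF x] using p pm by blast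
  next
    assume *: "p \<in> min_Var R (annihilator R M x) \<and> p \<subseteq> m"
    note P = conjunct1[OF *, unfolded min_ann_iff[OF x]]
    have p: "primeideal p R" using P by blast
    have "r \<in> p" if r: "r \<in> ?K" for r
    proof -
      obtain u where u: "u \<in> C" "u \<odot>\<^bsub>M\<^esub> (r \<odot>\<^bsub>M\<^esub> x) = \<zero>\<^bsub>M\<^esub>" using r K by blast
      have rR: "r \<in> carrier R" using r by simp
      then have "u \<otimes>\<^bsub>R\<^esub> r \<in> p" using P u x by (simp add: smult_assoc1)
      then show ?thesis using R.prime_mult_iff[OF p, of u r] u rR * by auto
    qed
    moreover have "\<exists>t\<in>carrier R - p. \<exists>n::nat. t \<otimes>\<^bsub>R\<^esub> r [^]\<^bsub>R\<^esub> n \<in> ?K" if r: "r \<in> p" for r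
    proof -
      obtain t and n :: nat where t: "t \<in> carrier R - p" "t \<odot>\<^bsub>M\<^esub> (r [^]\<^bsub>R\<^esub> n \<odot>\<^bsub>M\<^esub> x) = \<zero>\<^bsub>M\<^esub>"
        using P r by blast
      have "t \<otimes>\<^bsub>R\<^esub> r [^]\<^bsub>R\<^esub> n \<in> carrier R" "\<one>\<^bsub>R\<^esub> \<in> C"
        "\<one>\<^bsub>R\<^esub> \<odot>\<^bsub>M\<^esub> ((t \<otimes>\<^bsub>R\<^esub> r [^]\<^bsub>R\<^esub> n) \<odot>\<^bsub>M\<^esub> x) = \<zero>\<^bsub>M\<^esub>"
        using t R.prime_carr[OF p r] x R.prime_one[OF m] by (simp_all add: smult_assoc1)
      then show ?thesis using t(1) K by blast
    qed
    ultimately show "p \<in> min_Var R ?K" unfolding R.min_Var_iff[OF Kideal] using p by blast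
  qed
  then show ?thesis using F.min_ann_con[of "fr x s"] x s by auto
qed

end

section \<open>From the localisations back to the ring\<close>

lemma (in module) nilpotent_on_iff:
  assumes y: "y \<in> carrier M" and c: "c \<in> carrier R"
  shows "(\<exists>k::nat. c [^]\<^bsub>R\<^esub> k \<odot>\<^bsub>M\<^esub> y = \<zero>\<^bsub>M\<^esub>) \<longleftrightarrow>
    (\<forall>q. primeideal q R \<longrightarrow> annihilator R M y \<subseteq> q \<longrightarrow> c \<in> q)"
proof
  assume "\<exists>k::nat. c [^]\<^bsub>R\<^esub> k \<odot>\<^bsub>M\<^esub> y = \<zero>\<^bsub>M\<^esub>"
  then obtain k :: nat where "c [^]\<^bsub>R\<^esub> k \<in> annihilator R M y" using c by (auto simp: annihilator_def)
  then show "\<forall>q. primeideal q R \<longrightarrow> annihilator R M y \<subseteq> q \<longrightarrow> c \<in> q"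
    using R.prime_powD c by blast
next
  assume *: "\<forall>q. primeideal q R \<longrightarrow> annihilator R M y \<subseteq> q \<longrightarrow> c \<in> q"
  let ?W = "range (\<lambda>k::nat. c [^]\<^bsub>R\<^esub> k)"
  show "\<exists>k::nat. c [^]\<^bsub>R\<^esub> k \<odot>\<^bsub>M\<^esub> y = \<zero>\<^bsub>M\<^esub>"
  proof (rule ccontr)
    assume "\<not> ?thesis"
    then have disj: "annihilator R M y \<inter> ?W = {}" by (auto simp: annihilator_def)
    have pow: "c [^]\<^bsub>R\<^esub> k \<in> ?W" for k :: nat by (rule rangeI)
    have WR: "?W \<subseteq> carrier R" using c by auto
    have W1: "\<one>\<^bsub>R\<^esub> \<in> ?W" using pow[of 0] by simp
    have Wm: "x \<otimes>\<^bsub>R\<^esub> y \<in> ?W" if "x \<in> ?W" "y \<in> ?W" for x y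
      using that c by (auto simp: R.nat_pow_mult)
    have "\<exists>q. primeideal q R \<and> annihilator R M y \<subseteq> q \<and> q \<inter> ?W = {} \<and>
        (\<forall>J. ideal J R \<longrightarrow> q \<subseteq> J \<longrightarrow> J \<inter> ?W = {} \<longrightarrow> J = q)"
      by (intro R.prime_avoiding[OF annihilator_ideal[OF y] WR W1] Wm disj)
    then obtain q where q: "primeideal q R" "annihilator R M y \<subseteq> q" "q \<inter> ?W = {}"
      by (elim exE conjE) rule
    have "c \<in> q" using * q(1,2) by blast
    moreover have "c \<in> ?W" using pow[of 1] c by simp
    ultimately show False using q(3) by blast
  qed
qed

text \<open>In this form large torsion is a condition on the closed set of primes over the
  annihilator, which behaves well under sums and products of multipliers, with no exponents to be
  tracked.\<close>

lemma (in module_ideal) large_torsion_prime_iff: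
  assumes x: "x \<in> carrier M"
  shows "x \<in> large_torsion R a M \<longleftrightarrow>
    (\<forall>q. primeideal q R \<longrightarrow> annihilator R M x \<subseteq> q \<longrightarrow> a \<subseteq> q)"
proof -
  have "x \<in> large_torsion R a M \<longleftrightarrow> (\<forall>g\<in>a. \<forall>q. primeideal q R \<longrightarrow> annihilator R M x \<subseteq> q \<longrightarrow> g \<in> q)"
    unfolding large_torsion_iff using nilpotent_on_iff[OF x aR] x by simp
  then show ?thesis by blast
qed

lemma (in module) annihilator_multiple:
  "x \<in> carrier M \<Longrightarrow> v \<in> carrier R \<Longrightarrow> annihilator R M x \<subseteq> annihilator R M (v \<odot>\<^bsub>M\<^esub> x)"
  by (auto simp: annihilator_def smult_comm[of _ v])

locale local_global = cring R + ideal a R for R (structure) and a +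
  fixes P :: ideal_property and U :: "'m itself"
  assumes local: "m \<in> max_Var R a \<Longrightarrow>
      has_property P TYPE('m) (loc_ring R (carrier R - m)) (loc_ideal R (carrier R - m) a)"
    and rho: "m \<in> max_Var R a \<Longrightarrow> rho_iso TYPE('m) R (carrier R - m) a"
begin

lemma ex_max_above:
  assumes "ideal I R" "\<one> \<notin> I" "a \<subseteq> I"
  obtains m where "m \<in> max_Var R a" "I \<subseteq> m" "primeideal m R"
  by (rule ex_max_Var[OF assms(1,2)]) (use assms(3) that in blast)

lemma max_prime: "m \<in> max_Var R a \<Longrightarrow> primeideal m R \<and> a \<subseteq> m"
  by (simp add: max_Var_def Var_def Spec_def)

lemma at_max:
  "module R M \<Longrightarrow> m \<in> max_Var R a \<Longrightarrow> module_at_prime R M a m"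
  using max_prime by (intro module_at_prime.intro module_ideal.intro module_at_prime_axioms.intro is_ideal) auto

lemma module_ideal: "module R M \<Longrightarrow> module_ideal R M a"
  by (intro module_ideal.intro is_ideal)

lemma local_property:
  fixes M :: "('a, 'm) module"
  assumes M: "module R M" and m: "m \<in> max_Var R a"
  shows "property_at P (loc_ring R (carrier R - m)) (loc_ideal R (carrier R - m) a)
    (loc_module R (carrier R - m) M)"
proof -
  interpret X: module_at_prime R M a m by (rule at_max[OF M m])
  obtain f :: "('m \<times> 'a) set \<Rightarrow> 'm" where "inj_on f (carrier X.L)" using X.loc_module_embeds by blast
  then show ?thesis by (rule has_property_embed[OF local[OF m] X.loc_is_module X.I.loc_ideal_ideal])
qed

lemma torsion_lift:
  fixes M :: "('a, 'm) module"
  assumes M: "module R M" and m: "m \<in> max_Var R a" and x: "x \<in> carrier M" "s \<in> carrier R - m"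
    and t: "frac R (carrier R - m) M x s \<in> torsion (loc_ring R (carrier R - m))
      (loc_ideal R (carrier R - m) a) (loc_module R (carrier R - m) M)"
  shows "\<exists>u\<in>carrier R - m. u \<odot>\<^bsub>M\<^esub> x \<in> torsion R a M"
proof -
  interpret X: module_at_prime R M a m by (rule at_max[OF M m])
  have iso: "rho R X.C a M \<in> module_iso X.T (loc_module R X.C (M\<lparr>carrier := torsion R a M\<rparr>))
      (X.L\<lparr>carrier := torsion X.T X.I.b X.L\<rparr>)"
    using rho[OF m] M unfolding rho_iso_def by blast
  obtain y w where y: "y \<in> torsion R a M" "w \<in> X.W" "X.fr x s = X.fr y w"
    using X.rho_surjective[OF iso t] .
  have yM: "y \<in> carrier M" using y(1) by (simp add: torsion_def)
  have sW: "s \<in> X.W" using x(2) X.W_eq by simp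
  obtain u where u: "u \<in> X.W" "u \<odot>\<^bsub>M\<^esub> (w \<odot>\<^bsub>M\<^esub> x) = u \<odot>\<^bsub>M\<^esub> (s \<odot>\<^bsub>M\<^esub> y)"
    using y(3) X.fr_eq_iff[OF x(1) yM sW y(2)] by blast
  have "(u \<otimes> w) \<odot>\<^bsub>M\<^esub> x = (u \<otimes> s) \<odot>\<^bsub>M\<^esub> y"
    using u y(2) sW x(1) yM by (simp add: X.smult_assoc1)
  also have "\<dots> \<in> torsion R a M" using X.torsion_smult[OF y(1)] u(1) sW by simp
  finally show ?thesis using X.W_mult[OF u(1) y(2)] unfolding X.W_eq by blast
qed

text \<open>For \<open>x\<close> in \<open>M\<close> the multipliers that make \<open>x\<close> torsion form an ideal.  A maximal ideal \<open>m\<close>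
  above it contains \<open>a\<close>, because it lies above a member of the weak assassin; the local
  property at \<open>m\<close> then produces a multiplier outside \<open>m\<close>.\<close>

lemma half_centred_at:
  fixes M :: "('a, 'm) module"
  assumes P: "P = Half_Centred" and M: "module R M"
  shows "property_at Half_Centred R a M"
proof -
  interpret M: module_ideal R M a by (rule module_ideal[OF M])
  have "weak_assassin R M \<subseteq> Var R a" if "torsion R a M = carrier M"
    using that M.torsion_sub_large M.large_torsion_min_ann unfolding weak_assassin_eq by blast
  moreover have "x \<in> torsion R a M" if V: "weak_assassin R M \<subseteq> Var R a" and x: "x \<in> carrier M" for x
  proof -
    define I where "I = {r \<in> carrier R. r \<odot>\<^bsub>M\<^esub> x \<in> torsion R a M}"
    have I: "ideal I R"
    proof (rule idealI[OF ring_axioms])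
      show "subgroup I (add_monoid R)"
      proof (rule group.subgroupI[OF a_group])
        show "I \<noteq> {}" using M.zero_torsion x unfolding I_def by (auto intro: exI[of _ "\<zero>"])
        show "inv\<^bsub>add_monoid R\<^esub> r \<in> I" if "r \<in> I" for r
        proof -
          have r: "r \<in> carrier R" "r \<odot>\<^bsub>M\<^esub> x \<in> torsion R a M" using that by (auto simp: I_def)
          have "(\<ominus> \<one>) \<odot>\<^bsub>M\<^esub> (r \<odot>\<^bsub>M\<^esub> x) \<in> torsion R a M" using M.torsion_smult[OF r(2)] by simp
          then have "\<ominus> r \<in> I" using r x by (simp add: I_def M.smult_l_minus)
          then show ?thesis by (simp add: a_inv_def)
        qed
      qed (use x M.torsion_add in \<open>auto simp: I_def M.smult_l_distr\<close>)
      show "r \<otimes> s \<in> I" "s \<otimes> r \<in> I" if "s \<in> I" "r \<in> carrier R" for s r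
        using that x M.torsion_smult[of "s \<odot>\<^bsub>M\<^esub> x" r] M.smult_comm[of s r x]
        by (auto simp: I_def M.smult_assoc1)
    qed
    have "\<one> \<in> I"
    proof (rule ccontr)
      assume "\<one> \<notin> I"
      then obtain m where m: "primeideal m R" "I \<subseteq> m" and max: "\<And>c. c \<subseteq> m \<Longrightarrow> m \<in> max_Var R c"
        using ex_max_Var[OF I] by blast
      have "annihilator R M x \<subseteq> m" using m(2) M.zero_torsion by (auto simp: I_def annihilator_def)
      then obtain p where p: "p \<in> min_Var R (annihilator R M x)" "p \<subseteq> m"
        using min_prime_below[OF m(1)] by blast
      then have "a \<subseteq> m" using V x unfolding weak_assassin_eq Var_def by blast
      then have mm: "m \<in> max_Var R a" by (rule max)
      interpret X: module_at_prime R M a m by (rule at_max[OF M mm])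
      have "q \<in> Var X.T X.I.b" if q: "q \<in> weak_assassin X.T X.L" for q
      proof -
        obtain X where X: "X \<in> carrier X.L" "q \<in> min_Var X.T (annihilator X.T X.L X)"
          using q unfolding weak_assassin_eq by blast
        obtain y s where y: "y \<in> carrier M" "s \<in> X.W" "X = X.fr y s" using X(1) unfolding X.loc_carrier by blast
        have "X.F.con q \<in> min_Var R (annihilator R M y)"
          using X.min_ann_fr[OF y(1,2)] X(2) y(3) by blast
        then have "a \<subseteq> X.F.con q" using V y(1) unfolding weak_assassin_eq Var_def by blast
        moreover have "q \<in> Spec X.T" using q by (simp add: weak_assassin_def)
        ultimately show ?thesis using X.F.con_Var unfolding Var_def by blast
      qed
      then have "torsion X.T X.I.b X.L = carrier X.L"
        using local_property[OF M mm] unfolding P by auto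
      moreover have one: "\<one> \<in> carrier R - m" using prime_one[OF m(1)] by simp
      moreover have "X.fr x \<one> \<in> carrier X.L" using x by simp
      ultimately obtain u where u: "u \<in> carrier R - m" "u \<odot>\<^bsub>M\<^esub> x \<in> torsion R a M"
        using torsion_lift[OF M mm x one] by blast
      then have "u \<in> I" by (simp add: I_def)
      then show False using m(2) u(1) by blast
    qed
    then show ?thesis using x by (simp add: I_def)
  qed
  moreover have "torsion R a M \<subseteq> carrier M" by (auto simp: torsion_def)
  ultimately show ?thesis by auto
qed

lemma lift_prime:
  fixes M :: "('a, 'm) module"
  assumes M: "module R M" and x: "x \<in> carrier M" and p: "p \<in> min_Var R (annihilator R M x)"
    and m: "m \<in> max_Var R a" and pm: "a \<subseteq> p" "p \<subseteq> m"
  defines "S \<equiv> carrier R - m"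
  obtains q where "q \<in> min_Var (loc_ring R S) (annihilator (loc_ring R S) (loc_module R S M) (frac R S M x \<one>))"
    "q \<in> weak_assassin (loc_ring R S) (loc_module R S M) \<inter> Var (loc_ring R S) (loc_ideal R S a)"
    "fraction_map.con R (\<lambda>r. frac R S (self_module R) r \<one>) q = p"
proof -
  interpret X: module_at_prime R M a m by (rule at_max[OF M m])
  have "p \<in> X.F.con ` min_Var X.T (annihilator X.T X.L (X.fr x \<one>))"
    using X.min_ann_fr[OF x X.W_one] p pm by blast
  then obtain q where q: "q \<in> min_Var X.T (annihilator X.T X.L (X.fr x \<one>))" "X.F.con q = p" by blast
  have xL: "X.fr x \<one> \<in> carrier X.L" using x by simp
  have "q \<in> Spec X.T" using q(1) by (simp add: min_Var_def Var_def)
  then have "q \<in> Var X.T X.I.b" using X.F.con_Var q(2) pm(1) unfolding Var_def by blast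
  then show thesis using that[of q] q xL unfolding S_def weak_assassin_eq by blast
qed

lemma prime_in_max:
  assumes p: "p \<in> weak_assassin R M \<inter> Var R a"
  obtains x m where "x \<in> carrier M" "p \<in> min_Var R (annihilator R M x)" "m \<in> max_Var R a" "a \<subseteq> p" "p \<subseteq> m"
proof -
  obtain x where x: "x \<in> carrier M" "p \<in> min_Var R (annihilator R M x)"
    using p unfolding weak_assassin_eq by blast
  have "primeideal p R" and ap: "a \<subseteq> p" using p by (auto simp: Var_def Spec_def)
  then obtain m where "m \<in> max_Var R a" "p \<subseteq> m"
    using ex_max_above[of p] primeideal.axioms(1) prime_one by metis
  then show thesis using that x ap by blast
qed

lemma centred_at:
  fixes M :: "('a, 'm) module"
  assumes P: "P = Centred" and M: "module R M"
  shows "property_at Centred R a M"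
proof -
  interpret M: module_ideal R M a by (rule module_ideal[OF M])
  have "x = \<zero>\<^bsub>M\<^esub>" if "weak_assassin R M \<inter> Var R a = {}" "x \<in> torsion R a M" for x
  proof -
    have "x \<in> carrier M" "x \<in> large_torsion R a M"
      using that(2) M.torsion_sub_large by (auto simp: torsion_def)
    then show ?thesis using that(1) M.ex_min_ann M.large_torsion_min_ann by blast
  qed
  moreover have "p \<notin> weak_assassin R M \<inter> Var R a" if z: "torsion R a M = {\<zero>\<^bsub>M\<^esub>}" for p
  proof
    assume "p \<in> weak_assassin R M \<inter> Var R a"
    then obtain x m where x: "x \<in> carrier M" "p \<in> min_Var R (annihilator R M x)" and
      m: "m \<in> max_Var R a" "a \<subseteq> p" "p \<subseteq> m" by (rule prime_in_max)
    interpret X: module_at_prime R M a m by (rule at_max[OF M m(1)])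
    obtain q where q: "q \<in> weak_assassin X.T X.L \<inter> Var X.T X.I.b"
      by (rule lift_prime[OF M x m])
    interpret L: module_ideal X.T X.L X.I.b
      by (intro module_ideal.intro X.loc_is_module X.I.loc_ideal_ideal)
    have "X = \<zero>\<^bsub>X.L\<^esub>" if t: "X \<in> torsion X.T X.I.b X.L" for X
    proof -
      have "X \<in> carrier X.L" using t by (simp add: torsion_def)
      then obtain y s where y: "y \<in> carrier M" "s \<in> X.W" "X = X.fr y s" unfolding X.loc_carrier by blast
      then obtain u where "u \<in> X.W" "u \<odot>\<^bsub>M\<^esub> y \<in> torsion R a M"
        using torsion_lift[OF M m(1) y(1)] t unfolding X.W_eq by blast
      then show ?thesis using X.fr_zero_iff[OF y(1,2)] y(3) z by blast
    qed
    then have "torsion X.T X.I.b X.L = {\<zero>\<^bsub>X.L\<^esub>}" using L.zero_torsion by blast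
    then show False using local_property[OF M m(1)] q unfolding P by auto
  qed
  ultimately show ?thesis using M.zero_torsion by auto
qed

lemma weakly_quasifair_at:
  fixes M :: "('a, 'm) module"
  assumes P: "P = Weakly_Quasifair" and M: "module R M"
  shows "property_at Weakly_Quasifair R a M"
proof -
  interpret M: module_ideal R M a by (rule module_ideal[OF M])
  have "weak_assassin R (M\<lparr>carrier := torsion R a M\<rparr>) \<subseteq> weak_assassin R M \<inter> Var R a"
    using M.large_torsion_min_ann M.torsion_sub_large unfolding weak_assassin_on by blast
  moreover have "p \<in> weak_assassin R (M\<lparr>carrier := torsion R a M\<rparr>)"
    if pA: "p \<in> weak_assassin R M \<inter> Var R a" for p
  proof -
    obtain x m where x: "x \<in> carrier M" "p \<in> min_Var R (annihilator R M x)" and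
      m: "m \<in> max_Var R a" "a \<subseteq> p" "p \<subseteq> m" using pA by (rule prime_in_max)
    interpret X: module_at_prime R M a m by (rule at_max[OF M m(1)])
    obtain q where q: "q \<in> weak_assassin X.T X.L \<inter> Var X.T X.I.b" and con: "X.F.con q = p"
      by (rule lift_prime[OF M x m])
    then have "q \<in> weak_assassin X.T (X.L\<lparr>carrier := torsion X.T X.I.b X.L\<rparr>)"
      using local_property[OF M m(1)] unfolding P by simp
    then obtain X where X: "X \<in> torsion X.T X.I.b X.L" "q \<in> min_Var X.T (annihilator X.T X.L X)"
      unfolding weak_assassin_on by blast
    then have "X \<in> carrier X.L" by (simp add: torsion_def)
    then obtain y s where y: "y \<in> carrier M" "s \<in> X.W" "X = X.fr y s" unfolding X.loc_carrier by blast
    then obtain u where u: "u \<in> carrier R - m" "u \<odot>\<^bsub>M\<^esub> y \<in> torsion R a M"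
      using torsion_lift[OF M m(1) y(1)] X(1) unfolding X.W_eq by blast
    have "p \<in> min_Var R (annihilator R M y)" using X.min_ann_fr[OF y(1,2)] X(2) y(3) con by blast
    moreover have "u \<in> carrier R - p" using u(1) m(3) by blast
    ultimately have "p \<in> min_Var R (annihilator R M (u \<odot>\<^bsub>M\<^esub> y))" using y(1) by (intro M.min_ann_multiple)
    then show ?thesis using u(2) unfolding weak_assassin_on by blast
  qed
  ultimately show ?thesis by auto
qed

text \<open>The hypothesis says that \<open>y / 1\<close> is in the large torsion of \<open>M\<^sub>m\<close>.  Let \<open>J\<close> be the radical
  of the annihilator of \<open>y\<close>, and \<open>N = J y\<close>.  In \<open>M / N\<close> the annihilator of \<open>y\<close> is the radical ideal
  \<open>J\<close>, so that all exponents become \<open>1\<close> and \<open>y / 1\<close> becomes torsion in \<open>(M / N)\<^sub>m\<close>.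
  Surjectivity of \<open>\<rho>\<close> for \<open>M / N\<close> gives a single denominator \<open>u\<close> for all elements of
  \<open>a\<close>.\<close>

lemma radical_quotient_lift:
  fixes M :: "('a, 'm) module"
  assumes M: "module R M" and m: "m \<in> max_Var R a" and y: "y \<in> carrier M"
    and nil: "\<And>g. g \<in> a \<Longrightarrow> \<exists>w\<in>carrier R - m. \<exists>k::nat. w \<odot>\<^bsub>M\<^esub> (g [^] k \<odot>\<^bsub>M\<^esub> y) = \<zero>\<^bsub>M\<^esub>"
  shows "\<exists>u\<in>carrier R - m. \<forall>q. primeideal q R \<longrightarrow> annihilator R M y \<subseteq> q \<longrightarrow> u \<in> q \<or> a \<subseteq> q"
proof -
  interpret M: module_ideal R M a by (rule module_ideal[OF M])
  define J where "J = {c \<in> carrier R. \<forall>q. primeideal q R \<longrightarrow> annihilator R M y \<subseteq> q \<longrightarrow> c \<in> q}"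
  define N where "N = (\<lambda>c. c \<odot>\<^bsub>M\<^esub> y) ` J"
  have J_mult: "r \<otimes> c \<in> J" if "r \<in> carrier R" "c \<in> J" for r c
    using that prime_mult_iff by (simp add: J_def)
  have J_add: "c \<oplus> d \<in> J" if "c \<in> J" "d \<in> J" for c d
    using that unfolding J_def
    by (auto intro: additive_subgroup.a_closed ideal.axioms(1) primeideal.axioms(1))
  have J0: "\<zero> \<in> J" using prime_zero by (simp add: J_def)
  have JR: "c \<in> J \<Longrightarrow> c \<in> carrier R" for c by (simp add: J_def)
  have N: "submodule N R M"
  proof (rule M.submoduleI)
    show "N \<subseteq> carrier M" using y JR by (auto simp: N_def)
    show "\<zero>\<^bsub>M\<^esub> \<in> N" unfolding N_def using J0 y by (intro image_eqI[of _ _ "\<zero>"]) simp_all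
    fix z assume "z \<in> N"
    then obtain c where c: "c \<in> J" "z = c \<odot>\<^bsub>M\<^esub> y" by (auto simp: N_def)
    show smult: "r \<odot>\<^bsub>M\<^esub> z \<in> N" if "r \<in> carrier R" for r
      unfolding N_def using J_mult[OF that c(1)] that c y JR
      by (intro image_eqI[of _ _ "r \<otimes> c"]) (simp_all add: M.smult_assoc1)
    show "\<ominus>\<^bsub>M\<^esub> z \<in> N" using smult[of "\<ominus> \<one>"] c y JR by (simp add: M.smult_l_minus)
    fix z' assume "z' \<in> N"
    then obtain d where d: "d \<in> J" "z' = d \<odot>\<^bsub>M\<^esub> y" by (auto simp: N_def)
    show "z \<oplus>\<^bsub>M\<^esub> z' \<in> N" unfolding N_def using J_add[OF c(1) d(1)] c d y JR
      by (intro image_eqI[of _ _ "c \<oplus> d"]) (simp_all add: M.smult_l_distr)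
  qed
  have N_iff: "c \<odot>\<^bsub>M\<^esub> y \<in> N \<longleftrightarrow> c \<in> J" if c: "c \<in> carrier R" for c
  proof
    assume "c \<odot>\<^bsub>M\<^esub> y \<in> N"
    then obtain d where d: "d \<in> J" "c \<odot>\<^bsub>M\<^esub> y = d \<odot>\<^bsub>M\<^esub> y" by (auto simp: N_def)
    then have "c \<ominus> d \<in> annihilator R M y"
      using c y JR[OF d(1)] M.smult_minus_eq_zero by (simp add: annihilator_def)
    then have "c \<ominus> d \<in> J" using c JR[OF d(1)] by (auto simp: J_def)
    then have "(c \<ominus> d) \<oplus> d \<in> J" using J_add d(1) by blast
    then show "c \<in> J" using c JR[OF d(1)] by (simp add: minus_eq a_assoc l_neg)
  qed (auto simp: N_def)
  define \<pi> where "\<pi> = quotient_rep M N"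
  note quot = quotient_module[OF M N, folded \<pi>_def]
  interpret \<pi>: module_congruence R M \<pi> by (rule quot(1))
  have zero: "\<pi> z = \<zero>\<^bsub>\<pi>.Q\<^esub> \<longleftrightarrow> z \<in> N" if "z \<in> carrier M" for z
    using quot(3)[OF that] by (simp add: \<pi>.image_zero)
  interpret X: module_at_prime R \<pi>.Q a m by (rule at_max[OF \<pi>.image_is_module m])
  have yQ: "\<pi> y \<in> carrier \<pi>.Q" using y by (simp add: \<pi>.image_carrier)
  have "\<beta> \<odot>\<^bsub>X.L\<^esub> X.fr (\<pi> y) \<one> = \<zero>\<^bsub>X.L\<^esub>" if \<beta>: "\<beta> \<in> X.I.b" for \<beta>
  proof -
    obtain g s where g: "g \<in> a" "s \<in> X.W" "\<beta> = X.fR g s" using \<beta> unfolding X.I.loc_ideal_iff by blast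
    have gR: "g \<in> carrier R" using Icarr[OF g(1)] .
    obtain w and k :: nat where w: "w \<in> carrier R - m" "w \<odot>\<^bsub>M\<^esub> (g [^] k \<odot>\<^bsub>M\<^esub> y) = \<zero>\<^bsub>M\<^esub>"
      using nil[OF g(1)] by blast
    have "w \<otimes> g [^] k \<in> annihilator R M y" using w gR y by (simp add: annihilator_def M.smult_assoc1)
    then have "w \<otimes> g \<in> q" if q: "primeideal q R" "annihilator R M y \<subseteq> q" for q
    proof -
      have "w \<otimes> g [^] k \<in> q" using that \<open>w \<otimes> g [^] k \<in> annihilator R M y\<close> by blast
      then have "w \<in> q \<or> g \<in> q"
        using prime_mult_iff[OF q(1), of w "g [^] k"] prime_powD[OF q(1) gR] w(1) gR by auto
      then show ?thesis using prime_mult_iff[OF q(1)] w(1) gR by auto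
    qed
    then have "w \<otimes> g \<in> J" using w(1) gR by (simp add: J_def)
    then have "w \<odot>\<^bsub>\<pi>.Q\<^esub> (g \<odot>\<^bsub>\<pi>.Q\<^esub> \<pi> y) = \<zero>\<^bsub>\<pi>.Q\<^esub>"
      using w(1) gR y zero[of "w \<odot>\<^bsub>M\<^esub> (g \<odot>\<^bsub>M\<^esub> y)"] N_iff[of "w \<otimes> g"]
      by (simp add: \<pi>.image_smult M.smult_assoc1)
    then have "X.fr (g \<odot>\<^bsub>\<pi>.Q\<^esub> \<pi> y) s = \<zero>\<^bsub>X.L\<^esub>"
      using X.fr_zero_iff[of "g \<odot>\<^bsub>\<pi>.Q\<^esub> \<pi> y" s] g(2) gR yQ w(1) X.W_eq by auto
    then show ?thesis using g gR yQ by (simp add: X.loc_smult)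
  qed
  then have "power_kills X.I.b X.L 1 (X.fr (\<pi> y) \<one>)" by simp
  moreover interpret L: module_ideal X.T X.L X.I.b
    by (intro module_ideal.intro X.loc_is_module X.I.loc_ideal_ideal)
  have "X.fr (\<pi> y) \<one> \<in> carrier X.L" using yQ by simp
  ultimately have "X.fr (\<pi> y) \<one> \<in> torsion X.T X.I.b X.L" unfolding L.torsion_iff by blast
  moreover have "\<one> \<in> carrier R - m" using prime_one max_prime[OF m] by blast
  ultimately obtain u where u: "u \<in> carrier R - m" "u \<odot>\<^bsub>\<pi>.Q\<^esub> \<pi> y \<in> torsion R a \<pi>.Q"
    using torsion_lift[OF \<pi>.image_is_module m yQ] by blast
  obtain l where l: "power_kills a \<pi>.Q l (u \<odot>\<^bsub>\<pi>.Q\<^esub> \<pi> y)" using u(2) X.torsion_iff by blast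
  have "u \<in> q \<or> g \<in> q" if q: "primeideal q R" "annihilator R M y \<subseteq> q" and g: "g \<in> a" for q g
  proof -
    have gR: "g \<in> carrier R" using Icarr[OF g] .
    have "g [^] l \<odot>\<^bsub>\<pi>.Q\<^esub> (u \<odot>\<^bsub>\<pi>.Q\<^esub> \<pi> y) = \<zero>\<^bsub>\<pi>.Q\<^esub>"
      using X.power_kills_pow[OF l _ g] u(1) yQ by simp
    then have "(g [^] l \<otimes> u) \<odot>\<^bsub>M\<^esub> y \<in> N"
      using gR u(1) y zero[of "g [^] l \<odot>\<^bsub>M\<^esub> (u \<odot>\<^bsub>M\<^esub> y)"] by (simp add: \<pi>.image_smult M.smult_assoc1)
    then have "g [^] l \<otimes> u \<in> q" using N_iff[of "g [^] l \<otimes> u"] gR u(1) q by (simp add: J_def)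
    then have "g [^] l \<in> q \<or> u \<in> q" using prime_mult_iff[OF q(1), of "g [^] l" u] gR u(1) by simp
    then show ?thesis using prime_powD[OF q(1) gR] by blast
  qed
  then show ?thesis using u(1) by blast
qed

text \<open>If \<open>p\<close> lies below \<open>m\<close>, then the multiplier \<open>v\<close> is the numerator of the one that exists in
  the localisation at \<open>m\<close>.  Otherwise \<open>p\<close> contains some \<open>r\<close> outside \<open>m\<close>, and a power of \<open>r\<close>
  kills a multiple \<open>v x\<close> by minimality of \<open>p\<close>.\<close>

lemma large_torsion_near:
  fixes M :: "('a, 'm) module"
  assumes P: "P = Weakly_Large_Quasifair" and M: "module R M" and m: "m \<in> max_Var R a"
    and x: "x \<in> carrier M" and p: "p \<in> min_Var R (annihilator R M x)" "a \<subseteq> p"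
  shows "\<exists>v\<in>carrier R - p. \<exists>u\<in>carrier R - m. \<forall>q. primeideal q R \<longrightarrow>
    annihilator R M (v \<odot>\<^bsub>M\<^esub> x) \<subseteq> q \<longrightarrow> u \<in> q \<or> a \<subseteq> q"
proof -
  interpret M: module_ideal R M a by (rule module_ideal[OF M])
  note P' = p(1)[unfolded M.min_ann_iff[OF x]]
  then have pp: "primeideal p R" by blast
  show ?thesis
  proof (cases "p \<subseteq> m")
    case True
    interpret X: module_at_prime R M a m by (rule at_max[OF M m])
    interpret L: module_ideal X.T X.L X.I.b
      by (intro module_ideal.intro X.loc_is_module X.I.loc_ideal_ideal)
    obtain q where q: "q \<in> min_Var X.T (annihilator X.T X.L (X.fr x \<one>))"
      "q \<in> weak_assassin X.T X.L \<inter> Var X.T X.I.b" "X.F.con q = p"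
      by (rule lift_prime[OF M x p(1) m p(2) True])
    have qp: "primeideal q X.T" and bq: "X.I.b \<subseteq> q" using q(2) by (auto simp: Var_def Spec_def)
    obtain f :: "('m \<times> 'a) set \<Rightarrow> 'm" where f: "inj_on f (carrier X.L)" using X.loc_module_embeds by blast
    have xL: "X.fr x \<one> \<in> carrier X.L" using x by simp
    obtain v where v: "v \<in> carrier X.T - q" "v \<odot>\<^bsub>X.L\<^esub> X.fr x \<one> \<in> large_torsion X.T X.I.b X.L"
      using weakly_large_quasifair_multiplier[OF local[OF m, unfolded P] X.loc_is_module
          X.I.loc_ideal_ideal f xL q(1) bq] by blast
    obtain r w where r: "r \<in> carrier R" "w \<in> X.W" "X.I.\<phi> w \<otimes>\<^bsub>X.T\<^esub> v = X.I.\<phi> r"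
      using X.F.numerator v(1) by blast
    have rp: "r \<in> carrier R - p"
      using X.F.mem_iff_numerator[OF qp _ r(2,1,3)] v(1) r(1) q(3) by blast
    have wT: "X.I.\<phi> w \<in> carrier X.T" using r(2) by simp
    have "X.I.\<phi> w \<odot>\<^bsub>X.L\<^esub> (v \<odot>\<^bsub>X.L\<^esub> X.fr x \<one>) \<in> large_torsion X.T X.I.b X.L"
      using L.large_torsion_smult[OF v(2) wT] .
    also have "X.I.\<phi> w \<odot>\<^bsub>X.L\<^esub> (v \<odot>\<^bsub>X.L\<^esub> X.fr x \<one>) = X.I.\<phi> r \<odot>\<^bsub>X.L\<^esub> X.fr x \<one>"
      unfolding r(3)[symmetric] using wT v(1) xL by (simp add: X.F.N.smult_assoc1)
    also have "\<dots> = X.fr (r \<odot>\<^bsub>M\<^esub> x) \<one>" using r(1) x by (simp add: X.loc_smult)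
    finally have rx: "X.fr (r \<odot>\<^bsub>M\<^esub> x) \<one> \<in> large_torsion X.T X.I.b X.L" .
    have "\<exists>w\<in>carrier R - m. \<exists>k::nat. w \<odot>\<^bsub>M\<^esub> (g [^] k \<odot>\<^bsub>M\<^esub> (r \<odot>\<^bsub>M\<^esub> x)) = \<zero>\<^bsub>M\<^esub>"
      if g: "g \<in> a" for g
    proof -
      have gR: "g \<in> carrier R" using Icarr[OF g] .
      obtain k :: nat where "X.I.\<phi> g [^]\<^bsub>X.T\<^esub> k \<odot>\<^bsub>X.L\<^esub> X.fr (r \<odot>\<^bsub>M\<^esub> x) \<one> = \<zero>\<^bsub>X.L\<^esub>"
        using rx X.F.b_image[OF g] unfolding L.large_torsion_iff by blast
      then have "X.I.\<phi> (g [^] k) \<odot>\<^bsub>X.L\<^esub> X.fr (r \<odot>\<^bsub>M\<^esub> x) \<one> = \<zero>\<^bsub>X.L\<^esub>"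
        unfolding X.F.\<phi>_pow[OF gR] .
      then have "X.fr (g [^] k \<odot>\<^bsub>M\<^esub> (r \<odot>\<^bsub>M\<^esub> x)) \<one> = \<zero>\<^bsub>X.L\<^esub>"
        using gR r(1) x by (simp add: X.loc_smult)
      then obtain w where "w \<in> X.W" "w \<odot>\<^bsub>M\<^esub> (g [^] k \<odot>\<^bsub>M\<^esub> (r \<odot>\<^bsub>M\<^esub> x)) = \<zero>\<^bsub>M\<^esub>"
        using X.fr_zero_iff[of "g [^] k \<odot>\<^bsub>M\<^esub> (r \<odot>\<^bsub>M\<^esub> x)" \<one>] gR r(1) x by auto
      then show ?thesis unfolding X.W_eq by blast
    qed
    then show ?thesis
      using radical_quotient_lift[OF M m M.smult_closed[OF r(1) x]] rp by blast
  next
    case False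
    then obtain r where r: "r \<in> p" "r \<notin> m" by blast
    have rR: "r \<in> carrier R" using prime_carr[OF pp r(1)] .
    obtain t and n :: nat where t: "t \<in> carrier R - p" "t \<odot>\<^bsub>M\<^esub> (r [^] n \<odot>\<^bsub>M\<^esub> x) = \<zero>\<^bsub>M\<^esub>"
      using P' r by blast
    have "r [^] n \<odot>\<^bsub>M\<^esub> (t \<odot>\<^bsub>M\<^esub> x) = \<zero>\<^bsub>M\<^esub>" using t rR x M.smult_comm[of t "r [^] n" x] by simp
    then have "r [^] n \<in> annihilator R M (t \<odot>\<^bsub>M\<^esub> x)" using rR by (simp add: annihilator_def)
    moreover have "r [^] n \<in> carrier R - m" using prime_powD max_prime[OF m] r(2) rR by blast
    ultimately show ?thesis using t(1) by blast
  qed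
qed

text \<open>No maximal ideal over \<open>a\<close> contains all the elements \<open>u\<close> that the previous lemma provides,
  for varying \<open>m\<close>.  So they generate the unit ideal together with \<open>a\<close>, and \<open>1 = u + f\<close> serves as a
  partition of unity.\<close>

lemma weakly_large_quasifair_at:
  fixes M :: "('a, 'm) module"
  assumes P: "P = Weakly_Large_Quasifair" and M: "module R M"
  shows "property_at Weakly_Large_Quasifair R a M"
proof -
  interpret M: module_ideal R M a by (rule module_ideal[OF M])
  have "weak_assassin R (M\<lparr>carrier := large_torsion R a M\<rparr>) \<subseteq> weak_assassin R M \<inter> Var R a"
    using M.large_torsion_min_ann unfolding weak_assassin_on by blast
  moreover have "p \<in> weak_assassin R (M\<lparr>carrier := large_torsion R a M\<rparr>)"
    if pA: "p \<in> weak_assassin R M \<inter> Var R a" for p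
  proof -
    have ap: "a \<subseteq> p" and pp: "primeideal p R" using pA by (auto simp: Var_def Spec_def)
    obtain x where x: "x \<in> carrier M" "p \<in> min_Var R (annihilator R M x)"
      using pA unfolding weak_assassin_eq by blast
    define good where "good u v \<longleftrightarrow> (\<forall>q. primeideal q R \<longrightarrow>
      annihilator R M (v \<odot>\<^bsub>M\<^esub> x) \<subseteq> q \<longrightarrow> u \<in> q \<or> a \<subseteq> q)" for u v
    define W where "W = {u \<in> carrier R. \<exists>v\<in>carrier R - p. good u v}"
    have mult: "r \<otimes> u \<in> W" if "u \<in> W" and r: "r \<in> carrier R" for u r
    proof -
      obtain v where v: "v \<in> carrier R - p" "good u v" and u: "u \<in> carrier R"
        using \<open>u \<in> W\<close> unfolding W_def by blast
      have "good (r \<otimes> u) v" using v(2) prime_mult_iff[OF _ r u] unfolding good_def by blast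
      then show ?thesis using v(1) u r unfolding W_def by blast
    qed
    have W: "ideal W R"
    proof (rule idealI[OF ring_axioms])
      show "subgroup W (add_monoid R)"
      proof (rule group.subgroupI[OF a_group])
        have "good \<zero> \<one>" unfolding good_def using prime_zero by blast
        then have "\<zero> \<in> W" using prime_one[OF pp] unfolding W_def by blast
        then show "W \<noteq> {}" by blast
        show "inv\<^bsub>add_monoid R\<^esub> u \<in> W" if u: "u \<in> W" for u
        proof -
          have "\<ominus> u \<in> W" using mult[OF u, of "\<ominus> \<one>"] u by (simp add: W_def l_minus)
          then show ?thesis by (simp add: a_inv_def)
        qed
        show "u \<otimes>\<^bsub>add_monoid R\<^esub> u' \<in> W" if "u \<in> W" "u' \<in> W" for u u'
        proof -
          obtain v v' where v: "v \<in> carrier R - p" "v' \<in> carrier R - p" "good u v" "good u' v'"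
            using \<open>u \<in> W\<close> \<open>u' \<in> W\<close> unfolding W_def by blast
          have uR: "u \<in> carrier R" "u' \<in> carrier R" using that by (auto simp: W_def)
          have "annihilator R M (v \<odot>\<^bsub>M\<^esub> x) \<subseteq> annihilator R M ((v \<otimes> v') \<odot>\<^bsub>M\<^esub> x)"
            "annihilator R M (v' \<odot>\<^bsub>M\<^esub> x) \<subseteq> annihilator R M ((v \<otimes> v') \<odot>\<^bsub>M\<^esub> x)"
            using M.annihilator_multiple[of "v \<odot>\<^bsub>M\<^esub> x" v'] M.annihilator_multiple[of "v' \<odot>\<^bsub>M\<^esub> x" v]
              v(1,2) x(1) M.smult_comm[of v' v x] by (simp_all add: M.smult_assoc1)
          moreover have "u \<oplus> u' \<in> q" if "primeideal q R" "u \<in> q" "u' \<in> q" for q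
            using that by (auto intro: additive_subgroup.a_closed ideal.axioms(1) primeideal.axioms(1))
          ultimately have "good (u \<oplus> u') (v \<otimes> v')"
            using v(3,4) unfolding good_def by (meson subset_trans)
          moreover have "v \<otimes> v' \<in> carrier R - p" using v(1,2) prime_mult_iff[OF pp] by auto
          ultimately show ?thesis using uR by (auto simp: W_def)
        qed
      qed (auto simp: W_def)
      show "u \<otimes> r \<in> W" if "u \<in> W" "r \<in> carrier R" for u r
        using mult[OF that] that m_comm[of u r] by (simp add: W_def)
    qed (use mult in blast)
    let ?K = "W <+>\<^bsub>R\<^esub> a"
    have K: "ideal ?K R" by (rule add_ideals[OF W is_ideal])
    have "\<one> \<in> ?K"
    proof (rule ccontr)
      assume one: "\<one> \<notin> ?K"
      have WK: "u \<in> ?K" if "u \<in> W" for u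
      proof -
        have "u = u \<oplus> \<zero>" using that by (simp add: W_def)
        then show ?thesis using that zero_closed unfolding set_add_def' by blast
      qed
      have "a \<subseteq> ?K"
      proof
        fix f assume f: "f \<in> a"
        have "f = \<zero> \<oplus> f" using Icarr[OF f] by simp
        moreover have "\<zero> \<in> W" using additive_subgroup.zero_closed[OF ideal.axioms(1)[OF W]] .
        ultimately show "f \<in> ?K" using f unfolding set_add_def' by blast
      qed
      then obtain m where m: "m \<in> max_Var R a" "?K \<subseteq> m" using ex_max_above[OF K one] by metis
      obtain v u where "v \<in> carrier R - p" "u \<in> carrier R - m" "good u v"
        using large_torsion_near[OF P M m(1) x ap] unfolding good_def by blast
      then have "u \<in> W" "u \<notin> m" by (auto simp: W_def)
      then show False using WK m(2) by blast
    qed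
    then obtain u f where uf: "u \<in> W" "f \<in> a" "\<one> = u \<oplus> f" unfolding set_add_def' by blast
    then obtain v where v: "v \<in> carrier R - p" "good u v" and uR: "u \<in> carrier R" by (auto simp: W_def)
    have fR: "f \<in> carrier R" using Icarr[OF uf(2)] .
    have cover: "u \<in> q \<Longrightarrow> f \<in> q \<Longrightarrow> \<not> primeideal q R" for q
      using uf(3) prime_one[of q] additive_subgroup.a_closed[of q R u f] ideal.axioms(1) primeideal.axioms(1)
      by metis
    let ?y = "v \<odot>\<^bsub>M\<^esub> x"
    have y: "?y \<in> carrier M" using v(1) x(1) by simp
    have "u \<otimes> f \<in> q" if q: "primeideal q R" "annihilator R M ?y \<subseteq> q" for q
      using v(2) q uf(2) prime_mult_iff[OF q(1) uR fR] unfolding good_def by blast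
    then obtain N :: nat where N: "(u \<otimes> f) [^] N \<odot>\<^bsub>M\<^esub> ?y = \<zero>\<^bsub>M\<^esub>"
      using M.nilpotent_on_iff[OF y, of "u \<otimes> f"] uR fR by auto
    \<comment> \<open>Each prime over the annihilator of \<open>v x\<close> contains \<open>u\<close> or \<open>f\<close>, never both.  Multiplication
      by \<open>u\<^sup>N\<close> leaves only those that contain \<open>f\<close>.\<close>
    define z where "z = u [^] N \<odot>\<^bsub>M\<^esub> ?y"
    have zM: "z \<in> carrier M" using uR y by (simp add: z_def)
    have "f [^] N \<odot>\<^bsub>M\<^esub> z = \<zero>\<^bsub>M\<^esub>"
      using N uR fR y m_comm[of u f] by (simp add: z_def nat_pow_distrib M.smult_assoc1)
    then have fz: "f [^] N \<in> annihilator R M z" using fR by (simp add: annihilator_def)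
    have "a \<subseteq> q" if q: "primeideal q R" "annihilator R M z \<subseteq> q" for q
    proof -
      have "f \<in> q" using fz q prime_powD[OF q(1) fR] by blast
      then have "u \<notin> q" using cover q(1) by blast
      moreover have "annihilator R M ?y \<subseteq> q"
        using M.annihilator_multiple[OF y, of "u [^] N"] uR q(2) by (simp add: z_def)
      ultimately show ?thesis using v(2) q(1) unfolding good_def by blast
    qed
    then have "z \<in> large_torsion R a M" using M.large_torsion_prime_iff[OF zM] by blast
    moreover have "u \<notin> p" using cover uf(2) ap pp by blast
    then have "u [^] N \<in> carrier R - p" using prime_powD[OF pp uR] uR by auto
    then have "p \<in> min_Var R (annihilator R M z)"
      unfolding z_def using M.min_ann_multiple[OF M.min_ann_multiple[OF x(2,1) v(1)] y] by blast
    ultimately show ?thesis unfolding weak_assassin_on by blast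
  qed
  ultimately show ?thesis by auto
qed

lemma has_property_from_local: "has_property P TYPE('m) R a"
  unfolding has_property_iff
  using half_centred_at centred_at weakly_quasifair_at weakly_large_quasifair_at by (cases P) auto

end

theorem mainTheorem10:
  fixes R :: "('a, 'b) ring_scheme" and a :: "'a set" and P :: ideal_property
  assumes "cring R" and "ideal a R"
  defines "stmt1 \<equiv> has_property P TYPE('m) R a"
    and "stmt2 \<equiv> \<forall>S. S \<subseteq> carrier R \<longrightarrow>
      has_property P TYPE('m) (loc_ring R S) (loc_ideal R S a)"
    and "stmt3 \<equiv> \<forall>m\<in>max_Var R a.
      has_property P TYPE('m) (loc_ring R (carrier R - m)) (loc_ideal R (carrier R - m) a)"
  shows "(stmt1 \<longrightarrow> stmt2) \<and> (stmt2 \<longrightarrow> stmt3) \<and>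
    ((\<forall>m\<in>max_Var R a. rho_iso TYPE('m) R (carrier R - m) a) \<longrightarrow>
      (stmt1 \<longleftrightarrow> stmt2) \<and> (stmt2 \<longleftrightarrow> stmt3))"
proof -
  have 12: stmt2 if stmt1
    unfolding stmt2_def
  proof (intro allI impI)
    fix S assume "S \<subseteq> carrier R"
    then interpret ideal_fractions R S a
      using assms(1,2) by (intro ideal_fractions.intro ring_fractions.intro ring_fractions_axioms.intro)
    show "has_property P TYPE('m) (loc_ring R S) (loc_ideal R S a)"
      using has_property_localises \<open>stmt1\<close> unfolding stmt1_def by blast
  qed
  have 23: stmt3 if stmt2 using that unfolding stmt2_def stmt3_def by blast
  have 31: stmt1 if rho: "\<forall>m\<in>max_Var R a. rho_iso TYPE('m) R (carrier R - m) a" and 3: stmt3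
  proof -
    interpret local_global R a P "TYPE('m)"
      by (intro local_global.intro local_global_axioms.intro assms(1,2))
        (use rho 3 in \<open>auto simp: stmt3_def\<close>)
    show ?thesis unfolding stmt1_def by (rule has_property_from_local)
  qed
  show ?thesis using 12 23 31 by blast
qed

end
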